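(* Circulant graphs of prime order $p$ and vertex degree $\Delta$ admit a canonical labeling computable in time $\mathcal{O}(\Delta\, p\log p)$.
   Context: Graphs are directed graphs without loops (undirected graphs are the special case of a symmetric edge relation). For a finite group $H$ with neutral element $e$ and $S\subseteq H\setminus\{e\}$, the Cayley graph $\mathrm{Cay}(H,S)$ has vertex set $H$ and edge set $\{(h,sh): h\in H, s\in S\}$. A circulant graph of order $n$ is a Cayley graph over the cyclic group $\mathbb{Z}_n$. A canonical labeling for a class of graphs is a function that assigns to each graph $G$ in the class on $n$ vertices a bijection $\lambda_G: V(G)\to\{1,\dots,n\}$ such that whenever $G$ and $H$ in the class are isomorphic, the relabeled graphs $\lambda_G(G)$ and $\lambda_H(H)$ on $\{1,\dots,n\}$ are equal. *)

theory Defs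
  imports Complex_Main "HOL-Computational_Algebra.Primes" "HOL-Algebra.Elementary_Groups" "Graph_Theory.Graph_Theory"
begin

section \<open>Circulant graphs and canonical labelings\<close>

definition cayley_digraph :: "('a, 'b) monoid_scheme \<Rightarrow> 'a set \<Rightarrow> 'a pair_pre_digraph" where
  "cayley_digraph H S =
     \<lparr>pverts = carrier H, parcs = {(h, s \<otimes>\<^bsub>H\<^esub> h) | h s. h \<in> carrier H \<and> s \<in> S}\<rparr>"

text \<open>
  Being circulant is a property of the isomorphism type: a representation of the graph as a
  Cayley graph exists but is not part of the data.
\<close>

definition circulant_graph :: "nat \<Rightarrow> 'a pair_pre_digraph \<Rightarrow> bool" where
  "circulant_graph n G \<longleftrightarrow> 0 < n \<and>
     (\<exists>S \<subseteq> carrier (integer_mod_group n) - {\<one>\<^bsub>integer_mod_group n\<^esub>}.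
        digraph_iso (with_proj G) (with_proj (cayley_digraph (integer_mod_group n) S)))"

text \<open>The circulant graphs of order \<open>n\<close> as they are presented to an algorithm.\<close>

definition circulant_graphs :: "nat \<Rightarrow> nat pair_pre_digraph set" where
  "circulant_graphs n = {G. pverts G = {0..<n} \<and> circulant_graph n G}"

definition relabel :: "('a \<Rightarrow> 'b) \<Rightarrow> 'a pair_pre_digraph \<Rightarrow> 'b pair_pre_digraph" where
  "relabel f G = \<lparr>pverts = f ` pverts G, parcs = (\<lambda>(u, v). (f u, f v)) ` parcs G\<rparr>"

definition canonical_labeling ::
  "'a pair_pre_digraph set \<Rightarrow> ('a pair_pre_digraph \<Rightarrow> 'a \<Rightarrow> nat) \<Rightarrow> bool" where
  "canonical_labeling \<C> lab \<longleftrightarrow>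
     (\<forall>G\<in>\<C>. bij_betw (lab G) (pverts G) {1..card (pverts G)}) \<and>
     (\<forall>G\<in>\<C>. \<forall>H\<in>\<C>. digraph_iso (with_proj G) (with_proj H) \<longrightarrow> relabel (lab G) G = relabel (lab H) H)"


section \<open>Word RAM\<close>

text \<open>
  Programs of a random access machine with unit-cost operations on bounded words, with structured
  control flow instead of jumps. A program mentions finitely many registers; memory cells
  are addressed indirectly. Subtraction is truncated and division by zero yields zero.
\<close>

datatype binop = Add | Sub | Mul | Div

datatype expr = Const nat | Reg nat | Mem expr | Bin binop expr expr

datatype cond = Less expr expr | Not cond | And cond cond

datatype prog =
    Skip
  | Assign nat expr
  | Store expr expr
  | Seq prog prog
  | If cond prog prog
  | While cond prog

record state =
  reg :: "nat \<Rightarrow> nat"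
  mem :: "nat \<Rightarrow> nat"

fun op_val :: "binop \<Rightarrow> nat \<Rightarrow> nat \<Rightarrow> nat" where
  "op_val Add a b = a + b"
| "op_val Sub a b = a - b"
| "op_val Mul a b = a * b"
| "op_val Div a b = a div b"

fun expr_val :: "state \<Rightarrow> expr \<Rightarrow> nat" where
  "expr_val s (Const a) = a"
| "expr_val s (Reg x) = reg s x"
| "expr_val s (Mem e) = mem s (expr_val s e)"
| "expr_val s (Bin f e1 e2) = op_val f (expr_val s e1) (expr_val s e2)"

fun cond_val :: "state \<Rightarrow> cond \<Rightarrow> bool" where
  "cond_val s (Less e1 e2) = (expr_val s e1 < expr_val s e2)"
| "cond_val s (Not b) = (\<not> cond_val s b)"
| "cond_val s (And b1 b2) = (cond_val s b1 \<and> cond_val s b2)"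

fun expr_cost :: "expr \<Rightarrow> nat" where
  "expr_cost (Const a) = 1"
| "expr_cost (Reg x) = 1"
| "expr_cost (Mem e) = expr_cost e + 1"
| "expr_cost (Bin f e1 e2) = expr_cost e1 + expr_cost e2 + 1"

fun cond_cost :: "cond \<Rightarrow> nat" where
  "cond_cost (Less e1 e2) = expr_cost e1 + expr_cost e2 + 1"
| "cond_cost (Not b) = cond_cost b + 1"
| "cond_cost (And b1 b2) = cond_cost b1 + cond_cost b2 + 1"

text \<open>
  All constants, addresses and intermediate values have to be less than the word bound \<open>W\<close>;
  a program exceeding it gets stuck.
\<close>

fun expr_fits :: "nat \<Rightarrow> state \<Rightarrow> expr \<Rightarrow> bool" where
  "expr_fits W s (Const a) = (a < W)"
| "expr_fits W s (Reg x) = (reg s x < W)"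
| "expr_fits W s (Mem e) = (expr_fits W s e \<and> expr_val s (Mem e) < W)"
| "expr_fits W s (Bin f e1 e2) =
     (expr_fits W s e1 \<and> expr_fits W s e2 \<and> expr_val s (Bin f e1 e2) < W)"

fun cond_fits :: "nat \<Rightarrow> state \<Rightarrow> cond \<Rightarrow> bool" where
  "cond_fits W s (Less e1 e2) = (expr_fits W s e1 \<and> expr_fits W s e2)"
| "cond_fits W s (Not b) = cond_fits W s b"
| "cond_fits W s (And b1 b2) = (cond_fits W s b1 \<and> cond_fits W s b2)"

text \<open>
  \<open>exec W c s t s'\<close>: with word bound \<open>W\<close>, program \<open>c\<close> started in \<open>s\<close> terminates in \<open>s'\<close> after
  \<open>t\<close> elementary steps.
\<close>

inductive exec :: "nat \<Rightarrow> prog \<Rightarrow> state \<Rightarrow> nat \<Rightarrow> state \<Rightarrow> bool" for W where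
  Skip: "exec W Skip s 1 s"
| Assign: "expr_fits W s e \<Longrightarrow>
    exec W (Assign x e) s (expr_cost e + 1) (s\<lparr>reg := (reg s)(x := expr_val s e)\<rparr>)"
| Store: "expr_fits W s e1 \<Longrightarrow> expr_fits W s e2 \<Longrightarrow>
    exec W (Store e1 e2) s (expr_cost e1 + expr_cost e2 + 1)
      (s\<lparr>mem := (mem s)(expr_val s e1 := expr_val s e2)\<rparr>)"
| Seq: "exec W c1 s t1 s' \<Longrightarrow> exec W c2 s' t2 s'' \<Longrightarrow> exec W (Seq c1 c2) s (t1 + t2) s''"
| IfTrue: "cond_fits W s b \<Longrightarrow> cond_val s b \<Longrightarrow> exec W c1 s t s' \<Longrightarrow>
    exec W (If b c1 c2) s (cond_cost b + 1 + t) s'"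
| IfFalse: "cond_fits W s b \<Longrightarrow> \<not> cond_val s b \<Longrightarrow> exec W c2 s t s' \<Longrightarrow>
    exec W (If b c1 c2) s (cond_cost b + 1 + t) s'"
| WhileFalse: "cond_fits W s b \<Longrightarrow> \<not> cond_val s b \<Longrightarrow>
    exec W (While b c) s (cond_cost b + 1) s"
| WhileTrue: "cond_fits W s b \<Longrightarrow> cond_val s b \<Longrightarrow> exec W c s t1 s' \<Longrightarrow>
    exec W (While b c) s' t2 s'' \<Longrightarrow> exec W (While b c) s (cond_cost b + 1 + t1 + t2) s''"

lemma exec_deterministic:
  "exec W c s t s' \<Longrightarrow> exec W c s u s'' \<Longrightarrow> t = u \<and> s' = s''"
proof (induction arbitrary: u s'' rule: exec.induct)
  case Skip
  from Skip.prems show ?case by cases auto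
next
  case Assign
  from Assign.prems show ?case by cases auto
next
  case Store
  from Store.prems show ?case by cases auto
next
  case (Seq c1 s t1 s1 c2 t2 s2)
  from Seq.prems show ?case
    by cases (auto dest!: Seq.IH)
next
  case (IfTrue s b c1 t s1 c2)
  from IfTrue.prems show ?case
    by cases (use IfTrue.hyps in \<open>auto dest!: IfTrue.IH\<close>)
next
  case (IfFalse s b c2 t s1 c1)
  from IfFalse.prems show ?case
    by cases (use IfFalse.hyps in \<open>auto dest!: IfFalse.IH\<close>)
next
  case (WhileFalse s b c)
  from WhileFalse.prems show ?case
    by cases (use WhileFalse.hyps in auto)
next
  case (WhileTrue s b c t1 s1 t2 s2)
  from WhileTrue.prems show ?case
    by cases (use WhileTrue.hyps in \<open>auto dest!: WhileTrue.IH\<close>)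
qed


section \<open>Computing labelings\<close>

text \<open>The out-neighbours of a vertex may be listed in any order.\<close>

definition adjacency_lists :: "nat pair_pre_digraph \<Rightarrow> nat list list \<Rightarrow> bool" where
  "adjacency_lists G adj \<longleftrightarrow> pverts G = {0..<length adj} \<and>
     (\<forall>v < length adj. distinct (adj ! v) \<and> set (adj ! v) = {w. (v, w) \<in> parcs G})"

text \<open>
  The input consists of the number of vertices, followed by the adjacency lists, each preceded
  by its length. Registers and the remaining memory are initially zero.
\<close>

definition encode_adjacency :: "nat list list \<Rightarrow> nat list" where
  "encode_adjacency adj = length adj # concat (map (\<lambda>ns. length ns # ns) adj)"

definition init_state :: "nat list \<Rightarrow> state" where
  "init_state xs = \<lparr>reg = (\<lambda>_. 0), mem = (\<lambda>i. if i < length xs then xs ! i else 0)\<rparr>"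

text \<open>
  On a graph with \<open>n\<close> vertices the word bound is \<open>n ^ k\<close>, so words have \<open>k log n\<close> bits.
  In the end, the label of vertex \<open>v\<close> is in memory cell \<open>v\<close>. The labels may not depend on the order
  of the adjacency lists.
\<close>

definition computes_labeling_within ::
  "prog \<Rightarrow> nat \<Rightarrow> (nat pair_pre_digraph \<Rightarrow> nat \<Rightarrow> nat) \<Rightarrow> nat pair_pre_digraph \<Rightarrow> real \<Rightarrow> bool" where
  "computes_labeling_within c k lab G T \<longleftrightarrow>
     (\<forall>adj. adjacency_lists G adj \<longrightarrow>
       (\<exists>t s. exec (card (pverts G) ^ k) c (init_state (encode_adjacency adj)) t s \<and>
          real t \<le> T \<and> (\<forall>v \<in> pverts G. mem s v = lab G v)))"

end

theory Submission
  imports Defs "HOL-Number_Theory.Residues" "HOL-Computational_Algebra.Polynomial"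
begin

text \<open>
  The labels come from color refinement with two individualized vertices. Let \<open>G\<close> be a Cayley
  graph over the integers modulo a prime \<open>p\<close> with connection set \<open>S\<close>, neither empty nor the
  set of all nonzero residues. A coloring is equitable if the number of in-neighbors of a
  vertex in a color class depends only on the color of the vertex. Two facts make the method
  work.

  First, if vertex 0 is a class of its own in an equitable coloring, then two vertices \<open>x\<close> and
  \<open>y\<close> of the same color differ by a multiplier: \<open>y = k * x\<close> with \<open>k * S = S\<close>, and
  multiplication by \<open>k\<close> is an automorphism fixing 0 (\<open>same_color_imp_multiple\<close>). The functions
  that are constant on the classes are closed under the operator \<open>A\<close> with
  \<open>A f x = (\<Sum>s\<in>S. f (x - s))\<close>. By the freshman's dream, the \<open>q\<close>-th power of \<open>A\<close> is congruent
  modulo a prime \<open>q\<close> to the same operator with \<open>S\<close> replaced by \<open>q * S\<close>. For an indicator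
  function \<open>f\<close> the sums count at most \<open>card S < p\<close> elements, so for \<open>q > p\<close> the congruence
  determines them. Hence the coloring is also equitable with respect to \<open>q * S\<close>. Every residue
  prime to \<open>p\<close> is represented by a product of primes above \<open>p\<close>, so this holds for all dilates
  of \<open>S\<close> (\<open>closed_under_coprime\<close>), and evaluation at the indicator of 0 gives the multiplier.
  As a consequence, it is irrelevant which vertex of a class is individualized next.

  Secondly, an equitable coloring with two singleton classes is discrete
  (\<open>two_singletons_imp_discrete\<close>). Consider the polynomials modulo \<open>p\<close> that are constant on
  the classes. The set of their degrees is closed under addition. Subtracting \<open>card S\<close> from
  the operator \<open>A\<close> lowers degrees below \<open>p\<close> by exactly \<open>j\<close>, where \<open>j\<close> is the first positive
  exponent with a nonzero power sum over \<open>S\<close>; it satisfies \<open>j < p - 1\<close> since otherwise \<open>S\<close>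
  would be one of the excluded sets. The two singletons provide the degrees \<open>p - 1\<close> and
  \<open>p - 2\<close>, and elementary arithmetic produces degree 1 (\<open>one_in_additive_set\<close>). A linear
  polynomial is injective.

  The relabeled graph is canonical because the whole procedure commutes with isomorphisms: a
  class is named by the position where it starts in the ordered partition, and the next color
  to be processed is a function of the set of waiting colors alone. Given an isomorphism
  between two graphs, a translation and a multiplier turn it into one that respects the two
  individualized vertices; it then respects all colors (\<open>second_refinement_canonical\<close>). Since
  the final coloring is a bijection, colors plus one are the labels. Empty and complete graphs
  keep their vertex names.

  The time bound is Hopcroft's. When a class splits, only a smaller part has to wait for
  processing, unless the class was waiting already. Processing a class \<open>X\<close> means to scan its
  \<open>\<Delta> * card X\<close> arcs, paid for by the potential that assigns to each vertex the binary
  logarithm of the size of its class, plus one if its color is waiting. There are fewer than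
  \<open>p\<close> splits and at most \<open>2 * p\<close> removals of a waiting color, each with one update of a search
  tree over the colors in time \<open>log p\<close>. The second half of the development proves that a
  program for the word RAM implements these steps within these bounds.
\<close>

section \<open>Frobenius congruences for shift operators\<close>

lemma freshmans_dream_dvd:
  fixes a b :: "'a :: comm_ring_1"
  assumes "prime q"
  shows "of_nat q dvd (a + b) ^ q - (a ^ q + b ^ q)"
proof -
  have q: "q \<ge> 2" using assms by (simp add: prime_ge_2_nat)
  let ?t = "\<lambda>k. of_nat (q choose k) * a ^ k * b ^ (q - k)"
  have "(a + b) ^ q = (\<Sum>k\<le>q. ?t k)"
    by (rule binomial_ring)
  also have "{..q} = insert 0 (insert q {0<..<q})" using q by auto
  also have "(\<Sum>k\<in>insert 0 (insert q {0<..<q}). ?t k) = b ^ q + (a ^ q + (\<Sum>k\<in>{0<..<q}. ?t k))"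
    using q by simp
  finally have "(a + b) ^ q - (a ^ q + b ^ q) = (\<Sum>k\<in>{0<..<q}. ?t k)"
    by simp
  moreover have "of_nat q dvd ?t k" if "k \<in> {0<..<q}" for k
  proof -
    have "q dvd (q choose k)" using that assms by (intro dvd_choose_prime) auto
    then have "(of_nat q :: 'a) dvd of_nat (q choose k)" by (auto elim!: dvdE)
    then show ?thesis by (simp add: mult.assoc)
  qed
  ultimately show ?thesis by (metis (no_types, lifting) dvd_sum)
qed

lemma freshmans_dream_sum_dvd:
  fixes f :: "'b \<Rightarrow> 'a :: comm_ring_1"
  assumes "prime q" "finite A"
  shows "of_nat q dvd (\<Sum>x\<in>A. f x) ^ q - (\<Sum>x\<in>A. f x ^ q)"
  using assms(2)
proof (induction A rule: finite_induct)
  case empty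
  then show ?case using assms(1) by (simp add: prime_gt_0_nat power_0_left)
next
  case (insert x A)
  have "of_nat q dvd ((f x + (\<Sum>x\<in>A. f x)) ^ q - (f x ^ q + (\<Sum>x\<in>A. f x) ^ q)) +
    ((\<Sum>x\<in>A. f x) ^ q - (\<Sum>x\<in>A. f x ^ q))"
    by (intro dvd_add freshmans_dream_dvd insert.IH assms)
  then show ?case using insert.hyps by (simp add: algebra_simps)
qed

text \<open>
  The integer polynomials act on functions by letting the indeterminate shift the argument by
  one. The Frobenius congruence for operators is thereby reduced to the one in a commutative
  ring.
\<close>

definition shift_op :: "int poly \<Rightarrow> (int \<Rightarrow> int) \<Rightarrow> int \<Rightarrow> int" where
  "shift_op P f x = (\<Sum>i\<le>degree P. coeff P i * f (x - int i))"

lemma shift_op_bound: "degree P \<le> n \<Longrightarrow> shift_op P f x = (\<Sum>i\<le>n. coeff P i * f (x - int i))"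
  unfolding shift_op_def
  by (rule sum.mono_neutral_left) (auto simp: coeff_eq_0)

lemma shift_op_0 [simp]: "shift_op 0 f x = 0"
  by (simp add: shift_op_def)

lemma shift_op_pCons: "shift_op (pCons a P) f x = a * f x + shift_op P f (x - 1)"
proof -
  have "shift_op (pCons a P) f x = (\<Sum>i\<le>Suc (degree P). coeff (pCons a P) i * f (x - int i))"
    by (rule shift_op_bound) (simp add: degree_pCons_le)
  then show ?thesis
    by (simp only: sum.atMost_Suc_shift shift_op_def) (simp add: algebra_simps)
qed

lemma shift_op_add: "shift_op (P + Q) f x = shift_op P f x + shift_op Q f x"
proof -
  define n where "n = max (degree P) (degree Q)"
  have "degree P \<le> n" "degree Q \<le> n" "degree (P + Q) \<le> n"
    unfolding n_def by (auto intro: degree_add_le)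
  then show ?thesis
    by (simp add: shift_op_bound[of _ n] sum.distrib algebra_simps)
qed

lemma shift_op_smult: "shift_op (smult a P) f x = a * shift_op P f x"
  by (simp add: shift_op_bound[of "smult a P" "degree P"] shift_op_def[of P] degree_smult_le
      sum_distrib_left mult.assoc)

lemma shift_op_mult: "shift_op (P * Q) f x = shift_op P (shift_op Q f) x"
  by (induction P arbitrary: x)
    (simp_all add: shift_op_pCons shift_op_add shift_op_smult)

lemma shift_op_monom: "shift_op (monom 1 n) f x = f (x - int n)"
  by (simp add: shift_op_def degree_monom_eq sum.If_cases coeff_monom if_distrib[of "\<lambda>z. z * _"] cong: if_cong)

lemma shift_op_sum: "shift_op (\<Sum>a\<in>A. P a) f x = (\<Sum>a\<in>A. shift_op (P a) f x)"
  by (induction A rule: infinite_finite_induct) (simp_all add: shift_op_add)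

lemma shift_op_power: "shift_op (P ^ n) f = ((shift_op P) ^^ n) f"
proof (induction n)
  case 0
  have "shift_op (monom 1 0) f = f" by (rule ext) (simp only: shift_op_monom, simp)
  then show ?case by (simp add: one_pCons monom_0)
next
  case (Suc n)
  then show ?case by (auto simp: shift_op_mult)
qed

text \<open>
  The operator that sums over the shifts by \<open>S\<close> is the action of the polynomial with the
  monomials of exponents in \<open>S\<close>, whose \<open>q\<close>-th power is congruent to the sum of the \<open>q\<close>-th
  powers of the monomials.
\<close>

lemma shift_sum_power_cong:
  fixes S :: "int set" and f :: "int \<Rightarrow> int"
  assumes "prime q" "finite S" "\<And>s. s \<in> S \<Longrightarrow> s \<ge> 0"
  defines "A \<equiv> \<lambda>f x. \<Sum>s\<in>S. f (x - s)"
  shows "[(A ^^ q) f x = (\<Sum>s\<in>S. f (x - int q * s))] (mod int q)"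
proof -
  define P :: "int poly" where "P = (\<Sum>s\<in>S. monom 1 (nat s))"
  have "shift_op P = A"
    unfolding P_def A_def by (intro ext) (simp add: shift_op_sum shift_op_monom assms(3))
  then have L: "(A ^^ q) f x = shift_op (P ^ q) f x"
    by (simp add: shift_op_power)
  have "of_nat q dvd P ^ q - (\<Sum>s\<in>S. monom 1 (nat s) ^ q)"
    unfolding P_def by (rule freshmans_dream_sum_dvd) fact+
  then obtain R where "P ^ q - (\<Sum>s\<in>S. monom 1 (nat s) ^ q) = of_nat q * R"
    by (elim dvdE)
  then have "P ^ q = smult (int q) R + (\<Sum>s\<in>S. monom 1 (nat s * q))"
    by (simp add: monom_power of_nat_poly algebra_simps)
  then have "shift_op (P ^ q) f x = int q * shift_op R f x + (\<Sum>s\<in>S. f (x - int q * s))"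
    by (simp add: shift_op_add shift_op_smult shift_op_sum shift_op_monom assms(3) mult.commute)
  then show ?thesis unfolding L by (simp add: cong_def)
qed

section \<open>Equitable colorings of the residues modulo a prime\<close>

text \<open>
  Residues modulo \<open>p\<close> are represented by all integers, with periodic colorings. Dilations
  \<open>m * s\<close> then make sense for every integer \<open>m\<close> without reduction. In the Cayley graph,
  \<open>x - s\<close> ranges over the in-neighbors of \<open>x\<close>.
\<close>

locale equitable_coloring =
  fixes p :: nat and S :: "int set" and c :: "int \<Rightarrow> nat"
  assumes prime: "prime p"
    and S_subset: "S \<subseteq> {1..<int p}"
    and periodic: "[x = y] (mod int p) \<Longrightarrow> c x = c y"
    and equitable: "c x = c y \<Longrightarrow> card {s \<in> S. c (x - s) = b} = card {s \<in> S. c (y - s) = b}"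
begin

lemma p_gt_1: "p > 1" using prime by (rule prime_gt_1_nat)

lemma finite_S: "finite S" using S_subset by (rule finite_subset) simp

lemma S_nonneg: "s \<in> S \<Longrightarrow> s \<ge> 0" using S_subset by auto

lemma card_S_less: "card S < p"
proof -
  have "card S \<le> card {1..<int p}" by (rule card_mono) (use S_subset in auto)
  then show ?thesis using p_gt_1 by simp
qed

lemma range_c_finite: "finite (range c)"
proof -
  have "range c \<subseteq> c ` {0..<int p}"
  proof (clarify)
    fix x
    have "c x = c (x mod int p)" by (rule periodic) (simp add: cong_def)
    moreover have "x mod int p \<in> {0..<int p}" using p_gt_1 by simp
    ultimately show "c x \<in> c ` {0..<int p}" by blast
  qed
  then show ?thesis by (rule finite_subset) simp
qed

definition invariant :: "(int \<Rightarrow> int) \<Rightarrow> bool" where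
  "invariant f \<longleftrightarrow> (\<forall>x y. c x = c y \<longrightarrow> f x = f y)"

lemma invariantI: "(\<And>x y. c x = c y \<Longrightarrow> f x = f y) \<Longrightarrow> invariant f"
  unfolding invariant_def by blast

lemma invariantD: "invariant f \<Longrightarrow> c x = c y \<Longrightarrow> f x = f y"
  unfolding invariant_def by blast

lemma invariant_sum_cong:
  assumes card: "\<And>b. card {s \<in> S. c (x - m * s) = b} = card {s \<in> S. c (y - m * s) = b}"
    and f: "\<And>x y. c x = c y \<Longrightarrow> [f x = f y] (mod N)"
  shows "[(\<Sum>s\<in>S. f (x - m * s)) = (\<Sum>s\<in>S. f (y - m * s))] (mod (N::int))"
proof -
  have *: "[(\<Sum>s\<in>S. f (x - m * s)) =
    (\<Sum>b\<in>range c. int (card {s \<in> S. c (x - m * s) = b}) * f (inv_into UNIV c b))] (mod N)" for x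
  proof -
    have "(\<Sum>s\<in>S. f (x - m * s)) =
      (\<Sum>b\<in>range c. \<Sum>s\<in>{s\<in>S. c (x - m * s) = b}. f (x - m * s))"
      by (rule sum.group[symmetric]) (auto simp: finite_S range_c_finite)
    also have "[\<dots> = (\<Sum>b\<in>range c. \<Sum>s\<in>{s\<in>S. c (x - m * s) = b}. f (inv_into UNIV c b))] (mod N)"
    proof (intro cong_sum)
      fix b s assume "b \<in> range c" "s \<in> {s \<in> S. c (x - m * s) = b}"
      then show "[f (x - m * s) = f (inv_into UNIV c b)] (mod N)"
        by (intro f) (auto simp: f_inv_into_f)
    qed
    finally show ?thesis by simp
  qed
  show ?thesis
    using *[of x] *[of y] card by (auto intro: cong_trans cong_sym)
qed

text \<open>
  Closure of the space of invariant functions under the dilate of the operator by \<open>m\<close>. It can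
  be iterated, unlike the equivalent statement about cardinalities.
\<close>

definition closed_under :: "int \<Rightarrow> bool" where
  "closed_under m \<longleftrightarrow> (\<forall>f. invariant f \<longrightarrow> invariant (\<lambda>x. \<Sum>s\<in>S. f (x - m * s)))"

lemma closed_under_card:
  assumes "\<And>x y b. c x = c y \<Longrightarrow>
    card {s \<in> S. c (x - m * s) = b} = card {s \<in> S. c (y - m * s) = b}"
  shows "closed_under m"
  unfolding closed_under_def
proof (intro allI impI invariantI)
  fix f x y assume f: "invariant f" and xy: "c x = c y"
  have "[(\<Sum>s\<in>S. f (x - m * s)) = (\<Sum>s\<in>S. f (y - m * s))] (mod 0)"
  proof (rule invariant_sum_cong)
    show "card {s \<in> S. c (x - m * s) = b} = card {s \<in> S. c (y - m * s) = b}" for b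
      using xy by (rule assms)
    show "[f u = f v] (mod 0)" if "c u = c v" for u v
      unfolding invariantD[OF f that] by (rule cong_refl)
  qed
  then show "(\<Sum>s\<in>S. f (x - m * s)) = (\<Sum>s\<in>S. f (y - m * s))"
    by simp
qed

lemma closed_under_1: "closed_under 1"
proof (rule closed_under_card)
  show "card {s \<in> S. c (x - 1 * s) = b} = card {s \<in> S. c (y - 1 * s) = b}" if "c x = c y" for x y b
    unfolding mult_1 using that by (rule equitable)
qed

text \<open>
  Iterating the operator \<open>q\<close> times stays within the invariant functions, and modulo \<open>q\<close> the
  result is the operator dilated by \<open>q\<close>.
\<close>

lemma closed_under_prime_mult:
  assumes m: "closed_under m" "m > 0" and q: "prime q" "q > p"
  shows "closed_under (int q * m)"
proof -
  have inj: "inj_on ((*) m) S" using m(2) by (auto simp: inj_on_def)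
  define A where "A = (\<lambda>f x. \<Sum>s\<in>(*) m ` S. (f (x - s) :: int))"
  have A_eq: "A = (\<lambda>f x. \<Sum>s\<in>S. f (x - m * s))"
    unfolding A_def by (simp add: sum.reindex[OF inj])
  have inv_iter: "invariant ((A ^^ n) f)" if "invariant f" for f n
    using that m(1) by (induction n) (simp_all add: A_eq closed_under_def)
  have cong: "[(A ^^ q) f x = (\<Sum>s\<in>S. f (x - int q * m * s))] (mod int q)" for f x
  proof -
    have "[(A ^^ q) f x = (\<Sum>s\<in>(*) m ` S. f (x - int q * s))] (mod int q)"
      unfolding A_def by (rule shift_sum_power_cong) (use q finite_S S_nonneg m(2) in auto)
    then show ?thesis by (simp add: sum.reindex[OF inj] mult.assoc)
  qed
  have card_eq: "card {s \<in> S. c (x - int q * m * s) = b} = card {s \<in> S. c (y - int q * m * s) = b}"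
    if "c x = c y" for x y b
  proof -
    define f :: "int \<Rightarrow> int" where "f = (\<lambda>x. if c x = b then 1 else 0)"
    have f: "(\<Sum>s\<in>S. f (x - int q * m * s)) = int (card {s \<in> S. c (x - int q * m * s) = b})" for x
      unfolding f_def by (simp add: sum.If_cases finite_S Int_def)
    have "invariant f" by (simp add: f_def invariant_def)
    then have "(A ^^ q) f x = (A ^^ q) f y"
      using inv_iter that unfolding invariant_def by blast
    then have "[(\<Sum>s\<in>S. f (x - int q * m * s)) = (\<Sum>s\<in>S. f (y - int q * m * s))] (mod int q)"
      using cong_trans[OF cong_sym[OF cong[of f x]], of "\<Sum>s\<in>S. f (y - int q * m * s)"] cong[of f y] by simp
    then have "[int (card {s \<in> S. c (x - int q * m * s) = b}) =
        int (card {s \<in> S. c (y - int q * m * s) = b})] (mod int q)"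
      unfolding f .
    moreover have "card {s \<in> S. c (z - int q * m * s) = b} < q" for z
      using card_mono[OF finite_S, of "{s \<in> S. c (z - int q * m * s) = b}"] card_S_less q by auto
    \<comment> \<open>Both cardinalities are at most \<open>card S < p < q\<close>, so their congruence modulo \<open>q\<close> is an
      equality.\<close>
    ultimately show ?thesis
      by (auto simp: cong_int_iff intro: cong_less_modulus_unique_nat)
  qed
  show ?thesis using card_eq by (rule closed_under_card)
qed

lemma closed_under_large_primes:
  assumes "m > 0" "\<And>q. prime q \<Longrightarrow> q dvd m \<Longrightarrow> q > p"
  shows "closed_under (int m)"
  using assms
proof (induction m rule: prime_divisors_induct)
  case zero
  then show ?case by simp
next
  case (unit m)
  then show ?case using closed_under_1 by simp
next
  case (factor q m)
  have "closed_under (int m)"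
    using factor.prems by (intro factor.IH) auto
  then have "closed_under (int q * int m)"
    using factor by (intro closed_under_prime_mult) auto
  then show ?case by simp
qed

text \<open>
  The Chinese remainder theorem replaces \<open>m\<close> by a number in the same residue class modulo \<open>p\<close>
  all of whose prime factors exceed \<open>p\<close>: it suffices that it is congruent to 1 modulo the
  factorial of \<open>p - 1\<close>.
\<close>

lemma closed_under_coprime:
  assumes "\<not> int p dvd m"
  shows "closed_under m"
proof -
  have p: "p > 0" using p_gt_1 by simp
  have "\<not> p dvd fact (p - 1)"
    using p prime_dvd_fact_iff[OF prime, of "p - 1"] by simp
  then have "coprime p (fact (p - 1) :: nat)"
    using prime by (simp add: prime_imp_coprime)
  from binary_chinese_remainder_nat[OF this, of "nat (m mod int p)" 1]
  obtain m' where m': "[m' = nat (m mod int p)] (mod p)" "[m' = 1] (mod (fact (p - 1)))"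
    by blast
  have m'm: "[int m' = m] (mod int p)"
  proof -
    have "[int m' = int (nat (m mod int p))] (mod int p)" using m'(1) by (simp only: cong_int_iff)
    then show ?thesis using p by (simp add: cong_def)
  qed
  have ndvd: "\<not> p dvd m'"
    using cong_dvd_iff[OF m'm] assms by simp
  then have "m' > 0" by (cases "m' = 0") auto
  moreover have "q > p" if q: "prime q" "q dvd m'" for q
  proof (rule ccontr)
    assume "\<not> q > p"
    moreover have "q \<noteq> p" using ndvd q by auto
    ultimately have "q dvd fact (p - 1)"
      using prime_dvd_fact_iff[OF q(1), of "p - 1"] by simp
    then have "[m' = 1] (mod q)" using m'(2) cong_dvd_modulus_nat by blast
    from cong_dvd_iff[OF this] show False using q by simp
  qed
  ultimately have cl: "closed_under (int m')" by (rule closed_under_large_primes)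
  show ?thesis
    unfolding closed_under_def
  proof (intro allI impI)
    fix f assume f: "invariant f"
    have "f (x - m * s) = f (x - int m' * s)" for x s
    proof -
      have "[x - m * s = x - int m' * s] (mod int p)"
        using m'm by (intro cong_diff cong_mult cong_refl) (simp add: cong_sym)
      then show ?thesis using f periodic unfolding invariant_def by blast
    qed
    moreover have "invariant (\<lambda>x. \<Sum>s\<in>S. f (x - int m' * s))" using cl f by (simp add: closed_under_def)
    ultimately show "invariant (\<lambda>x. \<Sum>s\<in>S. f (x - m * s))" by simp
  qed
qed

text \<open>
  This is a form of Schur's theorem on multipliers. Let \<open>k = y / x\<close> modulo \<open>p\<close>. For \<open>s \<in> S\<close>
  choose \<open>m\<close> with \<open>m * s = x\<close>. Closure under dilation by \<open>m\<close>, applied to the indicator of 0,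
  says that \<open>x\<close> and \<open>y\<close> are equally often of the form \<open>m * t\<close> with \<open>t \<in> S\<close>; so there is
  \<open>t \<in> S\<close> with \<open>m * t = y = m * (k * s)\<close>.
\<close>

lemma same_color_imp_multiple:
  assumes zero: "\<And>z. c z = c 0 \<Longrightarrow> int p dvd z"
    and xy: "c x = c y" "\<not> int p dvd x"
  shows "\<exists>\<kappa>. \<not> int p dvd \<kappa> \<and> [y = \<kappa> * x] (mod int p) \<and>
    (\<forall>s\<in>S. \<kappa> * s mod int p \<in> S)"
proof -
  have p: "p > 0" using p_gt_1 by simp
  have pI: "prime (int p)" using prime by simp
  have y: "\<not> int p dvd y"
  proof
    assume "int p dvd y"
    then have "c y = c 0" by (intro periodic) (simp add: cong_0_iff)
    then show False using zero[of x] xy by simp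
  qed
  obtain x' where x': "[x * x' = 1] (mod int p)"
    using xy(2) cong_solve_coprime_int[of x "int p"] prime_imp_coprime[OF pI] by (auto simp: coprime_commute)
  define \<kappa> where "\<kappa> = y * x'"
  have "\<not> int p dvd x'"
  proof
    assume "int p dvd x'"
    then have "[x * x' = 0] (mod int p)" by (simp add: cong_0_iff)
    from cong_trans[OF cong_sym[OF x'] this] have "[1 = 0] (mod int p)" .
    then show False using p_gt_1 by (simp add: cong_def)
  qed
  then have \<kappa>: "\<not> int p dvd \<kappa>"
    using y pI by (simp add: \<kappa>_def prime_dvd_mult_iff)
  have yx: "[y = \<kappa> * x] (mod int p)"
  proof -
    have "[y * (x * x') = y * 1] (mod int p)" using x' by (intro cong_mult cong_refl)
    then show ?thesis by (simp add: \<kappa>_def ac_simps cong_sym)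
  qed
  have "\<kappa> * s mod int p \<in> S" if s: "s \<in> S" for s
  proof -
    have s_nd: "\<not> int p dvd s" using s S_subset zdvd_not_zless by auto
    then obtain s' where s': "[s * s' = 1] (mod int p)"
      using cong_solve_coprime_int[of s "int p"] prime_imp_coprime[OF pI] by (auto simp: coprime_commute)
    define m where "m = s' * x"
    have ms: "[m * s = x] (mod int p)"
    proof -
      have "[x * (s * s') = x * 1] (mod int p)" using s' by (intro cong_mult cong_refl)
      then show ?thesis by (simp add: m_def ac_simps)
    qed
    have m: "\<not> int p dvd m"
    proof
      assume "int p dvd m"
      then have "int p dvd m * s" by simp
      then show False using ms xy(2) cong_dvd_iff by blast
    qed
    define f :: "int \<Rightarrow> int" where "f = (\<lambda>x. if int p dvd x then 1 else 0)"
    have "invariant f"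
      unfolding f_def
    proof (intro invariantI)
      fix u v assume uv: "c u = c v"
      have z: "int p dvd w \<longleftrightarrow> c w = c 0" for w
      proof
        assume "int p dvd w" then show "c w = c 0" by (intro periodic) (simp add: cong_0_iff)
      qed (rule zero)
      have "int p dvd u \<longleftrightarrow> int p dvd v"
        unfolding z uv ..
      then show "(if int p dvd u then 1 else 0) = (if int p dvd v then 1 else (0::int))" by simp
    qed
    then have "(\<Sum>s\<in>S. f (x - m * s)) = (\<Sum>s\<in>S. f (y - m * s))"
      using closed_under_coprime[OF m] xy unfolding closed_under_def invariant_def by blast
    moreover have "(\<Sum>s\<in>S. f (z - m * s)) = int (card {s \<in> S. [z = m * s] (mod int p)})" for z
      unfolding f_def by (simp add: sum.If_cases finite_S Int_def cong_iff_dvd_diff)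
    moreover have "s \<in> {s \<in> S. [x = m * s] (mod int p)}" using s ms by (simp add: cong_sym)
    ultimately have "card {s \<in> S. [y = m * s] (mod int p)} = card {s \<in> S. [x = m * s] (mod int p)}"
      and "{s \<in> S. [x = m * s] (mod int p)} \<noteq> {}"
      by auto
    then have "card {s \<in> S. [y = m * s] (mod int p)} > 0"
      using finite_S by (simp add: card_gt_0_iff)
    then have "{s \<in> S. [y = m * s] (mod int p)} \<noteq> {}"
      unfolding card_gt_0_iff by blast
    then obtain t where t: "t \<in> S" "[y = m * t] (mod int p)"
      by blast
    have "[m * (\<kappa> * s) = m * t] (mod int p)"
    proof -
      have "[\<kappa> * (m * s) = \<kappa> * x] (mod int p)" using ms by (intro cong_mult cong_refl)
      then have "[m * (\<kappa> * s) = \<kappa> * x] (mod int p)" by (simp add: ac_simps)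
      from cong_trans[OF cong_trans[OF this cong_sym[OF yx]] t(2)] show ?thesis .
    qed
    moreover have "coprime m (int p)" using m prime_imp_coprime[OF pI] by (simp add: coprime_commute)
    ultimately have "[\<kappa> * s = t] (mod int p)"
      by (simp add: cong_mult_lcancel)
    moreover have "t mod int p = t" using t S_subset by auto
    ultimately show ?thesis using t by (simp add: cong_def)
  qed
  then show ?thesis using \<kappa> yx by blast
qed

section \<open>Degrees of invariant polynomials\<close>

definition poly_invariant :: "int poly \<Rightarrow> bool" where
  "poly_invariant P \<longleftrightarrow> (\<forall>x y. c x = c y \<longrightarrow> [poly P x = poly P y] (mod int p))"

text \<open>
  Integer polynomials stand for polynomials over the field with \<open>p\<close> elements; degrees are
  meant after reduction.
\<close>

definition degrees :: "nat set" where
  "degrees = {d. \<exists>P. poly_invariant P \<and> \<not> int p dvd coeff P d \<and> (\<forall>i>d. int p dvd coeff P i)}"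

lemma poly_invariantI:
  "(\<And>x y. c x = c y \<Longrightarrow> [poly P x = poly P y] (mod int p)) \<Longrightarrow> poly_invariant P"
  unfolding poly_invariant_def by blast

lemma poly_invariantD: "poly_invariant P \<Longrightarrow> c x = c y \<Longrightarrow> [poly P x = poly P y] (mod int p)"
  unfolding poly_invariant_def by blast

lemma dvd_sum_remove:
  fixes f :: "'b \<Rightarrow> int"
  assumes "finite A" "a \<in> A" "\<And>i. i \<in> A \<Longrightarrow> i \<noteq> a \<Longrightarrow> n dvd f i"
  shows "n dvd (\<Sum>i\<in>A. f i) \<longleftrightarrow> n dvd f a"
proof -
  have "(\<Sum>i\<in>A. f i) = f a + (\<Sum>i\<in>A - {a}. f i)" using assms by (simp add: sum.remove)
  moreover have "n dvd (\<Sum>i\<in>A - {a}. f i)" using assms by (intro dvd_sum) auto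
  ultimately show ?thesis by (simp add: dvd_add_left_iff)
qed

lemma degrees_add:
  assumes "d \<in> degrees" "e \<in> degrees"
  shows "d + e \<in> degrees"
proof -
  from assms obtain P Q where
    P: "poly_invariant P" "\<not> int p dvd coeff P d" "\<And>i. i > d \<Longrightarrow> int p dvd coeff P i" and
    Q: "poly_invariant Q" "\<not> int p dvd coeff Q e" "\<And>i. i > e \<Longrightarrow> int p dvd coeff Q i"
    unfolding degrees_def by blast
  have "poly_invariant (P * Q)"
  proof (rule poly_invariantI)
    fix x y assume "c x = c y"
    then show "[poly (P * Q) x = poly (P * Q) y] (mod int p)"
      unfolding poly_mult using P(1) Q(1) by (intro cong_mult poly_invariantD)
  qed
  moreover have "\<not> int p dvd coeff (P * Q) (d + e)"
  proof -
    have "int p dvd coeff (P * Q) (d + e) \<longleftrightarrow> int p dvd coeff P d * coeff Q (d + e - d)"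
      unfolding coeff_mult
    proof (rule dvd_sum_remove)
      fix i assume i: "i \<in> {..d + e}" "i \<noteq> d"
      then have "i > d \<or> d + e - i > e" by auto
      then show "int p dvd coeff P i * coeff Q (d + e - i)"
        using P(3) Q(3) by (auto intro: dvd_mult dvd_mult2)
    qed auto
    then show ?thesis using P(2) Q(2) prime by (simp add: prime_dvd_mult_iff)
  qed
  moreover have "int p dvd coeff (P * Q) i" if i: "i > d + e" for i
    unfolding coeff_mult
  proof (rule dvd_sum)
    fix k assume k: "k \<in> {..i}"
    then have "k > d \<or> i - k > e" using i by auto
    then show "int p dvd coeff P k * coeff Q (i - k)"
      using P(3) Q(3) by (auto intro: dvd_mult dvd_mult2)
  qed
  ultimately show ?thesis unfolding degrees_def by blast
qed

definition power_sum :: "nat \<Rightarrow> int" where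
  "power_sum j = (\<Sum>s\<in>S. (- s) ^ j)"

lemma coeff_linear_power_int:
  "coeff ([:a, 1:] ^ i) n = of_nat (i choose n) * a ^ (i - n)" for a :: int
proof (cases "n \<le> i")
  case True
  then show ?thesis by (simp add: coeff_linear_poly_power)
next
  case False
  then show ?thesis by (simp add: coeff_eq_0 degree_linear_power)
qed

lemma pcompose_monom_eq: "pcompose (monom a n) q = smult a (q ^ n)" for q :: "int poly"
  by (induction n) (simp_all add: monom_0 monom_Suc pcompose_pCons mult.commute)

lemma coeff_pcompose_linear:
  "coeff (pcompose P [:a, 1:]) n = (\<Sum>i\<le>degree P. coeff P i * (of_nat (i choose n) * a ^ (i - n)))"
  for a :: int
proof -
  have "pcompose P [:a, 1:] = pcompose (\<Sum>i\<le>degree P. monom (coeff P i) i) [:a, 1:]"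
    by (simp add: poly_as_sum_of_monoms)
  also have "\<dots> = (\<Sum>i\<le>degree P. smult (coeff P i) ([:a, 1:] ^ i))"
    by (simp add: pcompose_sum pcompose_monom_eq)
  finally show ?thesis
    by (simp add: coeff_sum coeff_linear_power_int)
qed

text \<open>
  The operator \<open>A - card S\<close> maps the monomial of degree \<open>i\<close> to the sum over \<open>n < i\<close> of the
  monomials of degree \<open>n\<close> with coefficient \<open>i choose n\<close> times the power sum of exponent
  \<open>i - n\<close>. The power sums below \<open>j\<close> vanish, so the degree drops by \<open>j\<close>, and exactly by \<open>j\<close>
  because \<open>d choose j\<close> is not divisible by \<open>p\<close> for \<open>d < p\<close>.
\<close>

lemma degrees_sub:
  assumes d: "d \<in> degrees" "d < p" and j: "1 \<le> j" "j \<le> d" "\<not> int p dvd power_sum j"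
    and least: "\<And>i. 1 \<le> i \<Longrightarrow> i < j \<Longrightarrow> int p dvd power_sum i"
  shows "d - j \<in> degrees"
proof -
  from d obtain P where
    P: "poly_invariant P" "\<not> int p dvd coeff P d" "\<And>i. i > d \<Longrightarrow> int p dvd coeff P i"
    unfolding degrees_def by blast
  \<comment> \<open>\<open>Q\<close> is the image of \<open>P\<close>, and \<open>t n i\<close> is the contribution of the coefficient of degree \<open>i\<close>
    of \<open>P\<close> to the coefficient of degree \<open>n\<close>.\<close>
  define Q where "Q = (\<Sum>s\<in>S. pcompose P [:- s, 1:]) - smult (int (card S)) P"
  define t where "t = (\<lambda>n i. coeff P i * (of_nat (i choose n) * power_sum (i - n)))"
  have coeff_Q: "coeff Q n = (\<Sum>i\<in>{..degree P} - {n}. t n i)" for n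
  proof -
    have "coeff Q n = (\<Sum>i\<le>degree P. t n i) - int (card S) * coeff P n"
      unfolding Q_def t_def power_sum_def
      by (simp add: coeff_sum coeff_pcompose_linear sum_distrib_left sum.swap[of _ _ S])
    also have "(\<Sum>i\<le>degree P. t n i) = (\<Sum>i\<in>{..degree P} - {n}. t n i) + int (card S) * coeff P n"
    proof (cases "n \<le> degree P")
      case True
      then show ?thesis by (simp add: sum.remove[of _ n] t_def power_sum_def)
    next
      case False
      then show ?thesis by (simp add: coeff_eq_0)
    qed
    finally show ?thesis by simp
  qed
  have t_dvd: "int p dvd t n i" if "n \<ge> d - j" "i \<noteq> n" "n > d - j \<or> i \<noteq> d" for n i
  proof -
    have "i < n \<or> i > d \<or> (i > n \<and> i \<le> d)" using that(2) by linarith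
    then consider "i < n" | "i > d" | "i > n" "i \<le> d" by blast
    then show ?thesis
    proof cases
      case 1
      then show ?thesis by (simp add: t_def binomial_eq_0)
    next
      case 2
      then show ?thesis by (simp add: t_def P(3))
    next
      case 3
      then have "int p dvd power_sum (i - n)" using that j by (intro least) auto
      then show ?thesis by (simp add: t_def)
    qed
  qed
  have "poly_invariant Q"
  proof (rule poly_invariantI)
    fix x y assume xy: "c x = c y"
    have "[(\<Sum>s\<in>S. poly P (x - 1 * s)) = (\<Sum>s\<in>S. poly P (y - 1 * s))] (mod int p)"
    proof (rule invariant_sum_cong)
      show "card {s \<in> S. c (x - 1 * s) = b} = card {s \<in> S. c (y - 1 * s) = b}" for b
        unfolding mult_1 using xy by (rule equitable)
      show "[poly P u = poly P v] (mod int p)" if "c u = c v" for u v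
        using P(1) that by (rule poly_invariantD)
    qed
    moreover have "[int (card S) * poly P x = int (card S) * poly P y] (mod int p)"
      using poly_invariantD[OF P(1) xy] by (intro cong_mult cong_refl)
    ultimately have "[(\<Sum>s\<in>S. poly P (x - 1 * s)) - int (card S) * poly P x =
        (\<Sum>s\<in>S. poly P (y - 1 * s)) - int (card S) * poly P y] (mod int p)"
      by (rule cong_diff)
    then show "[poly Q x = poly Q y] (mod int p)"
      by (simp add: Q_def poly_sum poly_pcompose)
  qed
  moreover have "\<not> int p dvd coeff Q (d - j)"
  proof -
    have "d \<le> degree P" using P(2) by (intro le_degree) auto
    then have "int p dvd coeff Q (d - j) \<longleftrightarrow> int p dvd t (d - j) d"
      unfolding coeff_Q using j by (intro dvd_sum_remove t_dvd) auto
    moreover have "\<not> p dvd (d choose (d - j))"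
    proof
      assume "p dvd (d choose (d - j))"
      then have "p dvd fact (d - j) * fact (d - (d - j)) * (d choose (d - j))" by simp
      then have "p dvd fact d" by (subst (asm) binomial_fact_lemma) auto
      then show False using d(2) prime by (simp add: prime_dvd_fact_iff)
    qed
    ultimately show ?thesis
      using P(2) j prime by (simp add: t_def prime_dvd_mult_iff)
  qed
  moreover have "int p dvd coeff Q n" if "n > d - j" for n
    unfolding coeff_Q using that by (intro dvd_sum t_dvd) auto
  ultimately show ?thesis unfolding degrees_def by blast
qed

lemma fermat_int:
  assumes "\<not> int p dvd x"
  shows "[x ^ (p - 1) = 1] (mod int p)"
proof -
  have p: "p > 0" using p_gt_1 by simp
  define y where "y = nat (x mod int p)"
  have y: "int y = x mod int p" using p by (simp add: y_def)
  have "\<not> int p dvd int y" using assms unfolding y by (simp add: dvd_mod_iff)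
  then have "[y ^ (p - 1) = 1] (mod p)" using prime by (intro fermat_theorem) auto
  then have "[int y ^ (p - 1) = 1] (mod int p)"
    using cong_int_iff[of "y ^ (p - 1)" 1 p] by simp
  moreover have "[x ^ (p - 1) = int y ^ (p - 1)] (mod int p)"
    by (intro cong_pow) (simp add: y cong_def)
  ultimately show ?thesis by (rule cong_trans[rotated])
qed

text \<open>
  By Fermat's little theorem the monomial of degree \<open>p - 1\<close> is the indicator of the nonzero
  residues, which makes indicators of complements of points available as polynomials.
\<close>

lemma power_indicator: "[x ^ (p - 1) = (if int p dvd x then 0 else 1)] (mod int p)"
proof (cases "int p dvd x")
  case True
  then have "int p dvd x ^ (p - 1)" using p_gt_1 by (intro dvd_power[THEN dvd_trans[rotated]] ) (auto intro: dvd_trans)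
  then show ?thesis using True by (simp add: cong_0_iff)
next
  case False
  then show ?thesis using fermat_int by simp
qed

text \<open>
  Expand the sum of \<open>(x - s) ^ (p - 1)\<close> over \<open>s \<in> S\<close> in powers of \<open>x\<close>. Its value is \<open>card S\<close>
  minus the indicator of \<open>S\<close> at \<open>x\<close>. If all power sums with exponents strictly between 0 and
  \<open>p - 1\<close> vanished, only the two outer terms would remain, and the value would be \<open>2 * card S\<close>
  for every nonzero \<open>x\<close>. Then the indicator of \<open>S\<close> would be constant on the nonzero residues.
\<close>

lemma ex_power_sum:
  assumes "S \<noteq> {}" "S \<noteq> {1..<int p}"
  shows "\<exists>j. 1 \<le> j \<and> j < p - 1 \<and> \<not> int p dvd power_sum j"
proof (rule ccontr)
  assume "\<not> ?thesis"
  then have van: "int p dvd power_sum j" if "1 \<le> j" "j < p - 1" for j using that by blast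
  have ind: "[(if x \<in> S then 1 else 0) = - int (card S)] (mod int p)" if x: "x \<in> {1..<int p}" for x
  proof -
    have eq_dvd: "int p dvd x - s \<longleftrightarrow> s = x" if "s \<in> S" for s
    proof
      assume "int p dvd x - s"
      then have "[x = s] (mod int p)" by (simp add: cong_iff_dvd_diff)
      then show "s = x" using x that S_subset by (auto simp: cong_def)
    qed simp
    have "[(\<Sum>s\<in>S. (x - s) ^ (p - 1)) = (\<Sum>s\<in>S. if s = x then 0 else 1)] (mod int p)"
    proof (rule cong_sum)
      fix s assume "s \<in> S"
      from power_indicator[of "x - s", unfolded eq_dvd[OF this]]
      show "[(x - s) ^ (p - 1) = (if s = x then 0 else 1)] (mod int p)" .
    qed
    also have "(\<Sum>s\<in>S. if s = x then 0 else 1) = (\<Sum>s\<in>S. 1 - (if s = x then 1 else 0 :: int))"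
      by (rule sum.cong) auto
    also have "\<dots> = int (card S) - (if x \<in> S then 1 else 0)"
      by (simp add: sum_subtractf finite_S)
    finally have 1: "[(\<Sum>s\<in>S. (x - s) ^ (p - 1)) = int (card S) - (if x \<in> S then 1 else 0)] (mod int p)" .
    have "(\<Sum>s\<in>S. (x - s) ^ (p - 1)) =
      (\<Sum>k\<le>p - 1. of_nat (p - 1 choose k) * x ^ k * power_sum (p - 1 - k))"
    proof -
      have "(\<Sum>s\<in>S. (x - s) ^ (p - 1)) = (\<Sum>s\<in>S. (x + (- s)) ^ (p - 1))" by simp
      also have "\<dots> = (\<Sum>s\<in>S. \<Sum>k\<le>p - 1. of_nat (p - 1 choose k) * x ^ k * (- s) ^ (p - 1 - k))"
        by (simp only: binomial_ring)
      also have "\<dots> = (\<Sum>k\<le>p - 1. \<Sum>s\<in>S. of_nat (p - 1 choose k) * x ^ k * (- s) ^ (p - 1 - k))"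
        by (rule sum.swap)
      finally show ?thesis by (simp only: power_sum_def sum_distrib_left)
    qed
    also have "{..p - 1} = insert 0 (insert (p - 1) {1..<p - 1})" using p_gt_1 by auto
    also have "(\<Sum>k\<in>insert 0 (insert (p - 1) {1..<p - 1}). of_nat (p - 1 choose k) * x ^ k * power_sum (p - 1 - k)) =
       power_sum (p - 1) + x ^ (p - 1) * int (card S) +
       (\<Sum>k\<in>{1..<p - 1}. of_nat (p - 1 choose k) * x ^ k * power_sum (p - 1 - k))"
      using p_gt_1 by (simp add: power_sum_def)
    also have "[\<dots> = int (card S) + 1 * int (card S) + 0] (mod int p)"
    proof (intro cong_add cong_mult cong_refl)
      have "[power_sum (p - 1) = (\<Sum>s\<in>S. 1)] (mod int p)"
        unfolding power_sum_def
      proof (rule cong_sum)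
        fix s assume "s \<in> S"
        then have "\<not> int p dvd - s" using S_subset zdvd_not_zless by auto
        then show "[(- s) ^ (p - 1) = 1] (mod int p)" by (rule fermat_int)
      qed
      then show "[power_sum (p - 1) = int (card S)] (mod int p)" by simp
      have "\<not> int p dvd x" using x zdvd_not_zless by auto
      then show "[x ^ (p - 1) = 1] (mod int p)" by (rule fermat_int)
      show "[(\<Sum>k\<in>{1..<p - 1}. of_nat (p - 1 choose k) * x ^ k * power_sum (p - 1 - k)) = 0] (mod int p)"
        unfolding cong_0_iff
        by (intro dvd_sum dvd_mult van) auto
    qed
    finally have "[int (card S) - (if x \<in> S then 1 else 0) = int (card S) + int (card S)] (mod int p)"
      using cong_trans[OF cong_sym[OF 1]] by simp
    moreover have "A - B - (A + A) = - (B - (- A))" for A B :: int by simp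
    ultimately show ?thesis
      unfolding cong_iff_dvd_diff by (simp only: dvd_minus_iff)
  qed
  obtain x where x: "x \<in> S" using assms(1) by blast
  obtain y where y: "y \<in> {1..<int p}" "y \<notin> S" using assms(2) S_subset by blast
  have "[1 = - int (card S)] (mod int p)" using ind[of x] x S_subset by auto
  moreover have "[0 = - int (card S)] (mod int p)" using ind[of y] y by auto
  ultimately have "[1 = 0] (mod int p)" using cong_trans cong_sym by blast
  then show False using p_gt_1 by (simp add: cong_def)
qed

text \<open>
  The indicator polynomial of the complement of a point has degree \<open>p - 1\<close>. The difference of
  two of them has degree \<open>p - 2\<close>, since the second coefficients of \<open>(X - a) ^ (p - 1)\<close> and
  \<open>X ^ (p - 1)\<close> differ by a nonzero multiple of \<open>a\<close>.
\<close>

lemma singleton_degrees: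
  assumes zero: "\<And>z. c z = c 0 \<Longrightarrow> int p dvd z"
    and a: "\<And>z. c z = c a \<Longrightarrow> [z = a] (mod int p)" "\<not> int p dvd a"
  shows "p - 1 \<in> degrees" "p - 2 \<in> degrees"
proof -
  have inv: "poly_invariant ([:- b, 1:] ^ (p - 1))" if "\<And>z. c z = c b \<Longrightarrow> [z = b] (mod int p)" for b
  proof (rule poly_invariantI)
    fix x y assume xy: "c x = c y"
    have z: "int p dvd w - b \<longleftrightarrow> c w = c b" for w
      using that periodic[of w b] by (auto simp: cong_iff_dvd_diff)
    have "[poly ([:- b, 1:] ^ (p - 1)) w = (if c w = c b then 0 else 1)] (mod int p)" for w
      using power_indicator[of "w - b"] by (simp add: z)
    from cong_trans[OF this[of x] cong_sym[OF this[of y, folded xy]]]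
    show "[poly ([:- b, 1:] ^ (p - 1)) x = poly ([:- b, 1:] ^ (p - 1)) y] (mod int p)" .
  qed
  have i0: "poly_invariant ([:- 0, 1:] ^ (p - 1))"
    by (rule inv) (use zero in \<open>simp add: cong_0_iff\<close>)
  have ia: "poly_invariant ([:- a, 1:] ^ (p - 1))"
    by (rule inv) (rule a)
  have cf: "coeff ([:- b, 1:] ^ (p - 1)) i = of_nat (p - 1 choose i) * (- b) ^ (p - 1 - i)" for b :: int and i
    by (simp add: coeff_linear_power_int)
  have p: "\<not> int p dvd 1" using p_gt_1 by simp
  show "p - 1 \<in> degrees"
    unfolding degrees_def using i0 p
    by (intro CollectI exI[of _ "[:- 0, 1:] ^ (p - 1)"]) (auto simp only: cf, auto simp: binomial_eq_0)
  define P where "P = [:- a, 1:] ^ (p - 1) - [:- 0, 1:] ^ (p - 1)"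
  have "poly_invariant P"
    unfolding P_def
    by (rule poly_invariantI) (simp only: poly_diff, intro cong_diff poly_invariantD i0 ia)
  moreover have "coeff P (p - 2) = - (int (p - 1) * a)"
  proof -
    obtain k where "p = 2 + k" using p_gt_1 le_Suc_ex[of 2 p] by auto
    then show ?thesis unfolding P_def coeff_diff cf by (simp add: algebra_simps)
  qed
  moreover have "\<not> int p dvd - (int (p - 1) * a)"
  proof -
    have "\<not> p dvd p - 1" using p_gt_1 by (auto dest: dvd_imp_le)
    then have "\<not> int p dvd int (p - 1)" by (simp only: of_nat_dvd_iff not_False_eq_True)
    then show ?thesis using a(2) prime by (simp only: dvd_minus_iff) (simp add: prime_dvd_mult_iff)
  qed
  moreover have "int p dvd coeff P i" if "i > p - 2" for i
    using that unfolding P_def coeff_diff cf by (cases "i = p - 1") auto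
  ultimately show "p - 2 \<in> degrees"
    unfolding degrees_def by auto
qed

end

text \<open>
  Call a residue class modulo \<open>j\<close> full if all its members up to \<open>N\<close> lie in the set. By
  subtraction a class is full as soon as its largest member up to \<open>N\<close> belongs to the set. Full
  classes can be added to those of \<open>N\<close> and \<open>N - 1\<close>: adding to a member of the top window the
  least representative of the other class leaves the window by less than \<open>j\<close>, which is
  corrected by a subtraction. Starting from the class of \<open>N\<close> and adding \<open>N - 1\<close> repeatedly,
  the class of 1 is reached after \<open>j - 1\<close> steps.
\<close>

lemma one_in_additive_set:
  fixes \<Gamma> :: "nat set"
  assumes N: "N \<in> \<Gamma>" "N - 1 \<in> \<Gamma>" and j: "1 \<le> j" "j < N"
    and sub: "\<And>d. d \<in> \<Gamma> \<Longrightarrow> d \<le> N \<Longrightarrow> j \<le> d \<Longrightarrow> d - j \<in> \<Gamma>"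
    and add: "\<And>d e. d \<in> \<Gamma> \<Longrightarrow> e \<in> \<Gamma> \<Longrightarrow> d + e \<in> \<Gamma>"
  shows "1 \<in> \<Gamma>"
proof -
  define full where "full = (\<lambda>r. \<forall>n\<le>N. [n = r] (mod j) \<longrightarrow> n \<in> \<Gamma>)"
  have sub_mult: "d - i * j \<in> \<Gamma>" if "d \<in> \<Gamma>" "d \<le> N" "i * j \<le> d" for d i
    using that(3)
  proof (induction i)
    case 0
    then show ?case using that by simp
  next
    case (Suc i)
    then have "d - i * j \<in> \<Gamma>" by simp
    then have "d - i * j - j \<in> \<Gamma>" using Suc.prems that by (intro sub) auto
    then show ?case by (simp add: algebra_simps)
  qed
  have fullI: "full r" if w: "w \<in> \<Gamma>" "w \<le> N" "N < w + j" "[w = r] (mod j)" for w r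
    unfolding full_def
  proof (intro allI impI)
    fix n assume n: "n \<le> N" "[n = r] (mod j)"
    then have "[n = w] (mod j)" using w(4) cong_trans cong_sym by blast
    moreover have "n < w + j" using n w by simp
    ultimately have "n \<le> w" "j dvd w - n"
    proof -
      show "n \<le> w"
      proof (rule ccontr)
        assume "\<not> n \<le> w"
        then have "j dvd n - w" "0 < n - w" "n - w < j"
          using \<open>[n = w] (mod j)\<close> \<open>n < w + j\<close> by (auto simp: cong_altdef_nat)
        then show False by (auto dest: dvd_imp_le)
      qed
      then show "j dvd w - n" using cong_sym[OF \<open>[n = w] (mod j)\<close>] by (simp add: cong_altdef_nat)
    qed
    then obtain i where "w - n = i * j" by (metis dvdE mult.commute)
    then have "n = w - i * j" "i * j \<le> w" using \<open>n \<le> w\<close> by auto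
    then show "n \<in> \<Gamma>" using sub_mult w by metis
  qed
  have full_cong: "full r'" if "full r" "[r = r'] (mod j)" for r r'
    using that unfolding full_def by (meson cong_sym cong_trans)
  \<comment> \<open>The \<open>j\<close> largest numbers up to \<open>N\<close> represent every class.\<close>
  have window: "\<exists>w. w \<le> N \<and> N < w + j \<and> [w = r] (mod j)" for r
  proof (intro exI conjI)
    let ?w = "N - (N + j * r - r) mod j"
    have m: "(N + j * r - r) mod j < j" using j by simp
    show "?w \<le> N" by simp
    show "N < ?w + j" using m j by linarith
    have "[?w + (N + j * r - r) mod j = r + (N + j * r - r)] (mod j)"
    proof -
      have "?w + (N + j * r - r) mod j = N" using m j by linarith
      moreover have "r + (N + j * r - r) = N + j * r" using j by (cases j) auto
      ultimately show ?thesis by (simp add: cong_def)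
    qed
    then have "[?w + (N + j * r - r) = r + (N + j * r - r)] (mod j)"
      by (simp add: cong_def mod_add_right_eq)
    then show "[?w = r] (mod j)" by (simp add: cong_add_rcancel_nat)
  qed
  have step: "full (r + e)" if r: "full r" and e: "e = N \<or> e = N - 1" and fe: "full e" for r e
  proof -
    obtain w where w: "w \<le> N" "N < w + j" "[w = r] (mod j)" using window by blast
    have w\<Gamma>: "w \<in> \<Gamma>" using r w unfolding full_def by blast
    define e0 where "e0 = e mod j"
    have e0: "e0 < j" "[e0 = e] (mod j)" unfolding e0_def using j by (auto simp: cong_def)
    have e0\<Gamma>: "e0 \<in> \<Gamma>" using fe e0 j unfolding full_def by simp
    have re: "[w + e0 = r + e] (mod j)" using w(3) e0(2) by (rule cong_add)
    show ?thesis
    proof (cases "w + e0 \<le> N")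
      case True
      then show ?thesis using w re by (intro fullI[of "w + e0"] add w\<Gamma> e0\<Gamma>) auto
    next
      case False
      have "j \<le> e" using e j by auto
      then have "e0 + j \<le> e" using j unfolding e0_def
        by (metis add.commute add_le_mono1 le_add_diff_inverse le_mod_geq mod_less_eq_dividend)
      then have jw: "j \<le> w" using False e by auto
      show ?thesis
      proof (rule fullI[of "w - j + e0"])
        show "w - j + e0 \<in> \<Gamma>" using jw w by (intro add sub w\<Gamma> e0\<Gamma>) auto
        show "w - j + e0 \<le> N" using w e0 jw by simp
        show "N < w - j + e0 + j" using False jw by simp
        have "w - j + e0 + j = w + e0" using jw by simp
        then show "[w - j + e0 = r + e] (mod j)"
          using re by (metis cong_def mod_add_self2)
      qed
    qed
  qed
  have fN: "full N" by (rule fullI[of N]) (use N j in auto)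
  have fN1: "full (N - 1)"
  proof (cases "j = 1")
    case True
    then show ?thesis using fN by (elim full_cong) (simp add: cong_def)
  next
    case False
    then show ?thesis using N j by (intro fullI[of "N - 1"]) auto
  qed
  have "full (N + i * (N - 1))" for i
  proof (induction i)
    case 0
    then show ?case using fN by simp
  next
    case (Suc i)
    have "N + Suc i * (N - 1) = N + i * (N - 1) + (N - 1)" by simp
    then show ?case using step[OF Suc _ fN1] by metis
  qed
  from this[of "j - 1"] have "full 1"
  proof (rule full_cong)
    have "j * (N - 1) = (N - 1) + (j - 1) * (N - 1)"
      using j mult_eq_if[of j "N - 1"] by simp
    then have "N + (j - 1) * (N - 1) = 1 + j * (N - 1)" using j by linarith
    then show "[N + (j - 1) * (N - 1) = 1] (mod j)" by (simp only: cong_def mod_mult_self2)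
  qed
  moreover have "1 \<le> N" using j by simp
  ultimately show ?thesis using cong_refl[of 1 j] unfolding full_def by (elim allE impE)
qed

context equitable_coloring
begin

text \<open>
  With degree 1 available there is an invariant polynomial that is linear modulo \<open>p\<close> with
  invertible slope.
\<close>

lemma two_singletons_imp_discrete:
  assumes zero: "\<And>z. c z = c 0 \<Longrightarrow> int p dvd z"
    and a: "\<And>z. c z = c a \<Longrightarrow> [z = a] (mod int p)" "\<not> int p dvd a"
    and S: "S \<noteq> {}" "S \<noteq> {1..<int p}"
    and xy: "c x = c y"
  shows "[x = y] (mod int p)"
proof -
  let ?Q = "\<lambda>j. 1 \<le> j \<and> \<not> int p dvd power_sum j"
  define j where "j = (LEAST j. ?Q j)"
  obtain k where k: "?Q k" "k < p - 1" using ex_power_sum[OF S] by blast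
  have j: "?Q j" unfolding j_def using k(1) by (rule LeastI)
  have "j \<le> k" unfolding j_def using k(1) by (rule Least_le)
  then have jp: "j < p - 1" using k(2) by simp
  have least: "int p dvd power_sum i" if "1 \<le> i" "i < j" for i
    using not_less_Least[of i ?Q] that unfolding j_def by blast
  have "1 \<in> degrees"
  proof (rule one_in_additive_set)
    show "p - 1 \<in> degrees" by (rule singleton_degrees[OF zero a])
    have "p - 2 \<in> degrees" by (rule singleton_degrees[OF zero a])
    then show "p - 1 - 1 \<in> degrees" by (simp add: numeral_2_eq_2)
    show "1 \<le> j" "j < p - 1" using j jp by auto
    show "d - j \<in> degrees" if "d \<in> degrees" "d \<le> p - 1" "j \<le> d" for d
      using that j least p_gt_1 by (intro degrees_sub) auto
    show "d + e \<in> degrees" if "d \<in> degrees" "e \<in> degrees" for d e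
      using that by (rule degrees_add)
  qed
  then obtain P where
    P: "poly_invariant P" "\<not> int p dvd coeff P 1" "\<And>i. i > 1 \<Longrightarrow> int p dvd coeff P i"
    unfolding degrees_def by blast
  have lin: "[poly P z = coeff P 0 + coeff P 1 * z] (mod int p)" for z
  proof -
    have "poly P z = (\<Sum>i\<le>max 1 (degree P). coeff P i * z ^ i)"
      unfolding poly_altdef by (rule sum.mono_neutral_left) (auto simp: coeff_eq_0)
    also have "{..max 1 (degree P)} = insert 0 (insert 1 {2..max 1 (degree P)})" by auto
    also have "(\<Sum>i\<in>\<dots>. coeff P i * z ^ i) =
      coeff P 0 + coeff P 1 * z + (\<Sum>i\<in>{2..max 1 (degree P)}. coeff P i * z ^ i)" by simp
    also have "[\<dots> = coeff P 0 + coeff P 1 * z + 0] (mod int p)"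
      by (intro cong_add cong_refl, unfold cong_0_iff) (auto intro!: dvd_sum dvd_mult2 P(3))
    finally show ?thesis by simp
  qed
  have "[coeff P 0 + coeff P 1 * x = coeff P 0 + coeff P 1 * y] (mod int p)"
    using cong_trans[OF cong_trans[OF cong_sym[OF lin[of x]] poly_invariantD[OF P(1) xy]] lin[of y]] .
  then have "int p dvd coeff P 1 * (x - y)"
    by (simp add: cong_iff_dvd_diff algebra_simps)
  then show ?thesis
    using P(2) prime by (simp add: prime_dvd_mult_iff cong_iff_dvd_diff)
qed

end

section \<open>Partition refinement\<close>

definition cell :: "nat \<Rightarrow> (nat \<Rightarrow> nat) \<Rightarrow> nat \<Rightarrow> nat set" where
  "cell p col b = {v. v < p \<and> col v = b}"

lemma finite_cell [simp]: "finite (cell p col b)"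
  by (simp add: cell_def)

lemma in_cell_iff: "v \<in> cell p col b \<longleftrightarrow> v < p \<and> col v = b"
  by (simp add: cell_def)

lemma cell_Int_nonempty: "v < p \<Longrightarrow> v \<in> M \<Longrightarrow> cell p col (col v) \<inter> M \<noteq> {}"
  by (auto simp: in_cell_iff)

lemma cell_Diff_nonempty: "v < p \<Longrightarrow> v \<notin> M \<Longrightarrow> cell p col (col v) - M \<noteq> {}"
  by (auto simp: in_cell_iff)

definition colors :: "nat \<Rightarrow> (nat \<Rightarrow> nat) \<Rightarrow> nat set" where
  "colors p col = col ` {..<p}"

definition split_cells :: "nat \<Rightarrow> nat set \<Rightarrow> (nat \<Rightarrow> nat) \<Rightarrow> nat set" where
  "split_cells p M col = {b. cell p col b \<inter> M \<noteq> {} \<and> cell p col b - M \<noteq> {}}"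

text \<open>
  A cell with color \<open>b\<close> is thought of as occupying the positions from \<open>b\<close> on in an ordered
  partition. When it is split, the part outside \<open>M\<close> comes first and keeps the name \<open>b\<close>, and
  the part inside \<open>M\<close> starts after it. If there is nothing outside \<open>M\<close>, the name does not
  change.
\<close>

definition new_color :: "nat \<Rightarrow> nat set \<Rightarrow> (nat \<Rightarrow> nat) \<Rightarrow> nat \<Rightarrow> nat" where
  "new_color p M col b = b + card (cell p col b - M)"

definition split_col :: "nat \<Rightarrow> nat set \<Rightarrow> (nat \<Rightarrow> nat) \<Rightarrow> nat \<Rightarrow> nat" where
  "split_col p M col v = (if v \<in> M then new_color p M col (col v) else col v)"

text \<open>
  If \<open>b\<close> is waiting, it continues to wait as the name of the part outside \<open>M\<close>, and the other
  part has to be added. If it is not waiting, adding one part suffices, as the arcs from the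
  whole cell have been accounted for; the choice of the smaller one gives the logarithmic time
  bound.
\<close>

definition smaller_part :: "nat \<Rightarrow> nat set \<Rightarrow> (nat \<Rightarrow> nat) \<Rightarrow> nat set \<Rightarrow> nat \<Rightarrow> nat" where
  "smaller_part p M col W b =
    (if b \<in> W \<or> card (cell p col b \<inter> M) \<le> card (cell p col b - M) then new_color p M col b else b)"

definition split_queue :: "nat \<Rightarrow> nat set \<Rightarrow> (nat \<Rightarrow> nat) \<Rightarrow> nat set \<Rightarrow> nat set" where
  "split_queue p M col W = W \<union> smaller_part p M col W ` split_cells p M col"

text \<open>
  A refinement state consists of a coloring and the set of waiting colors.
\<close>

type_synonym refinement = "(nat \<Rightarrow> nat) \<times> nat set"

definition split :: "nat \<Rightarrow> nat set \<Rightarrow> refinement \<Rightarrow> refinement" where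
  "split p M st = (split_col p M (fst st), split_queue p M (fst st) (snd st))"

lemma fst_split [simp]: "fst (split p M st) = split_col p M (fst st)"
  and snd_split [simp]: "snd (split p M st) = split_queue p M (fst st) (snd st)"
  by (simp_all add: split_def)

text \<open>
  The intervals of positions that start at the colors and are as long as the cells are
  disjoint and lie below \<open>p\<close>. This is what makes new names fresh.
\<close>

definition valid_coloring :: "nat \<Rightarrow> (nat \<Rightarrow> nat) \<Rightarrow> bool" where
  "valid_coloring p col \<longleftrightarrow>
    (\<forall>v<p. col v + card (cell p col (col v)) \<le> p) \<and>
    (\<forall>u<p. \<forall>v<p. col u < col v \<longrightarrow> col u + card (cell p col (col u)) \<le> col v)"

definition valid :: "nat \<Rightarrow> refinement \<Rightarrow> bool" where
  "valid p st \<longleftrightarrow> valid_coloring p (fst st) \<and> snd st \<subseteq> colors p (fst st) \<and> 0 \<in> colors p (fst st)"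

lemma card_cell_split: "card (cell p col b) = card (cell p col b - M) + card (cell p col b \<inter> M)"
  by (metis Diff_Int_distrib2 Int_lower2 Un_Diff_Int add.commute card_Int_Diff finite_cell inf_commute)

context
  fixes p :: nat and col :: "nat \<Rightarrow> nat" and M :: "nat set"
  assumes valid: "valid_coloring p col"
begin

lemma color_bound: "v < p \<Longrightarrow> col v + card (cell p col (col v)) \<le> p"
  and color_gap: "u < p \<Longrightarrow> v < p \<Longrightarrow> col u < col v \<Longrightarrow> col u + card (cell p col (col u)) \<le> col v"
  using valid by (auto simp: valid_coloring_def)

lemma card_cell_pos: "v < p \<Longrightarrow> 0 < card (cell p col (col v))"
  by (auto simp: card_gt_0_iff in_cell_iff)

lemma color_less: "v < p \<Longrightarrow> col v < p"
  using color_bound[of v] card_cell_pos[of v] by simp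

lemma split_col_bounds:
  assumes "v < p"
  shows "col v \<le> split_col p M col v" "split_col p M col v < col v + card (cell p col (col v))"
proof -
  show "col v \<le> split_col p M col v" by (simp add: split_col_def new_color_def)
  show "split_col p M col v < col v + card (cell p col (col v))"
  proof (cases "v \<in> M")
    case True
    then have "card (cell p col (col v) \<inter> M) > 0"
      using assms by (auto simp: card_gt_0_iff in_cell_iff)
    then show ?thesis using card_cell_split[of p col "col v" M] True
      by (simp add: split_col_def new_color_def)
  next
    case False
    then show ?thesis using card_cell_pos[OF assms] by (simp add: split_col_def)
  qed
qed

lemma split_col_imp_col_eq:
  assumes "u < p" "v < p" "split_col p M col u = split_col p M col v"
  shows "col u = col v"
  using color_gap[of u v] color_gap[of v u] split_col_bounds[of u] split_col_bounds[of v] assms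
  by (metis (no_types, lifting) leD le_less_trans less_le_trans linorder_neqE_nat)

lemma split_col_eq_iff:
  assumes "u < p" "v < p"
  shows "split_col p M col u = split_col p M col v \<longleftrightarrow> col u = col v \<and> (u \<in> M \<longleftrightarrow> v \<in> M)"
proof
  assume eq: "split_col p M col u = split_col p M col v"
  have cu: "col u = col v" using split_col_imp_col_eq[OF assms eq] .
  have *: "card (cell p col (col v) - M) > 0" if "w < p" "col w = col v" "w \<notin> M" for w
    using that by (auto simp: card_gt_0_iff in_cell_iff)
  moreover have "u \<in> M \<longleftrightarrow> v \<in> M"
  proof (rule ccontr)
    assume "(u \<in> M) \<noteq> (v \<in> M)"
    then consider "u \<in> M" "v \<notin> M" | "u \<notin> M" "v \<in> M" by blast
    then show False
    proof cases
      case 1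
      then have "col v + card (cell p col (col v) - M) = col v"
        using eq cu by (simp only: split_col_def new_color_def if_True if_False)
      then show False using *[of v] 1 assms by linarith
    next
      case 2
      then have "col v + card (cell p col (col v) - M) = col v"
        using eq cu by (simp only: split_col_def new_color_def if_True if_False)
      then show False using *[of u] cu 2 assms by linarith
    qed
  qed
  ultimately show "col u = col v \<and> (u \<in> M \<longleftrightarrow> v \<in> M)" using cu by blast
qed (auto simp: split_col_def)

lemma cell_split_col:
  assumes "v < p"
  shows "cell p (split_col p M col) (split_col p M col v) =
    (if v \<in> M then cell p col (col v) \<inter> M else cell p col (col v) - M)"
  using split_col_eq_iff[OF _ assms] by (auto simp: in_cell_iff)

lemma cell_split_old:
  assumes "b \<in> split_cells p M col"
  shows "cell p (split_col p M col) b = cell p col b - M"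
    and "cell p (split_col p M col) (new_color p M col b) = cell p col b \<inter> M"
proof -
  have "cell p col b \<inter> M \<noteq> {}" "cell p col b - M \<noteq> {}" using assms by (auto simp: split_cells_def)
  then obtain u v where u: "u < p" "col u = b" "u \<in> M" and v: "v < p" "col v = b" "v \<notin> M"
    unfolding in_cell_iff ex_in_conv[symmetric] by (auto simp: in_cell_iff)
  from cell_split_col[OF v(1)] v show "cell p (split_col p M col) b = cell p col b - M"
    by (simp add: split_col_def)
  from cell_split_col[OF u(1)] u
  show "cell p (split_col p M col) (new_color p M col b) = cell p col b \<inter> M"
    by (simp add: split_col_def)
qed

lemma cell_unsplit:
  assumes "b \<notin> split_cells p M col" "b \<in> colors p col"
  shows "cell p (split_col p M col) b = cell p col b"
proof -
  from assms(2) obtain v where v: "v < p" "col v = b" by (auto simp: colors_def)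
  have "split_col p M col v = b"
    using assms(1) v cell_Int_nonempty[OF v(1), of M col] by (auto simp: split_col_def new_color_def split_cells_def)
  then show ?thesis
    using cell_split_col[OF v(1)] v assms(1) cell_Int_nonempty[OF v(1), of M col]
      cell_Diff_nonempty[OF v(1), of M col]
    by (cases "v \<in> M") (auto simp: split_cells_def)
qed

lemma split_cells_subset: "split_cells p M col \<subseteq> colors p col"
  by (auto simp: split_cells_def colors_def in_cell_iff)

lemma finite_split_cells: "finite (split_cells p M col)"
  by (rule finite_subset[OF split_cells_subset]) (simp add: colors_def)

lemma new_color_bounds:
  assumes "b \<in> split_cells p M col"
  shows "b < new_color p M col b" "new_color p M col b < b + card (cell p col b)"
proof -
  have "card (cell p col b - M) > 0" "card (cell p col b \<inter> M) > 0"
    using assms by (auto simp: split_cells_def card_gt_0_iff)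
  then show "b < new_color p M col b" "new_color p M col b < b + card (cell p col b)"
    using card_cell_split[of p col b M] by (auto simp: new_color_def)
qed

lemma new_color_fresh: "b \<in> split_cells p M col \<Longrightarrow> new_color p M col b \<notin> colors p col"
proof
  assume b: "b \<in> split_cells p M col" and "new_color p M col b \<in> colors p col"
  then obtain u v where "u < p" "col u = b" "v < p" "col v = new_color p M col b"
    using split_cells_subset by (auto simp: colors_def)
  then show False using color_gap[of u v] new_color_bounds[OF b] by auto
qed

lemma inj_on_new_color: "inj_on (new_color p M col) (split_cells p M col)"
proof (rule inj_onI)
  fix b b' assume b: "b \<in> split_cells p M col" "b' \<in> split_cells p M col"
    and eq: "new_color p M col b = new_color p M col b'"
  obtain u where "u < p" "col u = b" using b(1) split_cells_subset by (auto simp: colors_def)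
  moreover obtain v where "v < p" "col v = b'" using b(2) split_cells_subset by (auto simp: colors_def)
  ultimately show "b = b'"
    using color_gap[of u v] color_gap[of v u] new_color_bounds[OF b(1)] new_color_bounds[OF b(2)] eq
    by (cases b b' rule: linorder_cases) auto
qed

lemma colors_split_col:
  "colors p (split_col p M col) = colors p col \<union> new_color p M col ` split_cells p M col"
proof (intro equalityI subsetI)
  fix c assume "c \<in> colors p (split_col p M col)"
  then obtain v where v: "v < p" "c = split_col p M col v" by (auto simp: colors_def)
  show "c \<in> colors p col \<union> new_color p M col ` split_cells p M col"
  proof (cases "v \<in> M \<and> cell p col (col v) - M \<noteq> {}")
    case True
    then have "col v \<in> split_cells p M col" using cell_Int_nonempty[OF v(1)] by (simp add: split_cells_def)
    then show ?thesis using True v by (auto simp: split_col_def)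
  next
    case False
    then have "c = col v" using v by (cases "v \<in> M") (simp_all add: split_col_def new_color_def)
    then show ?thesis using v by (auto simp: colors_def)
  qed
next
  fix c assume "c \<in> colors p col \<union> new_color p M col ` split_cells p M col"
  then show "c \<in> colors p (split_col p M col)"
  proof
    assume c: "c \<in> colors p col"
    show ?thesis
    proof (cases "c \<in> split_cells p M col")
      case True
      then have "cell p col c - M \<noteq> {}" by (simp add: split_cells_def)
      then obtain v where "v \<in> cell p col c - M" by blast
      then have "v < p" "col v = c" "v \<notin> M" by (auto simp: in_cell_iff)
      then show ?thesis by (auto simp: colors_def split_col_def intro!: image_eqI[of _ _ v])
    next
      case False
      then have "cell p (split_col p M col) c = cell p col c" using c by (rule cell_unsplit)
      then show ?thesis using c by (auto simp: colors_def in_cell_iff set_eq_iff) (metis imageI lessThan_iff)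
    qed
  next
    assume "c \<in> new_color p M col ` split_cells p M col"
    then obtain b where b: "b \<in> split_cells p M col" "c = new_color p M col b" by blast
    then obtain u where "u < p" "col u = b" "u \<in> M" by (auto simp: split_cells_def in_cell_iff)
    then show ?thesis using b by (auto simp: colors_def split_col_def intro!: image_eqI[of _ _ u])
  qed
qed

lemma card_colors_split: "card (colors p (split_col p M col)) = card (colors p col) + card (split_cells p M col)"
proof -
  have "colors p col \<inter> new_color p M col ` split_cells p M col = {}" using new_color_fresh by blast
  moreover have "finite (colors p col)" by (simp add: colors_def)
  ultimately show ?thesis
    unfolding colors_split_col
    by (simp add: card_Un_disjoint finite_split_cells card_image[OF inj_on_new_color])
qed

lemma valid_split_col: "valid_coloring p (split_col p M col)"
  unfolding valid_coloring_def
proof (intro conjI allI impI)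
  have upper: "split_col p M col v + card (cell p (split_col p M col) (split_col p M col v))
      \<le> col v + card (cell p col (col v))" if "v < p" for v
    using card_cell_split[of p col "col v" M]
    by (auto simp: cell_split_col[OF that]) (simp_all add: split_col_def new_color_def)
  show "split_col p M col v + card (cell p (split_col p M col) (split_col p M col v)) \<le> p" if "v < p" for v
    using upper[OF that] color_bound[OF that] by simp
  fix u v assume uv: "u < p" "v < p" "split_col p M col u < split_col p M col v"
  consider "col u < col v" | "col u = col v" | "col v < col u" by linarith
  then show "split_col p M col u + card (cell p (split_col p M col) (split_col p M col u)) \<le> split_col p M col v"
  proof cases
    case 1
    then show ?thesis
      using upper[OF uv(1)] color_gap[OF uv(1,2)] split_col_bounds[OF uv(2)] by linarith
  next
    case 2
    then have "u \<notin> M" "v \<in> M" using uv(3) by (auto simp: split_col_def new_color_def split: if_splits)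
    then show ?thesis using 2 uv(1) by (simp add: cell_split_col) (simp add: split_col_def new_color_def)
  next
    case 3
    then show ?thesis
      using uv color_gap[OF uv(2,1)] split_col_bounds[OF uv(1)] split_col_bounds[OF uv(2)] by linarith
  qed
qed

lemma smaller_part_in_colors: "b \<in> split_cells p M col \<Longrightarrow> smaller_part p M col W b \<in> colors p (split_col p M col)"
  using split_cells_subset by (auto simp: smaller_part_def colors_split_col)

end

lemma valid_split:
  assumes "valid p st"
  shows "valid p (split p M st)"
proof -
  have vc: "valid_coloring p (fst st)" and W: "snd st \<subseteq> colors p (fst st)"
    using assms by (auto simp: valid_def)
  have "snd st \<subseteq> colors p (split_col p M (fst st))" "0 \<in> colors p (split_col p M (fst st))"
    using W assms by (auto simp: colors_split_col[OF vc] valid_def)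
  then show ?thesis
    using smaller_part_in_colors[OF vc] valid_split_col[OF vc]
    by (auto simp: valid_def split_queue_def)
qed

lemma valid_remove: "valid p (col, W) \<Longrightarrow> valid p (col, W - {x})"
  by (auto simp: valid_def)

subsection \<open>Stability\<close>

definition hits :: "(nat \<times> nat) set \<Rightarrow> nat set \<Rightarrow> nat \<Rightarrow> nat" where
  "hits E X v = card {u \<in> X. (u, v) \<in> E}"

lemma hits_Un: "finite X \<Longrightarrow> finite Y \<Longrightarrow> X \<inter> Y = {} \<Longrightarrow> hits E (X \<union> Y) v = hits E X v + hits E Y v"
proof -
  assume *: "finite X" "finite Y" "X \<inter> Y = {}"
  have "{u \<in> X \<union> Y. (u, v) \<in> E} = {u \<in> X. (u, v) \<in> E} \<union> {u \<in> Y. (u, v) \<in> E}" by blast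
  then show ?thesis unfolding hits_def using * by (simp add: card_Un_disjoint disjoint_iff)
qed

lemma hits_empty [simp]: "hits E {} v = 0"
  by (simp add: hits_def)

lemma hits_cell_split:
  "hits E (cell p col b) v = hits E (cell p col b - M) v + hits E (cell p col b \<inter> M) v"
  by (subst hits_Un[symmetric]) (auto intro: arg_cong[of _ _ "\<lambda>X. hits E X v"])

text \<open>
  The invariant of Hopcroft's method: vertices of the same color that cannot be distinguished
  by the waiting cells cannot be distinguished by any cell. The set \<open>X\<close> is an additional cell,
  already removed from the waiting ones but not yet completely used for splitting; for the
  empty set its condition is void. With no color waiting, the invariant says that the coloring
  is equitable.
\<close>

definition stable_up_to :: "nat \<Rightarrow> (nat \<times> nat) set \<Rightarrow> nat set \<Rightarrow> refinement \<Rightarrow> bool" where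
  "stable_up_to p E X st \<longleftrightarrow> (\<forall>u<p. \<forall>v<p. fst st u = fst st v \<longrightarrow>
     (\<forall>b\<in>snd st. hits E (cell p (fst st) b) u = hits E (cell p (fst st) b) v) \<longrightarrow>
     hits E X u = hits E X v \<longrightarrow>
     (\<forall>b. hits E (cell p (fst st) b) u = hits E (cell p (fst st) b) v))"

lemma stable_up_toD:
  assumes "stable_up_to p E X (col, W)" "u < p" "v < p" "col u = col v"
    and "\<And>b. b \<in> W \<Longrightarrow> hits E (cell p col b) u = hits E (cell p col b) v"
    and "hits E X u = hits E X v"
  shows "hits E (cell p col b) u = hits E (cell p col b) v"
  using assms unfolding stable_up_to_def by (metis fst_conv snd_conv)

text \<open>
  The counts for a cell are the sums of the counts for its two parts, so the old cell and one
  part determine the other part.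
\<close>

lemma stable_up_to_split:
  assumes v: "valid p st" and st: "stable_up_to p E X st"
  shows "stable_up_to p E X (split p M st)"
  unfolding stable_up_to_def
proof (intro allI impI)
  obtain col W where [simp]: "st = (col, W)" by (cases st)
  have vc: "valid_coloring p col" and W: "W \<subseteq> colors p col" using v by (auto simp: valid_def)
  let ?col' = "split_col p M col" and ?W' = "split_queue p M col W"
  fix u v c assume uv: "u < p" "v < p" "fst (split p M st) u = fst (split p M st) v"
    and q: "\<forall>b\<in>snd (split p M st). hits E (cell p (fst (split p M st)) b) u = hits E (cell p (fst (split p M st)) b) v"
    and X: "hits E X u = hits E X v"
  have col: "col u = col v" using uv split_col_eq_iff[OF vc] by simp
  have q': "hits E (cell p ?col' b) u = hits E (cell p ?col' b) v" if "b \<in> ?W'" for b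
    using q that by simp
  have "hits E (cell p col b) u = hits E (cell p col b) v" if b: "b \<in> W" for b
  proof (cases "b \<in> split_cells p M col")
    case True
    then have "smaller_part p M col W b = new_color p M col b" using b by (simp add: smaller_part_def)
    then have "new_color p M col b \<in> ?W'" "b \<in> ?W'"
      using b True unfolding split_queue_def by (metis Un_iff imageI)+
    from q'[OF this(1)] q'[OF this(2)] show ?thesis
      by (simp add: cell_split_old[OF vc True] hits_cell_split[of E p col b _ M])
  next
    case False
    have "b \<in> ?W'" using b by (simp add: split_queue_def)
    from q'[OF this] cell_unsplit[OF vc False] W b show ?thesis by auto
  qed
  then have all: "hits E (cell p col b) u = hits E (cell p col b) v" for b
    by (rule stable_up_toD[OF st[unfolded \<open>st = (col, W)\<close>] uv(1,2) col _ X])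
  have parts: "hits E (cell p col b - M) u = hits E (cell p col b - M) v \<and>
    hits E (cell p col b \<inter> M) u = hits E (cell p col b \<inter> M) v" if b: "b \<in> split_cells p M col" for b
  proof -
    have "smaller_part p M col W b \<in> ?W'" using b by (simp add: split_queue_def)
    from q'[OF this] have "hits E (cell p col b - M) u = hits E (cell p col b - M) v \<or>
        hits E (cell p col b \<inter> M) u = hits E (cell p col b \<inter> M) v"
      by (auto simp: smaller_part_def cell_split_old[OF vc b] split: if_splits)
    then show ?thesis
      using all[of b] hits_cell_split[of E p col b u M] hits_cell_split[of E p col b v M] by auto
  qed
  have "hits E (cell p ?col' c) u = hits E (cell p ?col' c) v"
  proof (cases "c \<in> colors p ?col'")
    case False
    then have "cell p ?col' c = {}" by (auto simp: colors_def in_cell_iff)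
    then show ?thesis by simp
  next
    case True
    then consider "c \<in> split_cells p M col" | "c \<in> colors p col" "c \<notin> split_cells p M col"
      | b where "b \<in> split_cells p M col" "c = new_color p M col b"
      unfolding colors_split_col[OF vc] by blast
    then show ?thesis
    proof cases
      case 1
      then show ?thesis using parts by (simp add: cell_split_old[OF vc])
    next
      case 2
      then show ?thesis using all by (simp add: cell_unsplit[OF vc])
    next
      case 3
      then show ?thesis using parts by (simp add: cell_split_old[OF vc])
    qed
  qed
  then show "hits E (cell p (fst (split p M st)) c) u = hits E (cell p (fst (split p M st)) c) v" by simp
qed

text \<open>
  Splitting by the layers for all \<open>j\<close> separates the vertices by the number of their
  in-neighbors in \<open>X\<close>. All refinement thus uses binary splits only.
\<close>

definition layer :: "nat \<Rightarrow> (nat \<times> nat) set \<Rightarrow> nat set \<Rightarrow> nat \<Rightarrow> nat set" where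
  "layer p E X j = {v. v < p \<and> j < hits E X v}"

primrec split_layers :: "nat \<Rightarrow> (nat \<Rightarrow> nat set) \<Rightarrow> nat \<Rightarrow> refinement \<Rightarrow> refinement" where
  "split_layers p L 0 st = st"
| "split_layers p L (Suc n) st = split p (L n) (split_layers p L n st)"

primrec count_splits :: "nat \<Rightarrow> (nat \<Rightarrow> nat set) \<Rightarrow> nat \<Rightarrow> refinement \<Rightarrow> nat" where
  "count_splits p L 0 st = 0"
| "count_splits p L (Suc n) st =
     count_splits p L n st + card (split_cells p (L n) (fst (split_layers p L n st)))"

lemma valid_split_layers: "valid p st \<Longrightarrow> valid p (split_layers p L n st)"
  by (induction n) (simp_all add: valid_split)

lemma stable_split_layers:
  "valid p st \<Longrightarrow> stable_up_to p E X st \<Longrightarrow> stable_up_to p E X (split_layers p L n st)"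
  by (induction n) (simp_all add: valid_split_layers stable_up_to_split)

lemma split_layers_separates:
  assumes "valid p st" "u < p" "v < p" "fst (split_layers p L n st) u = fst (split_layers p L n st) v"
  shows "fst st u = fst st v \<and> (\<forall>j<n. u \<in> L j \<longleftrightarrow> v \<in> L j)"
  using assms(4)
proof (induction n)
  case 0
  then show ?case by simp
next
  case (Suc n)
  have vc: "valid_coloring p (fst (split_layers p L n st))"
    using valid_split_layers[OF assms(1)] by (simp add: valid_def)
  from Suc.prems have "fst (split_layers p L n st) u = fst (split_layers p L n st) v \<and> (u \<in> L n \<longleftrightarrow> v \<in> L n)"
    using split_col_eq_iff[OF vc assms(2,3)] by simp
  with Suc.IH show ?case by (auto simp: less_Suc_eq)
qed

lemma split_empty_layer: "split p {} st = st"
  by (cases st) (simp add: split_def split_col_def[abs_def] split_queue_def split_cells_def)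

lemma split_layers_empty_tail:
  assumes "\<And>j. n \<le> j \<Longrightarrow> L j = {}" "n \<le> m"
  shows "split_layers p L m st = split_layers p L n st \<and> count_splits p L m st = count_splits p L n st"
  using assms(2)
proof (induction m rule: dec_induct)
  case base
  then show ?case by simp
next
  case (step m)
  then show ?case using assms(1)[of m] by (simp add: split_empty_layer) (simp add: split_cells_def)
qed

subsection \<open>The work list\<close>

text \<open>
  A set of colors is stored in a complete binary tree with heap numbering: the children of
  node \<open>i\<close> are \<open>2 * i\<close> and \<open>2 * i + 1\<close>, and color \<open>b\<close> is the leaf \<open>p + b\<close>. Inner nodes count
  the members below them. The numbering works for every \<open>p\<close>, not only for powers of two.
  Searching from the root yields a member of the set that depends on the set alone and not on
  the order of insertions, which is essential for canonicity.
\<close>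

function tree_count :: "nat \<Rightarrow> nat set \<Rightarrow> nat \<Rightarrow> nat" where
  "tree_count p W i = (if i = 0 then 0 else if p \<le> i then (if i - p \<in> W then 1 else 0)
     else tree_count p W (2 * i) + tree_count p W (2 * i + 1))"
  by pat_completeness auto
termination by (relation "measure (\<lambda>(p, W, i). p - i)") auto

function tree_search :: "nat \<Rightarrow> nat set \<Rightarrow> nat \<Rightarrow> nat" where
  "tree_search p W i = (if i = 0 \<or> p \<le> i then i - p
     else if 0 < tree_count p W (2 * i) then tree_search p W (2 * i) else tree_search p W (2 * i + 1))"
  by pat_completeness auto
termination by (relation "measure (\<lambda>(p, W, i). p - i)") auto

declare tree_count.simps [simp del] tree_search.simps [simp del]

lemma tree_count_leaf: "0 < p \<Longrightarrow> p \<le> i \<Longrightarrow> tree_count p W i = (if i - p \<in> W then 1 else 0)"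
  by (simp add: tree_count.simps)

lemma tree_count_node: "0 < i \<Longrightarrow> i < p \<Longrightarrow>
    tree_count p W i = tree_count p W (2 * i) + tree_count p W (2 * i + 1)"
  by (subst tree_count.simps) simp

lemma tree_count_empty [simp]: "tree_count p {} i = 0"
proof (induction p "{} :: nat set" i rule: tree_count.induct)
  case (1 p i)
  then show ?case by (cases "i = 0 \<or> p \<le> i") (auto simp: tree_count.simps[of p _ i])
qed

lemma tree_search_in: "0 < tree_count p W i \<Longrightarrow> tree_search p W i \<in> W"
proof (induction p W i rule: tree_search.induct)
  case (1 p W i)
  show ?case
  proof (cases "i = 0 \<or> p \<le> i")
    case True
    then show ?thesis using 1(3)
      by (auto simp: tree_search.simps[of p _ i] tree_count.simps[of p _ i] split: if_splits)
  next
    case False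
    then have "tree_count p W i = tree_count p W (2 * i) + tree_count p W (2 * i + 1)"
      by (intro tree_count_node) auto
    then show ?thesis using 1 False by (subst tree_search.simps) auto
  qed
qed

lemma tree_count_insert:
  assumes "b \<notin> W"
  shows "tree_count p (insert b W) i = tree_count p W i + tree_count p {b} i"
  using assms
proof (induction p W i rule: tree_count.induct)
  case (1 p W i)
  show ?case
  proof (cases "i = 0 \<or> p \<le> i")
    case True
    then show ?thesis using 1(3) by (auto simp: tree_count.simps[of p _ i])
  next
    case False
    then have "tree_count p V i = tree_count p V (2 * i) + tree_count p V (2 * i + 1)" for V
      by (intro tree_count_node) auto
    then show ?thesis using 1 False by simp
  qed
qed

lemma tree_count_remove: "b \<in> W \<Longrightarrow> tree_count p (W - {b}) i = tree_count p W i - tree_count p {b} i"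
  using tree_count_insert[of b "W - {b}" p i] by (simp add: insert_absorb)

text \<open>
  The ancestors of a leaf are its iterated halves. An update of the tree has to visit exactly
  these nodes.
\<close>

lemma tree_count_singleton:
  assumes "b < p" "0 < i"
  shows "tree_count p {b} i = (if \<exists>k. i = (p + b) div 2 ^ k then 1 else 0)"
  using assms
proof (induction p "{b}" i rule: tree_count.induct)
  case (1 p i)
  show ?case
  proof (cases "p \<le> i")
    case True
    have "(\<exists>k. i = (p + b) div 2 ^ k) \<longleftrightarrow> i = p + b"
    proof
      assume "\<exists>k. i = (p + b) div 2 ^ k"
      then obtain k where k: "i = (p + b) div 2 ^ k" by blast
      show "i = p + b"
      proof (cases k)
        case (Suc k')
        have "i \<le> (p + b) div 2"
          unfolding k Suc by (simp add: div_mult2_eq)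
        also have "\<dots> < p" using 1 by simp
        finally show ?thesis using True by simp
      qed (use k in simp)
    next
      assume "i = p + b" then show "\<exists>k. i = (p + b) div 2 ^ k" by (intro exI[of _ 0]) simp
    qed
    then show ?thesis using 1 True by (auto simp: tree_count_leaf)
  next
    case False
    let ?P = "\<lambda>i. \<exists>k. i = (p + b) div 2 ^ k"
    have IH: "tree_count p {b} (2 * i) = (if ?P (2 * i) then 1 else 0)"
      "tree_count p {b} (2 * i + 1) = (if ?P (2 * i + 1) then 1 else 0)"
      using 1 False by simp_all
    have up: "?P i" if "?P j" "j div 2 = i" for j
    proof -
      from that obtain k where "j = (p + b) div 2 ^ k" by blast
      then have "i = (p + b) div 2 ^ Suc k" using that unfolding power_Suc2 div_mult2_eq by simp
      then show ?thesis by blast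
    qed
    have down: "?P (2 * i) \<or> ?P (2 * i + 1)" if Pi: "?P i"
    proof -
      from Pi obtain k where k: "i = (p + b) div 2 ^ k" by blast
      have "k \<noteq> 0" using k False by (cases "k = 0") auto
      then obtain k' where k': "k = Suc k'" by (cases k) auto
      have "(p + b) div 2 ^ k' div 2 = i" unfolding k k' power_Suc2 div_mult2_eq ..
      then have "(p + b) div 2 ^ k' = 2 * i \<or> (p + b) div 2 ^ k' = 2 * i + 1" by linarith
      then show ?thesis by metis
    qed
    have excl: "\<not> (?P (2 * i) \<and> ?P (2 * i + 1))"
    proof
      assume "?P (2 * i) \<and> ?P (2 * i + 1)"
      then obtain k l where kl: "2 * i = (p + b) div 2 ^ k" "2 * i + 1 = (p + b) div 2 ^ l" by blast
      have mono: "(p + b) div 2 ^ (m + Suc d) \<le> (p + b) div 2 ^ m div 2" for m d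
      proof -
        have "2 ^ (m + Suc d) = (2 ^ m * 2 * 2 ^ d :: nat)" by (simp add: power_add)
        then have "(p + b) div 2 ^ (m + Suc d) = (p + b) div 2 ^ m div 2 div 2 ^ d"
          by (simp only: div_mult2_eq)
        then show ?thesis by simp
      qed
      consider "k = l" | d where "l = k + Suc d" | d where "k = l + Suc d"
        by (metis less_iff_Suc_add add_Suc_right linorder_neqE_nat)
      then show False
      proof cases
        case 1
        then show ?thesis using kl by simp
      next
        case 2
        then show ?thesis using mono[of k d] kl by simp
      next
        case 3
        then show ?thesis using mono[of l d] kl \<open>0 < i\<close> by simp
      qed
    qed
    have "?P i \<longleftrightarrow> ?P (2 * i) \<or> ?P (2 * i + 1)" using up[of "2 * i"] up[of "2 * i + 1"] down by auto
    then show ?thesis using excl False \<open>0 < i\<close> IH by (auto simp: tree_count_node)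
  qed
qed

lemma tree_count_root_pos:
  assumes "W \<subseteq> {..<p}" "W \<noteq> {}"
  shows "0 < tree_count p W 1"
proof -
  have up: "0 < tree_count p W i \<Longrightarrow> 0 < i \<Longrightarrow> i < 2 * p \<Longrightarrow> 0 < tree_count p W 1" for i
  proof (induction i rule: less_induct)
    case (less i)
    show ?case
    proof (cases "i = 1")
      case False
      then have i: "0 < i div 2" "i div 2 < p" "i div 2 < i" using less.prems by auto
      have "i = 2 * (i div 2) \<or> i = 2 * (i div 2) + 1" by linarith
      then have "0 < tree_count p W (i div 2)"
        using tree_count_node[OF i(1,2), of W] less.prems by (metis add_gr_0)
      then show ?thesis using i by (intro less.IH[of "i div 2"]) auto
    qed (use less.prems in simp)
  qed
  obtain b where "b \<in> W" using assms by blast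
  have "b < p" using assms \<open>b \<in> W\<close> by auto
  then have "0 < tree_count p W (p + b)" using \<open>b \<in> W\<close> by (simp add: tree_count_leaf)
  then show ?thesis using \<open>b < p\<close> by (intro up[of "p + b"]) auto
qed

definition select :: "nat \<Rightarrow> nat set \<Rightarrow> nat" where
  "select p W = tree_search p W 1"

lemma select_in: "W \<subseteq> {..<p} \<Longrightarrow> W \<noteq> {} \<Longrightarrow> select p W \<in> W"
  unfolding select_def by (intro tree_search_in tree_count_root_pos)

lemma tree_count_le_card:
  assumes "finite W" "W \<subseteq> {..<p}"
  shows "tree_count p W i \<le> card W"
  using assms
proof (induction W rule: finite_induct)
  case (insert b W)
  have "tree_count p {b} i \<le> 1"
    using tree_count_singleton[of b p i] insert.prems by (cases "i = 0") (auto simp: tree_count.simps[of p _ 0])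
  moreover have "tree_count p W i \<le> card W" using insert by simp
  ultimately show ?case
    using tree_count_insert[OF insert.hyps(2), of p i] insert.hyps by simp
qed simp

subsection \<open>Refinement to the coarsest stable coloring\<close>

definition refine_step :: "nat \<Rightarrow> (nat \<times> nat) set \<Rightarrow> refinement \<Rightarrow> refinement" where
  "refine_step p E st = (if snd st = {} then st else
     let x = select p (snd st); X = cell p (fst st) x
     in split_layers p (layer p E X) p (fst st, snd st - {x}))"

text \<open>
  \<open>2 * p\<close> steps suffice by the budget below, and a step without waiting colors changes
  nothing. A fixed number of iterations avoids a recursion with a termination proof.
\<close>

definition refine :: "nat \<Rightarrow> (nat \<times> nat) set \<Rightarrow> refinement \<Rightarrow> refinement" where
  "refine p E st = (refine_step p E ^^ (2 * p)) st"

text \<open>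
  Splitting off a vertex is an ordinary split, which makes the smaller part, the vertex
  itself, wait for processing.
\<close>

definition individualize :: "nat \<Rightarrow> (nat \<times> nat) set \<Rightarrow> nat \<Rightarrow> refinement \<Rightarrow> refinement" where
  "individualize p E v st = refine p E (split p {v} st)"

lemma refine_step_done: "snd st = {} \<Longrightarrow> refine_step p E st = st"
  by (simp add: refine_step_def)

lemma valid_queue: "valid p st \<Longrightarrow> snd st \<subseteq> {..<p}"
  using color_less by (fastforce simp: valid_def colors_def)

lemma hits_le: "X \<subseteq> {..<p} \<Longrightarrow> hits E X v \<le> p"
  unfolding hits_def using card_mono[of "{..<p}" "{u \<in> X. (u, v) \<in> E}"] by auto

text \<open>
  The processed cell \<open>X\<close> leaves the waiting set and becomes the additional cell of the
  invariant. After splitting by all its layers, vertices of the same color agree on \<open>X\<close>, and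
  it can be dropped.
\<close>

lemma refine_step_invariants:
  assumes "valid p st" "stable_up_to p E {} st"
  shows "valid p (refine_step p E st) \<and> stable_up_to p E {} (refine_step p E st)"
proof (cases "snd st = {}")
  case True
  then show ?thesis using assms by (simp add: refine_step_def)
next
  case False
  obtain col W where st: "st = (col, W)" by (cases st)
  define x where "x = select p W"
  define X where "X = cell p col x"
  have eq: "refine_step p E st = split_layers p (layer p E X) p (col, W - {x})"
    using False by (simp add: refine_step_def st x_def X_def Let_def)
  have xW: "x \<in> W" using False valid_queue[OF assms(1)] unfolding x_def st by (intro select_in) auto
  have v: "valid p (col, W - {x})" using assms(1) unfolding st by (rule valid_remove)
  have "stable_up_to p E X (col, W - {x})"
    unfolding stable_up_to_def
  proof (intro allI impI)
    fix u v b assume uv: "u < p" "v < p" "fst (col, W - {x}) u = fst (col, W - {x}) v"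
      and q: "\<forall>b\<in>snd (col, W - {x}). hits E (cell p (fst (col, W - {x})) b) u = hits E (cell p (fst (col, W - {x})) b) v"
      and X: "hits E X u = hits E X v"
    have "hits E (cell p col b) u = hits E (cell p col b) v"
    proof (rule stable_up_toD[OF assms(2)[unfolded st] uv(1,2)])
      fix b assume "b \<in> W"
      then show "hits E (cell p col b) u = hits E (cell p col b) v"
        using q X by (cases "b = x") (auto simp: X_def)
    qed (use uv in auto)
    then show "hits E (cell p (fst (col, W - {x})) b) u = hits E (cell p (fst (col, W - {x})) b) v" by simp
  qed
  then have s: "stable_up_to p E X (split_layers p (layer p E X) p (col, W - {x}))"
    by (rule stable_split_layers[OF v])
  let ?r = "split_layers p (layer p E X) p (col, W - {x})"
  have sep: "hits E X u = hits E X v" if uv: "u < p" "v < p" "fst ?r u = fst ?r v" for u v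
  proof -
    have *: "(j < hits E X u) \<longleftrightarrow> (j < hits E X v)" if "j < p" for j
      using split_layers_separates[OF v uv] that uv by (simp add: layer_def)
    have "hits E X w \<le> p" for w by (rule hits_le) (auto simp: X_def in_cell_iff)
    then show ?thesis
      using *[of "hits E X u"] *[of "hits E X v"] by (metis le_neq_implies_less nat_neq_iff less_irrefl less_le_trans)
  qed
  have "stable_up_to p E {} ?r"
    using s sep unfolding stable_up_to_def by blast
  then show ?thesis unfolding eq using valid_split_layers[OF v] by blast
qed

text \<open>
  The first term pays for future waiting of a vertex: whenever its color starts to wait anew,
  the size of its cell has been at least halved. The second term pays for the scan of its
  cell.
\<close>

definition potential :: "nat \<Rightarrow> refinement \<Rightarrow> real" where
  "potential p st = (\<Sum>v<p. log 2 (real (card (cell p (fst st) (fst st v)))) + (if fst st v \<in> snd st then 1 else 0))"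

text \<open>
  The number of waiting colors plus two for every color that may still arise. A split creates
  one color and lets at most one color wait, hence frees one unit to pay for its own cost;
  removing a waiting color frees one unit as well.
\<close>

definition split_budget :: "nat \<Rightarrow> refinement \<Rightarrow> nat" where
  "split_budget p st = card (snd st) + 2 * (p - card (colors p (fst st)))"

lemma card_colors_le: "card (colors p col) \<le> p"
  unfolding colors_def using card_image_le[of "{..<p}" col] by simp

lemma finite_queue: "valid p st \<Longrightarrow> finite (snd st)"
  using valid_queue finite_subset by blast

lemma split_budget_split:
  assumes v: "valid p st"
  shows "split_budget p (split p M st) + card (split_cells p M (fst st)) \<le> split_budget p st"
proof -
  have vc: "valid_coloring p (fst st)" using v by (simp add: valid_def)
  have "card (split_queue p M (fst st) (snd st)) \<le> card (snd st) + card (split_cells p M (fst st))"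
    unfolding split_queue_def
    using card_Un_le card_image_le[OF finite_split_cells[OF vc]] by (metis (no_types, lifting) add_left_mono le_trans)
  moreover have "card (colors p (fst st)) + card (split_cells p M (fst st)) \<le> p"
    using card_colors_le[of p "split_col p M (fst st)"] card_colors_split[OF vc] by simp
  ultimately show ?thesis
    by (simp add: split_budget_def card_colors_split[OF vc])
qed

lemma potential_split:
  assumes v: "valid p st"
  shows "potential p (split p M st) \<le> potential p st"
  unfolding potential_def
proof (rule sum_mono)
  obtain col W where [simp]: "st = (col, W)" by (cases st)
  have vc: "valid_coloring p col" and W: "W \<subseteq> colors p col" using v by (auto simp: valid_def)
  fix v assume "v \<in> {..<p}"
  then have v: "v < p" by simp
  let ?C = "cell p col (col v)" and ?col' = "split_col p M col"
  have pos: "card ?C > 0" using card_cell_pos[OF vc v] .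
  have pos': "card (cell p ?col' (?col' v)) > 0" using card_cell_pos[OF valid_split_col[OF vc] v] .
  have "log 2 (real (card (cell p ?col' (?col' v)))) + (if ?col' v \<in> split_queue p M col W then 1 else 0)
    \<le> log 2 (real (card ?C)) + (if col v \<in> W then 1 else 0)"
  \<comment> \<open>Only the second case changes the cell of the vertex; there, either the color was waiting
    before, or the vertex ends up in a waiting part, which is at most half of the cell, or
    in a part that does not wait.\<close>
  proof (cases "col v \<in> split_cells p M col")
    case False
    have cv: "col v \<in> colors p col" using v by (auto simp: colors_def)
    have eq: "?col' v = col v"
      using False cell_Int_nonempty[OF v, of M col]
      by (cases "v \<in> M") (auto simp: split_col_def new_color_def split_cells_def)
    have "smaller_part p M col W b \<noteq> col v" if "b \<in> split_cells p M col" for b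
      using new_color_fresh[OF vc that] that False cv by (auto simp: smaller_part_def)
    then have "col v \<notin> smaller_part p M col W ` split_cells p M col" by (metis imageE)
    then have "col v \<in> split_queue p M col W \<longleftrightarrow> col v \<in> W"
      by (simp add: split_queue_def)
    then show ?thesis using cell_unsplit[OF vc False cv] eq by simp
  next
    case True
    note True0 = True
    let ?b = "col v"
    have C: "card ?C = card (?C - M) + card (?C \<inter> M)" by (rule card_cell_split)
    have own: "?col' v \<in> split_queue p M col W \<longleftrightarrow> ?b \<in> W \<or> smaller_part p M col W ?b = ?col' v"
    proof
      assume "?col' v \<in> split_queue p M col W"
      then consider "?col' v \<in> W" | b where "b \<in> split_cells p M col" "?col' v = smaller_part p M col W b"
        unfolding split_queue_def by blast
      then show "?b \<in> W \<or> smaller_part p M col W ?b = ?col' v"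
      proof cases
        case 1
        then show ?thesis using new_color_fresh[OF vc True] W by (auto simp: split_col_def split: if_splits)
      next
        case 2
        have "b = ?b"
          using 2 new_color_fresh[OF vc True] new_color_fresh[OF vc 2(1)] inj_on_new_color[OF vc, where M = M]
            split_cells_subset[OF vc, where M = M] True
          unfolding inj_on_def split_col_def smaller_part_def
          by (auto split: if_splits)
        then show ?thesis using 2 by simp
      qed
    next
      assume "?b \<in> W \<or> smaller_part p M col W ?b = ?col' v"
      moreover have "smaller_part p M col W ?b \<in> split_queue p M col W"
        using True by (simp add: split_queue_def)
      moreover have "smaller_part p M col W ?b = new_color p M col ?b" if "?b \<in> W"
        using that by (simp add: smaller_part_def)
      ultimately show "?col' v \<in> split_queue p M col W"
        by (auto simp: split_col_def) (auto simp: split_queue_def)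
    qed
    have le: "card (cell p ?col' (?col' v)) \<le> card ?C"
      by (simp add: cell_split_col[OF vc v] C)
    show ?thesis
    proof (cases "?b \<in> W \<or> ?col' v \<notin> split_queue p M col W")
      case True
      have "log 2 (real (card (cell p ?col' (?col' v)))) \<le> log 2 (real (card ?C))"
        using le pos' by simp
      then show ?thesis using True by auto
    next
      case False
      then have sm: "smaller_part p M col W ?b = ?col' v" "?b \<notin> W" using own by auto
      have nb: "new_color p M col ?b \<noteq> ?b" using new_color_bounds(1)[OF vc True0] by simp
      have "2 * card (cell p ?col' (?col' v)) \<le> card ?C"
        unfolding cell_split_col[OF vc v] using sm nb C
        by (auto simp: smaller_part_def split_col_def split: if_splits)
      then have "log 2 (real (2 * card (cell p ?col' (?col' v)))) \<le> log 2 (real (card ?C))"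
        using pos' by (subst log_le_cancel_iff) auto
      moreover have "log 2 (real (2 * k)) = log 2 (real k) + 1" if "k > 0" for k
        using that by (simp add: log_mult)
      ultimately have "log 2 (real (card (cell p ?col' (?col' v)))) + 1 \<le> log 2 (real (card ?C))"
        using pos' by metis
      then show ?thesis by simp
    qed
  qed
  then show "log 2 (real (card (cell p (fst (split p M st)) (fst (split p M st) v)))) +
      (if fst (split p M st) v \<in> snd (split p M st) then 1 else 0)
    \<le> log 2 (real (card (cell p (fst st) (fst st v)))) + (if fst st v \<in> snd st then 1 else 0)"
    by simp
qed

lemma split_layers_budgets:
  assumes "valid p st"
  shows "potential p (split_layers p L n st) \<le> potential p st"
    and "split_budget p (split_layers p L n st) + count_splits p L n st \<le> split_budget p st"
proof -
  show "potential p (split_layers p L n st) \<le> potential p st"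
    using potential_split[OF valid_split_layers[OF assms]] by (induction n) (auto intro: order_trans)
  show "split_budget p (split_layers p L n st) + count_splits p L n st \<le> split_budget p st"
  proof (induction n)
    case (Suc n)
    then show ?case
      using split_budget_split[OF valid_split_layers[OF assms, of L n], of "L n"] by simp
  qed simp
qed

lemma refine_step_budgets:
  assumes v: "valid p st" and ne: "snd st \<noteq> {}"
  defines "x \<equiv> select p (snd st)"
  defines "X \<equiv> cell p (fst st) x"
  shows "potential p (refine_step p E st) + card X \<le> potential p st"
    and "split_budget p (refine_step p E st) + Suc (count_splits p (layer p E X) p (fst st, snd st - {x}))
      \<le> split_budget p st"
proof -
  obtain col W where st [simp]: "st = (col, W)" by (cases st)
  have eq: "refine_step p E st = split_layers p (layer p E X) p (col, W - {x})"
    using ne by (simp add: refine_step_def x_def X_def Let_def)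
  have xW: "x \<in> W" using ne valid_queue[OF v] select_in[of W p] unfolding x_def by simp
  have v': "valid p (col, W - {x})" using v unfolding st by (rule valid_remove)
  have "potential p (col, W - {x}) + card X = potential p st"
  proof -
    have "real (card X) = (\<Sum>v<p. if col v = x then 1 else 0)"
      by (simp add: X_def cell_def sum.If_cases Int_def)
    then have "potential p (col, W - {x}) + card X =
      (\<Sum>v<p. log 2 (real (card (cell p col (col v)))) + (if col v \<in> W - {x} then 1 else 0) +
        (if col v = x then 1 else 0))"
      by (simp add: potential_def sum.distrib)
    also have "\<dots> = potential p st"
      unfolding potential_def using xW by (intro sum.cong) auto
    finally show ?thesis .
  qed
  then show "potential p (refine_step p E st) + card X \<le> potential p st"
    using split_layers_budgets(1)[OF v', of "layer p E X" p] eq by simp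
  have "Suc (split_budget p (col, W - {x})) = split_budget p st"
    using card_Suc_Diff1[OF finite_queue[OF v], of x] xW by (simp add: split_budget_def)
  then show "split_budget p (refine_step p E st) + Suc (count_splits p (layer p E X) p (fst st, snd st - {x}))
      \<le> split_budget p st"
    using split_layers_budgets(2)[OF v', of "layer p E X" p] eq by simp
qed

lemma refine_steps_invariants:
  assumes "valid p st" "stable_up_to p E {} st"
  shows "valid p ((refine_step p E ^^ n) st) \<and> stable_up_to p E {} ((refine_step p E ^^ n) st)"
  by (induction n) (simp_all add: assms refine_step_invariants)

lemma split_budget_le: "valid p st \<Longrightarrow> snd st = {} \<Longrightarrow> split_budget p st \<le> 2 * p"
  by (simp add: split_budget_def)

lemma refine_steps_done:
  assumes "valid p st" "stable_up_to p E {} st"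
  shows "snd ((refine_step p E ^^ n) st) = {} \<or> split_budget p ((refine_step p E ^^ n) st) + n \<le> split_budget p st"
proof (induction n)
  case (Suc n)
  let ?s = "(refine_step p E ^^ n) st"
  have v: "valid p ?s" using refine_steps_invariants[OF assms] by blast
  show ?case
  proof (cases "snd ?s = {}")
    case True
    then show ?thesis by (simp add: refine_step_done)
  next
    case False
    then show ?thesis using Suc refine_step_budgets(2)[OF v False, of E] by simp
  qed
qed simp

lemma refine_correct:
  assumes "valid p st" "stable_up_to p E {} st" "split_budget p st \<le> 2 * p"
  shows "valid p (refine p E st)" "stable_up_to p E {} (refine p E st)" "snd (refine p E st) = {}"
proof -
  show v: "valid p (refine p E st)" and "stable_up_to p E {} (refine p E st)"
    unfolding refine_def using refine_steps_invariants[OF assms(1,2)] by blast+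
  show "snd (refine p E st) = {}"
  proof (rule ccontr)
    assume "snd (refine p E st) \<noteq> {}"
    then have "card (snd (refine p E st)) > 0" using finite_queue[OF v] by (simp add: card_gt_0_iff)
    moreover have "split_budget p (refine p E st) = 0"
      using refine_steps_done[OF assms(1,2), of "2 * p"] assms(3) \<open>snd (refine p E st) \<noteq> {}\<close>
      unfolding refine_def by linarith
    ultimately show False by (simp add: split_budget_def)
  qed
qed

lemma refine_refines:
  assumes "valid p st" "stable_up_to p E {} st" "u < p" "v < p" "fst (refine p E st) u = fst (refine p E st) v"
  shows "fst st u = fst st v"
proof -
  have "fst ((refine_step p E ^^ n) st) u = fst ((refine_step p E ^^ n) st) v \<Longrightarrow> fst st u = fst st v" for n
  proof (induction n)
    case (Suc n)
    let ?s = "(refine_step p E ^^ n) st"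
    have vs: "valid p ?s" using refine_steps_invariants[OF assms(1,2)] by blast
    have "fst ?s u = fst ?s v"
    proof (cases "snd ?s = {}")
      case True
      then show ?thesis using Suc.prems by (simp add: refine_step_done)
    next
      case False
      have v': "valid p (fst ?s, snd ?s - {select p (snd ?s)})"
        using vs valid_remove[of p "fst ?s" "snd ?s"] by simp
      define X where "X = cell p (fst ?s) (select p (snd ?s))"
      have "(refine_step p E ^^ Suc n) st =
          split_layers p (layer p E X) p (fst ?s, snd ?s - {select p (snd ?s)})"
        using False by (simp only: funpow.simps o_apply refine_step_def[of p E ?s] X_def Let_def if_False)
      then show ?thesis
        using split_layers_separates[OF v' assms(3,4), of "layer p E X" p] Suc.prems by simp
    qed
    then show ?case by (rule Suc.IH)
  qed simp
  then show ?thesis using assms(5) unfolding refine_def by blast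
qed

lemma individualize_correct:
  fixes a :: nat
  assumes v: "valid p st" and s: "stable_up_to p E {} st" and W: "snd st = {}"
  defines "r \<equiv> individualize p E a st"
  shows "valid p r" "stable_up_to p E {} r" "snd r = {}"
    and "\<And>u v. u < p \<Longrightarrow> v < p \<Longrightarrow> fst r u = fst r v \<Longrightarrow> fst st u = fst st v \<and> (u = a \<longleftrightarrow> v = a)"
proof -
  have v': "valid p (split p {a} st)" and s': "stable_up_to p E {} (split p {a} st)"
    using valid_split[OF v] stable_up_to_split[OF v s] by auto
  have "split_budget p (split p {a} st) \<le> 2 * p"
    using split_budget_split[OF v, of "{a}"] split_budget_le[OF v W] by simp
  note * = refine_correct[OF v' s' this]
  show "valid p r" "stable_up_to p E {} r" "snd r = {}"
    using * by (simp_all add: r_def individualize_def)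
  fix u w assume uw: "u < p" "w < p" "fst r u = fst r w"
  then have "fst (split p {a} st) u = fst (split p {a} st) w"
    unfolding r_def individualize_def by (intro refine_refines[OF v' s']) auto
  moreover have "valid_coloring p (fst st)" using v by (simp add: valid_def)
  ultimately show "fst st u = fst st w \<and> (u = a \<longleftrightarrow> w = a)"
    using split_col_eq_iff[of p "fst st" u w "{a}"] uw by simp
qed

lemma split_col_ge: "col v \<le> split_col p M col v"
  by (simp add: split_col_def new_color_def)

lemma split_layers_ge: "fst st v \<le> fst (split_layers p L n st) v"
  by (induction n) (auto intro: order_trans[OF _ split_col_ge])

text \<open>
  Colors only grow. In particular a vertex that has lost color 0 never regains it.
\<close>

lemma refine_ge: "fst st v \<le> fst (refine p E st) v"
proof -
  have "fst st v \<le> fst (refine_step p E st) v" for st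
    using split_layers_ge[of "(fst st, snd st - {x})" v for x] by (simp add: refine_step_def Let_def)
  note step = this
  have "fst st v \<le> fst ((refine_step p E ^^ n) st) v" for n
  proof (induction n)
    case (Suc n)
    then show ?case using order_trans[OF Suc step] by simp
  qed simp
  then show ?thesis unfolding refine_def .
qed

lemma individualize_ge: "fst (split p {a} st) v \<le> fst (individualize p E a st) v"
  unfolding individualize_def by (rule refine_ge)

lemma valid_ex_color_0: "valid p st \<Longrightarrow> \<exists>v<p. fst st v = 0"
  by (force simp: valid_def colors_def)

text \<open>
  The coloring with one class is equitable for a regular graph, so nothing has to wait.
\<close>

definition unit_refinement :: refinement where
  "unit_refinement = (\<lambda>_. 0, {})"

lemma unit_refinement:
  assumes "0 < p" "\<And>v. v < p \<Longrightarrow> hits E {..<p} v = d"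
  shows "valid p unit_refinement" "stable_up_to p E {} unit_refinement" "snd unit_refinement = {}"
proof -
  have c: "cell p (\<lambda>_. 0) b = (if b = 0 then {..<p} else {})" for b
    by (auto simp: cell_def)
  show "valid p unit_refinement"
    using assms(1) by (auto simp: valid_def valid_coloring_def unit_refinement_def c colors_def)
  show "stable_up_to p E {} unit_refinement"
    using assms(2) by (simp add: stable_up_to_def unit_refinement_def c)
  show "snd unit_refinement = {}" by (simp add: unit_refinement_def)
qed

subsection \<open>Invariance under isomorphisms\<close>

text \<open>
  Runs of the refinement on isomorphic graphs proceed in lockstep: the sets of waiting colors
  are literally equal, so the same color is selected, and the colorings correspond under the
  isomorphism.
\<close>

locale refinement_iso =
  fixes p :: nat and E E' :: "(nat \<times> nat) set" and \<phi> :: "nat \<Rightarrow> nat"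
  assumes bij: "bij_betw \<phi> {..<p} {..<p}"
    and arcs: "u < p \<Longrightarrow> v < p \<Longrightarrow> (\<phi> u, \<phi> v) \<in> E' \<longleftrightarrow> (u, v) \<in> E"
begin

definition related :: "refinement \<Rightarrow> refinement \<Rightarrow> bool" where
  "related st st' \<longleftrightarrow> snd st' = snd st \<and> (\<forall>v<p. fst st' (\<phi> v) = fst st v)"

lemma \<phi>_less: "v < p \<Longrightarrow> \<phi> v < p"
  using bij by (auto simp: bij_betw_def)

lemma \<phi>_inj: "u < p \<Longrightarrow> v < p \<Longrightarrow> \<phi> u = \<phi> v \<longleftrightarrow> u = v"
  using bij by (auto simp: bij_betw_def inj_on_def)

lemma \<phi>_surj: "w < p \<Longrightarrow> \<exists>v<p. w = \<phi> v"
  using bij by (auto simp: bij_betw_def image_iff set_eq_iff)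

lemma card_image_\<phi>: "A \<subseteq> {..<p} \<Longrightarrow> card (\<phi> ` A) = card A"
  using bij by (intro card_image) (auto simp: bij_betw_def intro: inj_on_subset)

lemma in_image_\<phi>: "A \<subseteq> {..<p} \<Longrightarrow> v < p \<Longrightarrow> \<phi> v \<in> \<phi> ` A \<longleftrightarrow> v \<in> A"
  using \<phi>_inj by (auto simp: subset_iff)

lemma cell_related: "related st st' \<Longrightarrow> cell p (fst st') b = \<phi> ` cell p (fst st) b"
  using \<phi>_surj \<phi>_less by (force simp: related_def cell_def image_iff)

lemma cell_subset: "cell p col b \<subseteq> {..<p}"
  by (auto simp: cell_def)

lemma related_split:
  assumes r: "related st st'" and M: "M \<subseteq> {..<p}"
  shows "related (split p M st) (split p (\<phi> ` M) st')"
proof -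
  let ?c = "fst st" and ?c' = "fst st'"
  have I: "cell p ?c' b \<inter> \<phi> ` M = \<phi> ` (cell p ?c b \<inter> M)" for b
    unfolding cell_related[OF r] using bij M cell_subset
    by (intro inj_on_image_Int[symmetric, of _ "{..<p}"]) (auto simp: bij_betw_def)
  have D: "cell p ?c' b - \<phi> ` M = \<phi> ` (cell p ?c b - M)" for b
    unfolding cell_related[OF r] using bij M cell_subset[of ?c b]
    by (intro inj_on_image_set_diff[symmetric, of _ "{..<p}"]) (auto simp: bij_betw_def)
  have cI: "card (cell p ?c' b \<inter> \<phi> ` M) = card (cell p ?c b \<inter> M)" for b
    unfolding I using cell_subset by (intro card_image_\<phi>) auto
  have cD: "card (cell p ?c' b - \<phi> ` M) = card (cell p ?c b - M)" for b
    unfolding D using cell_subset by (intro card_image_\<phi>) auto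
  have nc: "new_color p (\<phi> ` M) ?c' = new_color p M ?c"
    by (rule ext) (simp add: new_color_def cD)
  have sc: "split_cells p (\<phi> ` M) ?c' = split_cells p M ?c"
    unfolding split_cells_def I D by simp
  have W: "snd st' = snd st" and col: "\<And>v. v < p \<Longrightarrow> ?c' (\<phi> v) = ?c v"
    using r by (auto simp: related_def)
  have sp: "smaller_part p (\<phi> ` M) ?c' (snd st) = smaller_part p M ?c (snd st)"
    by (rule ext) (simp add: smaller_part_def cI cD nc)
  show ?thesis
    using M by (auto simp: related_def W split_queue_def sc sp split_col_def col nc in_image_\<phi>)
qed

lemma hits_related:
  assumes "X \<subseteq> {..<p}" "v < p"
  shows "hits E' (\<phi> ` X) (\<phi> v) = hits E X v"
proof -
  have "{u \<in> \<phi> ` X. (u, \<phi> v) \<in> E'} = \<phi> ` {u \<in> X. (u, v) \<in> E}"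
    using assms arcs by auto
  then show ?thesis unfolding hits_def using assms by (simp add: card_image_\<phi> subset_iff)
qed

lemma layer_related: "X \<subseteq> {..<p} \<Longrightarrow> layer p E' (\<phi> ` X) j = \<phi> ` layer p E X j"
  using \<phi>_surj \<phi>_less by (force simp: layer_def hits_related image_iff)

lemma related_split_layers:
  assumes "related st st'" "X \<subseteq> {..<p}"
  shows "related (split_layers p (layer p E X) n st) (split_layers p (layer p E' (\<phi> ` X)) n st')"
  by (induction n) (auto simp: assms layer_related intro!: related_split, auto simp: layer_def)

lemma related_refine_step: "related st st' \<Longrightarrow> related (refine_step p E st) (refine_step p E' st')"
proof -
  assume r: "related st st'"
  then have W: "snd st' = snd st" by (simp add: related_def)
  have "related (fst st, snd st - {x}) (fst st', snd st - {x})" for x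
    using r by (simp add: related_def)
  then show ?thesis
    using r cell_subset by (auto simp: refine_step_def W Let_def cell_related[OF r] intro!: related_split_layers)
qed

lemma related_refine: "related st st' \<Longrightarrow> related (refine p E st) (refine p E' st')"
proof -
  assume r: "related st st'"
  have "related ((refine_step p E ^^ n) st) ((refine_step p E' ^^ n) st')" for n
    by (induction n) (simp_all add: r related_refine_step)
  then show ?thesis unfolding refine_def .
qed

lemma related_individualize:
  assumes "related st st'" "a < p"
  shows "related (individualize p E a st) (individualize p E' (\<phi> a) st')"
  unfolding individualize_def using related_split[OF assms(1), of "{a}"] assms(2)
  by (intro related_refine) simp

lemma related_unit: "related unit_refinement unit_refinement"
  by (simp add: related_def unit_refinement_def)

end

section \<open>Running times of programs\<close>

text \<open>
  A total correctness statement with a time bound. Its rules below play the role of a Hoare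
  logic.
\<close>

definition runs :: "nat \<Rightarrow> prog \<Rightarrow> state \<Rightarrow> nat \<Rightarrow> (state \<Rightarrow> bool) \<Rightarrow> bool" where
  "runs W c s T Q \<longleftrightarrow> (\<exists>t s'. exec W c s t s' \<and> t \<le> T \<and> Q s')"

lemma runsI: "exec W c s t s' \<Longrightarrow> t \<le> T \<Longrightarrow> Q s' \<Longrightarrow> runs W c s T Q"
  unfolding runs_def by blast

lemma runsE:
  assumes "runs W c s T Q"
  obtains t s' where "exec W c s t s'" "t \<le> T" "Q s'"
  using assms unfolding runs_def by blast

abbreviation seq :: "prog \<Rightarrow> prog \<Rightarrow> prog" (infixr ";;" 60) where
  "c1 ;; c2 \<equiv> Seq c1 c2"

lemma runs_weaken: "runs W c s T Q \<Longrightarrow> T \<le> T' \<Longrightarrow> (\<And>s'. Q s' \<Longrightarrow> Q' s') \<Longrightarrow> runs W c s T' Q'"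
  unfolding runs_def by (meson order_trans)

lemma runs_Seq:
  "runs W c1 s T1 R \<Longrightarrow> (\<And>s'. R s' \<Longrightarrow> runs W c2 s' T2 Q) \<Longrightarrow> runs W (c1 ;; c2) s (T1 + T2) Q"
  unfolding runs_def by (meson exec.Seq add_mono)

text \<open>
  For loops whose number of iterations is known. The time of an iteration may depend on its
  index, which allows amortized bounds.
\<close>

lemma runs_While_count:
  assumes "I 0 s"
    and body: "\<And>s i. I i s \<Longrightarrow> i < n \<Longrightarrow> cond_fits W s b \<and> cond_val s b \<and> runs W c s (T i) (I (Suc i))"
    and stop: "\<And>s. I n s \<Longrightarrow> cond_fits W s b \<and> \<not> cond_val s b"
  shows "runs W (While b c) s ((\<Sum>i<n. T i) + (n + 1) * (cond_cost b + 1)) (I n)"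
proof -
  have "I i s \<Longrightarrow> i \<le> n \<Longrightarrow>
      runs W (While b c) s ((\<Sum>j\<in>{i..<n}. T j) + (n - i + 1) * (cond_cost b + 1)) (I n)" for i s
  proof (induction "n - i" arbitrary: i s)
    case 0
    then have "i = n" by simp
    with stop[of s] 0 show ?case by (intro runsI[OF exec.WhileFalse]) auto
  next
    case (Suc k)
    then have i: "i < n" by simp
    from body[OF Suc.prems(1) i] obtain t1 s1 where
      1: "cond_fits W s b" "cond_val s b" "exec W c s t1 s1" "t1 \<le> T i" "I (Suc i) s1"
      unfolding runs_def by blast
    have "k = n - Suc i" using Suc.hyps(2) by simp
    from Suc.hyps(1)[OF this 1(5)] i obtain t2 s2 where
      2: "exec W (While b c) s1 t2 s2" "I n s2"
        "t2 \<le> (\<Sum>j\<in>{Suc i..<n}. T j) + (n - Suc i + 1) * (cond_cost b + 1)"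
      unfolding runs_def by auto
    have "exec W (While b c) s (cond_cost b + 1 + t1 + t2) s2"
      by (rule exec.WhileTrue) fact+
    moreover have "cond_cost b + 1 + t1 + t2 \<le> (\<Sum>j\<in>{i..<n}. T j) + (n - i + 1) * (cond_cost b + 1)"
    proof -
      have "n - i + 1 = Suc (n - Suc i + 1)" using i by simp
      then show ?thesis using 1(4) 2(3) i by (simp add: sum.atLeast_Suc_lessThan)
    qed
    ultimately show ?case using 2(2) unfolding runs_def by blast
  qed
  from this[of 0 s] assms(1) show ?thesis by (simp add: atLeast0LessThan)
qed

text \<open>
  For loops of which only an upper bound on the number of iterations is known.
\<close>

lemma runs_While_bounded:
  assumes "I 0 s"
    and fits: "\<And>s i. I i s \<Longrightarrow> cond_fits W s b"
    and body: "\<And>s i. I i s \<Longrightarrow> cond_val s b \<Longrightarrow> i < n \<and> runs W c s T (I (Suc i))"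
  shows "runs W (While b c) s (n * T + (n + 1) * (cond_cost b + 1)) (\<lambda>s'. \<exists>i. I i s' \<and> \<not> cond_val s' b)"
proof -
  have "I i s \<Longrightarrow> i \<le> n \<Longrightarrow>
      runs W (While b c) s ((n - i) * T + (n - i + 1) * (cond_cost b + 1)) (\<lambda>s'. \<exists>i. I i s' \<and> \<not> cond_val s' b)" for i s
  proof (induction "n - i" arbitrary: i s rule: less_induct)
    case less
    show ?case
    proof (cases "cond_val s b")
      case False
      with less.prems(1) fits[OF less.prems(1)] show ?thesis
        by (intro runsI[OF exec.WhileFalse]) auto
    next
      case True
      from body[OF less.prems(1) True] have "i < n" and r: "runs W c s T (I (Suc i))" by auto
      from r obtain t1 s1 where
        1: "exec W c s t1 s1" "t1 \<le> T" "I (Suc i) s1"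
        by (rule runsE)
      have "n - Suc i < n - i" "Suc i \<le> n" using \<open>i < n\<close> by auto
      from less.hyps[OF this(1) 1(3) this(2)] obtain t2 s2 where
        2: "exec W (While b c) s1 t2 s2"
          "t2 \<le> (n - Suc i) * T + (n - Suc i + 1) * (cond_cost b + 1)" "\<exists>i. I i s2 \<and> \<not> cond_val s2 b"
        by (rule runsE)
      have "exec W (While b c) s (cond_cost b + 1 + t1 + t2) s2"
        by (rule exec.WhileTrue) (use fits[OF less.prems(1)] True 1 2 in auto)
      moreover have "cond_cost b + 1 + t1 + t2 \<le> (n - i) * T + (n - i + 1) * (cond_cost b + 1)"
      proof -
        have "n - i = Suc (n - Suc i)" using \<open>i < n\<close> by simp
        then show ?thesis using 1(2) 2(2) by simp
      qed
      ultimately show ?thesis using 2(3) by (rule runsI)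
    qed
  qed
  from this[of 0 s] assms(1) show ?thesis by simp
qed

subsection \<open>Interleaved arrays\<close>

definition set_reg :: "state \<Rightarrow> nat \<Rightarrow> nat \<Rightarrow> state" where
  "set_reg s x v = s\<lparr>reg := (reg s)(x := v)\<rparr>"

text \<open>
  Arrays are interleaved with stride 16, so that array \<open>r\<close> occupies the offsets congruent to
  \<open>r\<close> from the base address in register 0. They need no declared lengths, and distinct arrays
  never overlap.
\<close>

definition arr :: "state \<Rightarrow> nat \<Rightarrow> nat \<Rightarrow> nat" where
  "arr s r i = mem s (reg s 0 + (16 * i + r))"

definition set_arr :: "state \<Rightarrow> nat \<Rightarrow> nat \<Rightarrow> nat \<Rightarrow> state" where
  "set_arr s r i v = s\<lparr>mem := (mem s)(reg s 0 + (16 * i + r) := v)\<rparr>"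

definition array_address :: "nat \<Rightarrow> expr \<Rightarrow> expr" where
  "array_address r e = Bin Add (Reg 0) (Bin Add (Bin Mul (Const 16) e) (Const r))"

definition ld :: "nat \<Rightarrow> expr \<Rightarrow> expr" where
  "ld r e = Mem (array_address r e)"

definition st :: "nat \<Rightarrow> expr \<Rightarrow> expr \<Rightarrow> prog" where
  "st r e1 e2 = Store (array_address r e1) e2"

text \<open>
  Weakest preconditions of programs without loops. Simplification with these equations
  executes a loop body symbolically.
\<close>

fun wpl :: "nat \<Rightarrow> prog \<Rightarrow> (state \<Rightarrow> bool) \<Rightarrow> state \<Rightarrow> bool" where
  "wpl W Skip Q s = Q s"
| "wpl W (Assign x e) Q s = (expr_fits W s e \<and> Q (set_reg s x (expr_val s e)))"
| "wpl W (Store e1 e2) Q s = (expr_fits W s e1 \<and> expr_fits W s e2 \<and>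
     Q (s\<lparr>mem := (mem s)(expr_val s e1 := expr_val s e2)\<rparr>))"
| "wpl W (Seq c1 c2) Q s = wpl W c1 (wpl W c2 Q) s"
| "wpl W (If b c1 c2) Q s = (cond_fits W s b \<and> (if cond_val s b then wpl W c1 Q s else wpl W c2 Q s))"
| "wpl W (While b c) Q s = False"

fun straight_cost :: "prog \<Rightarrow> nat" where
  "straight_cost Skip = 1"
| "straight_cost (Assign x e) = expr_cost e + 1"
| "straight_cost (Store e1 e2) = expr_cost e1 + expr_cost e2 + 1"
| "straight_cost (Seq c1 c2) = straight_cost c1 + straight_cost c2"
| "straight_cost (If b c1 c2) = cond_cost b + 1 + max (straight_cost c1) (straight_cost c2)"
| "straight_cost (While b c) = 0"

lemma runs_straight: "wpl W c Q s \<Longrightarrow> straight_cost c \<le> T \<Longrightarrow> runs W c s T Q"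
proof -
  have "wpl W c Q s \<Longrightarrow> runs W c s (straight_cost c) Q"
  proof (induction c arbitrary: Q s)
    case Skip
    then show ?case by (intro runsI[OF exec.Skip]) auto
  next
    case (Assign x e)
    then show ?case by (intro runsI[OF exec.Assign]) (auto simp: set_reg_def)
  next
    case (Store e1 e2)
    then show ?case by (intro runsI[OF exec.Store]) auto
  next
    case (Seq c1 c2)
    have "runs W c1 s (straight_cost c1) (wpl W c2 Q)" using Seq by simp
    then have "runs W (Seq c1 c2) s (straight_cost c1 + straight_cost c2) Q"
      using Seq.IH(2) by (rule runs_Seq)
    then show ?case by simp
  next
    case (If b c1 c2)
    show ?case
    proof (cases "cond_val s b")
      case True
      then have "runs W c1 s (straight_cost c1) Q" "cond_fits W s b" using If by auto
      then show ?thesis using True by (elim runsE) (intro runsI[OF exec.IfTrue], auto)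
    next
      case False
      then have "runs W c2 s (straight_cost c2) Q" "cond_fits W s b" using If by auto
      then show ?thesis using False by (elim runsE) (intro runsI[OF exec.IfFalse], auto)
    qed
  qed simp
  then show "wpl W c Q s \<Longrightarrow> straight_cost c \<le> T \<Longrightarrow> runs W c s T Q"
    using runs_weaken by blast
qed

lemma runs_If:
  assumes "cond_fits W s b"
    and "cond_val s b \<Longrightarrow> runs W c1 s T Q"
    and "\<not> cond_val s b \<Longrightarrow> runs W c2 s T Q"
  shows "runs W (If b c1 c2) s (cond_cost b + 1 + T) Q"
proof (cases "cond_val s b")
  case True
  from assms(2)[OF True] show ?thesis using True assms(1) by (elim runsE) (intro runsI[OF exec.IfTrue], auto)
next
  case False
  from assms(3)[OF False] show ?thesis using False assms(1) by (elim runsE) (intro runsI[OF exec.IfFalse], auto)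
qed

text \<open>
  The stride is a constant of the program and has to fit into a word, too.
\<close>

definition addressable :: "nat \<Rightarrow> state \<Rightarrow> nat \<Rightarrow> nat \<Rightarrow> bool" where
  "addressable W s r i \<longleftrightarrow> 16 < W \<and> reg s 0 + (16 * i + r) < W"

lemma expr_ld [simp]:
  "expr_val s (ld r e) = arr s r (expr_val s e)"
  "expr_cost (ld r e) = expr_cost e + 7"
  by (simp_all add: ld_def arr_def array_address_def)

lemma expr_fits_ld [simp]:
  "expr_fits W s (ld r e) \<longleftrightarrow> expr_fits W s e \<and> addressable W s r (expr_val s e) \<and>
     arr s r (expr_val s e) < W"
  by (auto simp: ld_def arr_def array_address_def addressable_def)

lemma wpl_st [simp]:
  "wpl W (st r e1 e2) Q s \<longleftrightarrow> expr_fits W s e1 \<and> expr_fits W s e2 \<and>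
     addressable W s r (expr_val s e1) \<and> Q (set_arr s r (expr_val s e1) (expr_val s e2))"
  by (auto simp: st_def set_arr_def array_address_def addressable_def)

lemma straight_cost_st [simp]: "straight_cost (st r e1 e2) = expr_cost e1 + expr_cost e2 + 7"
  by (simp add: st_def array_address_def)

lemma reg_set_reg [simp]: "reg (set_reg s x v) y = (if y = x then v else reg s y)"
  and reg_set_arr [simp]: "reg (set_arr s r i v) = reg s"
  and mem_set_reg [simp]: "mem (set_reg s x v) = mem s"
  by (simp_all add: set_reg_def set_arr_def)

lemma addressable_set_reg [simp]: "x \<noteq> 0 \<Longrightarrow> addressable W (set_reg s x v) = addressable W s"
  and addressable_set_arr [simp]: "addressable W (set_arr s r i v) = addressable W s"
  by (auto simp: addressable_def fun_eq_iff)

lemma mem_set_arr [simp]: "a < reg s 0 \<Longrightarrow> mem (set_arr s r i v) a = mem s a"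
  by (simp add: set_arr_def)

lemma arr_set_reg [simp]: "x \<noteq> 0 \<Longrightarrow> arr (set_reg s x v) = arr s"
  by (simp add: arr_def[abs_def])

lemma arr_set_arr [simp]:
  assumes "r < 16" "r' < 16"
  shows "arr (set_arr s r i v) r' = (if r' = r then (arr s r)(i := v) else arr s r')"
proof
  fix j
  have "16 * j + r' = 16 * i + r \<longleftrightarrow> j = i \<and> r' = r"
  proof
    assume eq: "16 * j + r' = 16 * i + r"
    have "r' = (16 * j + r') mod 16" using assms(2) by simp
    also have "\<dots> = r" unfolding eq using assms(1) by simp
    finally show "j = i \<and> r' = r" using eq by simp
  qed simp
  then show "arr (set_arr s r i v) r' j = (if r' = r then (arr s r)(i := v) else arr s r') j"
    by (auto simp: arr_def set_arr_def)
qed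

section \<open>Registers and arrays of the refinement program\<close>

text \<open>
  Register 0 is the base address of the arrays, and registers 1 and 2 hold the number of
  vertices and the degree. \<open>rX\<close> is the vertex to be individualized or the color to be
  processed, \<open>rK\<close> the current layer and \<open>rN\<close> the end of the current loop over \<open>rI\<close>.

  By vertex: \<open>COL\<close> is the color, \<open>OLD\<close> the color before the current split, \<open>POS\<close> the position
  in the ordered partition, and \<open>CNT\<close> the number of hits from the processed cell. \<open>EL\<close> is the
  inverse of \<open>POS\<close>. By color: \<open>SZ\<close> is the size of the cell and \<open>MARK\<close> the number of its
  members in the current layer. Row \<open>k\<close> of the matrix \<open>BUCK\<close>, of current length \<open>BLEN k\<close>,
  lists layer \<open>k\<close>, and \<open>TREE\<close> is the search tree.
\<close>

abbreviation (input) "rX \<equiv> (3 :: nat)"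
abbreviation (input) "rI \<equiv> (4 :: nat)"
abbreviation (input) "rJ \<equiv> (5 :: nat)"
abbreviation (input) "rU \<equiv> (6 :: nat)"
abbreviation (input) "rV \<equiv> (7 :: nat)"
abbreviation (input) "rK \<equiv> (8 :: nat)"
abbreviation (input) "rN \<equiv> (9 :: nat)"
abbreviation (input) "rC \<equiv> (10 :: nat)"
abbreviation (input) "rT \<equiv> (11 :: nat)"
abbreviation (input) "rW \<equiv> (12 :: nat)"
abbreviation (input) "rQ \<equiv> (13 :: nat)"

abbreviation (input) "COL \<equiv> (0 :: nat)"
abbreviation (input) "POS \<equiv> (1 :: nat)"
abbreviation (input) "EL \<equiv> (2 :: nat)"
abbreviation (input) "SZ \<equiv> (3 :: nat)"
abbreviation (input) "MARK \<equiv> (4 :: nat)"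
abbreviation (input) "CNT \<equiv> (5 :: nat)"
abbreviation (input) "TREE \<equiv> (6 :: nat)"
abbreviation (input) "BLEN \<equiv> (7 :: nat)"
abbreviation (input) "BUCK \<equiv> (8 :: nat)"
abbreviation (input) "OLD \<equiv> (9 :: nat)"

text \<open>
  Frame conditions of program parts; every array number is below the stride.
\<close>

abbreviation keeps_arrays_but :: "nat set \<Rightarrow> state \<Rightarrow> state \<Rightarrow> bool" where
  "keeps_arrays_but A s s' \<equiv> \<forall>r<16. r \<notin> A \<longrightarrow> arr s' r = arr s r"

abbreviation keeps_regs_but :: "nat set \<Rightarrow> state \<Rightarrow> state \<Rightarrow> bool" where
  "keeps_regs_but X s s' \<equiv> \<forall>x. x \<notin> X \<longrightarrow> reg s' x = reg s x"

abbreviation add (infixl "\<^bold>+" 65) where "add \<equiv> Bin Add"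
abbreviation sub (infixl "\<^bold>-" 65) where "sub \<equiv> Bin Sub"
abbreviation mul (infixl "\<^bold>*" 70) where "mul \<equiv> Bin Mul"

text \<open>
  The start node is expected in \<open>rJ\<close>. Halving the root node 1 yields 0, which ends the loop.
\<close>

definition climb :: "binop \<Rightarrow> prog" where
  "climb f = While (Less (Const 0) (Reg rJ))
     (st TREE (Reg rJ) (Bin f (ld TREE (Reg rJ)) (Const 1)) ;;
      Assign rJ (Bin Div (Reg rJ) (Const 2)))"

definition pop :: prog where
  "pop = Assign rJ (Const 1) ;;
     While (Less (Reg rJ) (Reg 1))
       (Assign rJ (Const 2 \<^bold>* Reg rJ) ;;
        If (Less (Const 0) (ld TREE (Reg rJ))) Skip (Assign rJ (Reg rJ \<^bold>+ Const 1))) ;;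
     Assign rX (Reg rJ \<^bold>- Reg 1) ;;
     climb Sub"

text \<open>
  The word bound admits the addresses of 16 interleaved arrays of length \<open>p * p\<close> after a base
  of \<open>p * p + p\<close>.
\<close>

locale refinement_machine =
  fixes W p d :: nat and adj :: "nat list list"
  assumes d: "0 < d" "d < p" and p: "3 \<le> p"
    and W: "20 * (p * p) + 100 \<le> W"
begin

text \<open>
  The input occupies one cell and \<open>p\<close> rows of length \<open>d + 1 \<le> p\<close>; the arrays start behind it.
  The list of vertex \<open>u\<close> begins at address \<open>2 + u * (d + 1)\<close>, after its length.
\<close>

definition base :: nat where "base = p * p + p"

definition input :: "state \<Rightarrow> bool" where
  "input s \<longleftrightarrow> reg s 0 = base \<and> reg s 1 = p \<and> reg s 2 = d \<and>
     (\<forall>u<p. \<forall>j<d. mem s (2 + u * (d + 1) + j) = adj ! u ! j)"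

lemma pp: "3 * p \<le> p * p" using p by simp

lemma p_less_W: "p < W" "p * p < W" "2 * p < W" "2 * p + 2 < W" "16 < W" "8 < W" "base < W"
  using W pp p unfolding base_def by linarith+

lemma input_set_reg [simp]: "2 < x \<Longrightarrow> input (set_reg s x v) = input s"
  by (simp add: input_def)

lemma input_address_less:
  assumes "u < p" "j < d"
  shows "2 + u * (d + 1) + j < base"
proof -
  have "u * (d + 1) + (d + 1) = (u + 1) * (d + 1)" by simp
  also have "\<dots> \<le> p * p" using assms d by (intro mult_le_mono) auto
  finally show ?thesis using assms p unfolding base_def by linarith
qed

lemma input_set_arr [simp]: "input s \<Longrightarrow> input (set_arr s r i v)"
  using input_address_less by (simp add: input_def)

lemma inputD: "input s \<Longrightarrow> reg s 0 = base" "input s \<Longrightarrow> reg s (Suc 0) = p" "input s \<Longrightarrow> reg s 2 = d"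
  by (auto simp: input_def)

lemma addressable_pp: "input s \<Longrightarrow> i < p * p \<Longrightarrow> r < 16 \<Longrightarrow> addressable W s r i"
  using W pp unfolding addressable_def inputD base_def by linarith

lemma addressable_p: "input s \<Longrightarrow> i < 2 * p \<Longrightarrow> r < 16 \<Longrightarrow> addressable W s r i"
  by (rule addressable_pp) (use pp p in linarith)+

text \<open>
  A bound on the number of levels of the search tree.
\<close>

definition D :: nat where "D = nat \<lceil>log 2 (real p)\<rceil> + 2"

lemma two_p_le: "2 * p \<le> 2 ^ D" and p_le: "p \<le> 2 ^ D"
proof -
  have "real p = 2 powr (log 2 (real p))" using p by simp
  also have "\<dots> \<le> 2 powr (real (nat \<lceil>log 2 (real p)\<rceil>))" by (intro powr_mono) linarith+
  also have "\<dots> = 2 ^ nat \<lceil>log 2 (real p)\<rceil>" by (simp add: powr_realpow)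
  finally have "real p \<le> real (2 ^ nat \<lceil>log 2 (real p)\<rceil>)" by simp
  then have "p \<le> 2 ^ nat \<lceil>log 2 (real p)\<rceil>" by (simp only: of_nat_le_iff)
  then show "2 * p \<le> 2 ^ D" "p \<le> 2 ^ D" by (auto simp: D_def)
qed

lemma D_bound: "real D \<le> 4 * log 2 (real p)"
proof -
  have "1 \<le> log 2 (real p)" using p by (simp add: le_log_iff)
  then show ?thesis unfolding D_def by (simp add: nat_add_distrib) linarith
qed

lemma climb_correct:
  assumes s: "input s" and b: "b < p" "reg s rJ = p + b"
    and f: "f = Add \<or> f = Sub" and le: "\<And>i. 0 < i \<Longrightarrow> arr s TREE i \<le> p"
  shows "runs W (climb f) s (30 * D + 30) (\<lambda>s'. input s' \<and>
    (\<forall>r<16. r \<noteq> TREE \<longrightarrow> arr s' r = arr s r) \<and> (\<forall>x. x \<noteq> rJ \<longrightarrow> reg s' x = reg s x) \<and>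
    (\<forall>i>0. arr s' TREE i = (if \<exists>k. i = (p + b) div 2 ^ k then op_val f (arr s TREE i) 1 else arr s TREE i)))"
proof -
  let ?a = "\<lambda>k. (p + b) div 2 ^ k"
  have a_Suc: "?a (Suc k) = ?a k div 2" for k
    unfolding power_Suc2 div_mult2_eq ..
  have a_le: "?a k \<le> p + b" for k by simp
  define I where "I = (\<lambda>k s'. input s' \<and> reg s' rJ = ?a k \<and>
    (\<forall>r<16. r \<noteq> TREE \<longrightarrow> arr s' r = arr s r) \<and> (\<forall>x. x \<noteq> rJ \<longrightarrow> reg s' x = reg s x) \<and>
    (\<forall>i>0. arr s' TREE i = (if \<exists>l<k. i = ?a l then op_val f (arr s TREE i) 1 else arr s TREE i)))"
  have dec: "?a k < ?a l" if "l < k" "0 < ?a k" for k l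
    using that
  proof (induction k)
    case (Suc k)
    have pos: "0 < ?a k" using Suc.prems a_Suc[of k] by (cases "?a k = 0") auto
    then have "?a (Suc k) < ?a k" unfolding a_Suc by simp
    then show ?case using Suc pos by (cases "l = k") auto
  qed simp
  have "runs W (climb f) s (D * 22 + (D + 1) * (cond_cost (Less (Const 0) (Reg rJ)) + 1))
    (\<lambda>s'. \<exists>k. I k s' \<and> \<not> cond_val s' (Less (Const 0) (Reg rJ)))"
    unfolding climb_def
  proof (rule runs_While_bounded)
    show "I 0 s" using assms by (simp add: I_def)
  next
    fix s' k assume I: "I k s'"
    show "cond_fits W s' (Less (Const 0) (Reg rJ))"
    proof -
      have "?a k < W" using a_le[of k] b p_less_W(3) by linarith
      then show ?thesis using I p_less_W(5) by (simp add: I_def)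
    qed
    assume "cond_val s' (Less (Const 0) (Reg rJ))"
    then have pos: "0 < ?a k" using I by (simp add: I_def)
    have kD: "k < D"
    proof (rule ccontr)
      assume "\<not> k < D"
      then have "(2::nat) ^ D \<le> 2 ^ k" by (intro power_increasing) auto
      then have "p + b < 2 ^ k" using two_p_le b by linarith
      then show False using pos by simp
    qed
    have bnd: "?a k < 2 * p" using a_le[of k] b by linarith
    have not_yet: "\<not> (\<exists>l<k. ?a k = ?a l)" using dec pos by (metis less_irrefl)
    have "arr s' TREE (?a k) = (if \<exists>l<k. ?a k = ?a l then op_val f (arr s TREE (?a k)) 1 else arr s TREE (?a k))"
      using I pos unfolding I_def by blast
    then have cur: "arr s' TREE (?a k) = arr s TREE (?a k)" unfolding if_not_P[OF not_yet] .
    have cur_le: "arr s TREE (?a k) \<le> p" using le pos by simp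
    have upd: "(\<exists>l<Suc k. i = ?a l) \<longleftrightarrow> (\<exists>l<k. i = ?a l) \<or> i = ?a k" for i
      by (auto simp: less_Suc_eq)
    have rj: "reg s' 5 = ?a k" using I by (simp add: I_def)
    have ad: "addressable W s' 6 (?a k)" using I addressable_p[OF _ bnd] by (simp add: I_def)
    have op: "op_val f (arr s TREE (?a k)) 1 < W" "op_val f (arr s TREE (?a k)) 1 \<le> W"
      using f cur_le p_less_W by auto
    have "wpl W (st TREE (Reg rJ) (Bin f (ld TREE (Reg rJ)) (Const 1)) ;;
      Assign rJ (Bin Div (Reg rJ) (Const 2))) (I (Suc k)) s'"
      using I ad op bnd cur cur_le p_less_W not_yet
      by (simp add: rj) (auto simp: I_def a_Suc[simplified] upd)
    then have "runs W (st TREE (Reg rJ) (Bin f (ld TREE (Reg rJ)) (Const 1)) ;;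
      Assign rJ (Bin Div (Reg rJ) (Const 2))) s' 22 (I (Suc k))"
      by (rule runs_straight) simp
    with kD show "k < D \<and> runs W (st TREE (Reg rJ) (Bin f (ld TREE (Reg rJ)) (Const 1)) ;;
      Assign rJ (Bin Div (Reg rJ) (Const 2))) s' 22 (I (Suc k))" ..
  qed
  then show ?thesis
  proof (rule runs_weaken)
    fix s' assume "\<exists>k. I k s' \<and> \<not> cond_val s' (Less (Const 0) (Reg rJ))"
    then obtain k where k: "I k s'" and nc: "\<not> cond_val s' (Less (Const 0) (Reg rJ))" by blast
    have a0: "?a k = 0" using k nc by (simp add: I_def)
    have "(\<exists>l. i = ?a l) \<longleftrightarrow> (\<exists>l<k. i = ?a l)" if "0 < i" for i
    proof
      assume "\<exists>l. i = ?a l"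
      then obtain l where l: "i = ?a l" by blast
      have "l < k"
      proof (rule ccontr)
        assume "\<not> l < k"
        then have "?a l \<le> ?a k" by (intro div_le_mono2 power_increasing) auto
        then show False using a0 l that by simp
      qed
      then show "\<exists>l<k. i = ?a l" using l by blast
    qed blast
    then show "input s' \<and>
    (\<forall>r<16. r \<noteq> TREE \<longrightarrow> arr s' r = arr s r) \<and> (\<forall>x. x \<noteq> rJ \<longrightarrow> reg s' x = reg s x) \<and>
    (\<forall>i>0. arr s' TREE i = (if \<exists>k. i = ?a k then op_val f (arr s TREE i) 1 else arr s TREE i))"
      using k unfolding I_def by simp
  qed simp
qed

section \<open>The tree of waiting colors\<close>

definition tree_of :: "state \<Rightarrow> nat set \<Rightarrow> bool" where
  "tree_of s V \<longleftrightarrow> (\<forall>i>0. arr s TREE i = tree_count p V i)"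

lemma tree_count_le_p: "V \<subseteq> {..<p} \<Longrightarrow> tree_count p V i \<le> p"
  using tree_count_le_card[of V p i] card_mono[of "{..<p}" V] finite_subset[of V "{..<p}"] by simp

text \<open>
  Since the visited nodes are the ancestors of the leaf, the counters are changed by the
  counters of a singleton.
\<close>

lemma climb_tree:
  assumes s: "input s" and b: "b < p" "reg s rJ = p + b"
    and t: "tree_of s V" "V \<subseteq> {..<p}"
    and f: "f = Add \<and> b \<notin> V \<and> V' = insert b V \<or> f = Sub \<and> b \<in> V \<and> V' = V - {b}"
  shows "runs W (climb f) s (30 * D + 30) (\<lambda>s'. input s' \<and> tree_of s' V' \<and>
    (\<forall>r<16. r \<noteq> TREE \<longrightarrow> arr s' r = arr s r) \<and> (\<forall>x. x \<noteq> rJ \<longrightarrow> reg s' x = reg s x))"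
proof -
  have "runs W (climb f) s (30 * D + 30) (\<lambda>s'. input s' \<and>
    (\<forall>r<16. r \<noteq> TREE \<longrightarrow> arr s' r = arr s r) \<and> (\<forall>x. x \<noteq> rJ \<longrightarrow> reg s' x = reg s x) \<and>
    (\<forall>i>0. arr s' TREE i = (if \<exists>k. i = (p + b) div 2 ^ k then op_val f (arr s TREE i) 1 else arr s TREE i)))"
    by (rule climb_correct[OF s b]) (use f t tree_count_le_p in \<open>auto simp: tree_of_def\<close>)
  then show ?thesis
  proof (rule runs_weaken[OF _ order_refl], elim conjE, intro conjI)
    fix s' assume upd: "\<forall>i>0. arr s' TREE i = (if \<exists>k. i = (p + b) div 2 ^ k then op_val f (arr s TREE i) 1 else arr s TREE i)"
    show "tree_of s' V'"
      unfolding tree_of_def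
    proof (intro allI impI)
      fix i :: nat assume i: "0 < i"
      have "arr s' TREE i = op_val f (tree_count p V i) (tree_count p {b} i)"
        using upd i t(1) f tree_count_singleton[OF b(1) i] by (auto simp: tree_of_def)
      then show "arr s' TREE i = tree_count p V' i"
        using f tree_count_insert[of b V p i] tree_count_remove[of b V p i] by auto
    qed
  qed
qed

lemma pop_correct:
  assumes s: "input s" and t: "tree_of s V" "V \<subseteq> {..<p}" "V \<noteq> {}"
  shows "runs W pop s (100 * D + 100) (\<lambda>s'. input s' \<and> reg s' rX = select p V \<and> tree_of s' (V - {select p V}) \<and>
    (\<forall>r<16. r \<noteq> TREE \<longrightarrow> arr s' r = arr s r) \<and> (\<forall>x. x \<noteq> rJ \<and> x \<noteq> rX \<longrightarrow> reg s' x = reg s x))"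
proof -
  let ?x = "select p V"
  have xV: "?x \<in> V" using t by (intro select_in)
  then have xp: "?x < p" using t by auto
  let ?same = "\<lambda>s'. input s' \<and> (\<forall>r<16. arr s' r = arr s r) \<and> (\<forall>x. x \<noteq> rJ \<and> x \<noteq> rX \<longrightarrow> reg s' x = reg s x)"
  define I where "I = (\<lambda>k s'. ?same s' \<and> 2 ^ k \<le> reg s' rJ \<and> reg s' rJ < 2 * p \<and>
    0 < tree_count p V (reg s' rJ) \<and> tree_search p V (reg s' rJ) = ?x)"
  let ?b = "Less (Reg rJ) (Reg 1)"
  let ?body = "Assign rJ (Const 2 \<^bold>* Reg rJ) ;;
        If (Less (Const 0) (ld TREE (Reg rJ))) Skip (Assign rJ (Reg rJ \<^bold>+ Const 1))"
  have 1: "runs W (Assign rJ (Const 1)) s 2 (I 0)"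
    using s p p_less_W tree_count_root_pos[OF t(2,3)]
    by (intro runs_straight) (auto simp: I_def select_def)
  have 2: "runs W (While ?b ?body) s' (D * 30 + (D + 1) * 4) (\<lambda>s'. ?same s' \<and> reg s' rJ = p + ?x)" if "I 0 s'" for s'
  proof -
    have "runs W (While ?b ?body) s' (D * 30 + (D + 1) * (cond_cost ?b + 1)) (\<lambda>s'. \<exists>k. I k s' \<and> \<not> cond_val s' ?b)"
      using that
    proof (rule runs_While_bounded)
      fix k s' assume I: "I k s'"
      then show "cond_fits W s' ?b" using p_less_W by (simp add: I_def inputD)
      assume "cond_val s' ?b"
      then have jp: "reg s' 5 < p" using I by (simp add: I_def inputD)
      have "2 ^ k \<le> reg s' 5" using I by (simp add: I_def)
      then have j0: "0 < reg s' 5" using less_le_trans[OF zero_less_power[of 2 k]] by simp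
      have kD: "k < D"
      proof (rule ccontr)
        assume "\<not> k < D"
        then have "(2::nat) ^ D \<le> 2 ^ k" by (intro power_increasing) auto
        then show False using \<open>2 ^ k \<le> reg s' 5\<close> jp p_le by linarith
      qed
      have node: "tree_count p V (reg s' 5) = tree_count p V (2 * reg s' 5) + tree_count p V (2 * reg s' 5 + 1)"
        using j0 jp by (rule tree_count_node)
      have pos: "0 < tree_count p V (reg s' 5)" using I by (simp add: I_def)
      have srch: "?x = (if 0 < tree_count p V (2 * reg s' 5) then tree_search p V (2 * reg s' 5)
          else tree_search p V (2 * reg s' 5 + 1))"
        using I j0 jp by (simp add: I_def tree_search.simps[of p V "reg s' 5"])
      have "arr s' 6 (2 * reg s' 5) = tree_count p V (2 * reg s' 5)"
        using I j0 t(1) by (simp add: I_def tree_of_def)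
      moreover have "addressable W s' 6 (2 * reg s' 5)"
        by (rule addressable_p) (use I jp in \<open>auto simp: I_def\<close>)
      moreover have "tree_count p V (2 * reg s' 5) < W"
        using tree_count_le_p[OF t(2), of "2 * reg s' 5"] p_less_W by linarith
      moreover have "2 * reg s' 5 + 1 < 2 * p" "2 * reg s' 5 + 1 < W" using jp p_less_W by linarith+
      moreover have "input s'" using I by (simp add: I_def)
      ultimately have "wpl W ?body (I (Suc k)) s'"
        using p_less_W jp I pos node srch
        by (simp add: inputD) (auto simp: I_def)
      then have "runs W ?body s' 30 (I (Suc k))" by (rule runs_straight) simp
      with kD show "k < D \<and> runs W ?body s' 30 (I (Suc k))" ..
    qed
    then show ?thesis
    proof (rule runs_weaken)
      fix s' assume "\<exists>k. I k s' \<and> \<not> cond_val s' ?b"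
      then obtain k where I: "I k s'" and "\<not> cond_val s' ?b" by blast
      then have "p \<le> reg s' rJ" by (simp add: I_def inputD)
      moreover from this have "?x = reg s' rJ - p" using I by (simp add: I_def tree_search.simps[of p V "reg s' 5"])
      ultimately show "?same s' \<and> reg s' rJ = p + ?x" using I by (simp add: I_def)
    qed simp
  qed
  have 3: "runs W (Assign rX (Reg rJ \<^bold>- Reg 1)) s' 6
    (\<lambda>s'. ?same s' \<and> reg s' rJ = p + ?x \<and> reg s' rX = ?x)" if "?same s' \<and> reg s' rJ = p + ?x" for s'
    using that p_less_W xp by (intro runs_straight) (auto simp: inputD)
  have 4: "runs W (climb Sub) s' (30 * D + 30) (\<lambda>s'. input s' \<and> reg s' rX = ?x \<and> tree_of s' (V - {?x}) \<and>
    (\<forall>r<16. r \<noteq> TREE \<longrightarrow> arr s' r = arr s r) \<and> (\<forall>x. x \<noteq> rJ \<and> x \<noteq> rX \<longrightarrow> reg s' x = reg s x))"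
    if s': "?same s' \<and> reg s' rJ = p + ?x \<and> reg s' rX = ?x" for s'
  proof -
    have "runs W (climb Sub) s' (30 * D + 30) (\<lambda>t. input t \<and> tree_of t (V - {?x}) \<and>
      (\<forall>r<16. r \<noteq> TREE \<longrightarrow> arr t r = arr s' r) \<and> (\<forall>x. x \<noteq> rJ \<longrightarrow> reg t x = reg s' x))"
      by (rule climb_tree[where b = ?x and V = V]) (use s' xp xV t in \<open>auto simp: tree_of_def\<close>)
    then show ?thesis by (rule runs_weaken) (use s' in auto)
  qed
  have "runs W pop s (2 + (D * 30 + (D + 1) * 4 + (6 + (30 * D + 30)))) (\<lambda>s'. input s' \<and> reg s' rX = ?x \<and> tree_of s' (V - {?x}) \<and>
    (\<forall>r<16. r \<noteq> TREE \<longrightarrow> arr s' r = arr s r) \<and> (\<forall>x. x \<noteq> rJ \<and> x \<noteq> rX \<longrightarrow> reg s' x = reg s x))"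
    unfolding pop_def
    by (rule runs_Seq[OF 1 runs_Seq[OF 2]]) (assumption | rule runs_Seq[OF 3 4])+
  then show ?thesis by (rule runs_weaken) auto
qed

end

section \<open>Splitting the cells by one layer\<close>

text \<open>
  The positions permitted for \<open>v\<close> while the layer \<open>M\<close> is being marked: the marked members of a
  cell are gathered at the end of the interval of the cell, where the new cell will be.
\<close>

definition in_part :: "nat \<Rightarrow> (nat \<Rightarrow> nat) \<Rightarrow> nat set \<Rightarrow> nat \<Rightarrow> nat \<Rightarrow> bool" where
  "in_part p col M v i \<longleftrightarrow>
    (if v \<in> M
     then col v + card (cell p col (col v) - M) \<le> i \<and> i < col v + card (cell p col (col v))
     else col v \<le> i \<and> i < col v + card (cell p col (col v) - M))"

definition arranged :: "nat \<Rightarrow> (nat \<Rightarrow> nat) \<Rightarrow> nat set \<Rightarrow> (nat \<Rightarrow> nat) \<Rightarrow> (nat \<Rightarrow> nat) \<Rightarrow> bool" where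
  "arranged p col M pos el \<longleftrightarrow> (\<forall>i<p. el i < p \<and> pos (el i) = i) \<and>
     (\<forall>v<p. pos v < p \<and> el (pos v) = v \<and> in_part p col M v (pos v))"

lemma arrangedD:
  assumes "arranged p col M pos el"
  shows "i < p \<Longrightarrow> el i < p" "i < p \<Longrightarrow> pos (el i) = i"
    "v < p \<Longrightarrow> pos v < p" "v < p \<Longrightarrow> el (pos v) = v" "v < p \<Longrightarrow> in_part p col M v (pos v)"
  using assms by (auto simp: arranged_def)

text \<open>
  After marking, the arrangement is already the one of the split coloring.
\<close>

lemma arranged_split:
  assumes "valid_coloring p col" "arranged p col M pos el"
  shows "arranged p (split_col p M col) {} pos el"
proof -
  have "in_part p (split_col p M col) {} v (pos v)" if v: "v < p" for v
    using arrangedD(5)[OF assms(2) v] card_cell_split[of p col "col v" M]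
    unfolding in_part_def cell_split_col[OF assms(1) v]
    by (auto simp: split_col_def new_color_def split: if_splits)
  then show ?thesis using assms(2) by (simp add: arranged_def)
qed

text \<open>
  One more vertex is marked by exchanging it with the last unmarked vertex of its cell, which
  stands at position \<open>t\<close>.
\<close>

lemma arranged_mark:
  assumes vc: "valid_coloring p col" and A: "arranged p col M pos el" and v: "v < p" "v \<notin> M"
  defines "t \<equiv> col v + card (cell p col (col v)) - (1 + card (cell p col (col v) \<inter> M))"
  shows "t < p" "arranged p col (insert v M) (pos(el t := pos v, v := t)) (el(pos v := el t, t := v))"
proof -
  let ?C = "cell p col (col v)"
  have v_in: "v \<in> ?C - M" using v by (simp add: in_cell_iff)
  then have pos_card: "card (?C - M) > 0" by (auto simp: card_gt_0_iff)
  have t: "t = col v + (card (?C - M) - 1)"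
    unfolding t_def using card_cell_split[of p col "col v" M] pos_card by simp
  have le: "card (?C - M) \<le> card ?C" by (rule card_mono) auto
  show tp: "t < p" using t le pos_card color_bound[OF vc v(1)] by linarith
  let ?w = "el t" and ?q = "pos v"
  have wp: "?w < p" "pos ?w = t" using arrangedD[OF A] tp by auto
  have vq: "col v \<le> ?q" "?q < col v + card (?C - M)" "?q < p" "el ?q = v"
    using arrangedD[OF A] v by (auto simp: in_part_def)
  have w_part: "in_part p col M ?w t" using arrangedD(5)[OF A wp(1)] wp(2) by simp
  have tb: "col v \<le> t" "t < col v + card (?C - M)" using t pos_card by auto
  have w_le: "card (cell p col (col ?w) - M) \<le> card (cell p col (col ?w))" by (rule card_mono) auto
  have col_w: "col ?w = col v"
  proof (rule ccontr)
    assume "col ?w \<noteq> col v"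
    then consider "col ?w < col v" | "col v < col ?w" by linarith
    then show False
    proof cases
      case 1
      then have "col ?w + card (cell p col (col ?w)) \<le> col v" using color_gap[OF vc wp(1) v(1)] by simp
      then show False using w_part w_le tb by (auto simp: in_part_def split: if_splits)
    next
      case 2
      then have "col v + card ?C \<le> col ?w" using color_gap[OF vc v(1) wp(1)] by simp
      then show False using w_part tb le by (auto simp: in_part_def split: if_splits)
    qed
  qed
  have w_M: "?w \<notin> M"
    using w_part tb(2) col_w by (auto simp: in_part_def)
  have card_ins: "card (cell p col b - insert v M) = (if b = col v then card (?C - M) - 1 else card (cell p col b - M))" for b
  proof (cases "b = col v")
    case True
    then have "cell p col b - insert v M = (?C - M) - {v}" by blast
    then show ?thesis using v_in True by simp
  next
    case False
    then have "cell p col b - insert v M = cell p col b - M" by (auto simp: in_cell_iff)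
    then show ?thesis using False by simp
  qed
  let ?pos = "pos(?w := ?q, v := t)" and ?el = "el(?q := ?w, t := v)"
  have el1: "?el i < p \<and> ?pos (?el i) = i" if i: "i < p" for i
  proof -
    consider "i = t" | "i \<noteq> t" "i = ?q" | "i \<noteq> t" "i \<noteq> ?q" by blast
    then show ?thesis
    proof cases
      case 1
      then show ?thesis using v by simp
    next
      case 2
      then have "?w \<noteq> v" using wp(2) by auto
      then show ?thesis using 2 wp by simp
    next
      case 3
      have "el i \<noteq> ?w" using arrangedD(2)[OF A i] wp 3 by auto
      moreover have "el i \<noteq> v" using arrangedD(2)[OF A i] 3 by auto
      ultimately show ?thesis using 3 arrangedD(1,2)[OF A i] by simp
    qed
  qed
  have pos1: "?pos u < p \<and> ?el (?pos u) = u \<and> in_part p col (insert v M) u (?pos u)" if u: "u < p" for u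
  proof -
    consider "u = v" | "u \<noteq> v" "u = ?w" | "u \<noteq> v" "u \<noteq> ?w" by blast
    then show ?thesis
    proof cases
      case 1
      have "in_part p col (insert v M) v t" using tb le t pos_card by (auto simp: in_part_def card_ins)
      then show ?thesis using 1 tp by simp
    next
      case 2
      have "?q \<noteq> t" using 2 vq(4) by auto
      then have "?q < col v + (card (?C - M) - 1)" using vq(2) t by linarith
      then have "in_part p col (insert v M) ?w ?q"
        using 2 w_M vq col_w by (auto simp: in_part_def card_ins)
      then show ?thesis using 2 vq \<open>?q \<noteq> t\<close> by simp
    next
      case 3
      have q: "pos u \<noteq> ?q" "pos u \<noteq> t" using arrangedD(4)[OF A u] vq(4) 3 by auto
      have "in_part p col M u (pos u)" using arrangedD(5)[OF A u] .
      then have "in_part p col (insert v M) u (pos u)"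
        using 3 q(2) t pos_card by (auto simp: in_part_def card_ins split: if_splits)
      then show ?thesis using 3 q arrangedD(3,4)[OF A u] by simp
    qed
  qed
  show "arranged p col (insert v M) ?pos ?el"
    unfolding arranged_def using el1 pos1 by blast
qed

lemma arranged_members:
  assumes vc: "valid_coloring p col" and A: "arranged p col {} pos el" and x: "x \<in> colors p col"
  shows "bij_betw el {x..<x + card (cell p col x)} (cell p col x)" "x + card (cell p col x) \<le> p"
proof -
  from x obtain v where v: "v < p" "col v = x" by (auto simp: colors_def)
  show le: "x + card (cell p col x) \<le> p" using color_bound[OF vc v(1)] v(2) by simp
  show "bij_betw el {x..<x + card (cell p col x)} (cell p col x)"
    unfolding bij_betw_def
  proof
    show "inj_on el {x..<x + card (cell p col x)}"
      using arrangedD(2)[OF A] le by (intro inj_on_inverseI[of _ pos]) auto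
    show "el ` {x..<x + card (cell p col x)} = cell p col x"
    proof (intro equalityI subsetI)
      fix u assume "u \<in> el ` {x..<x + card (cell p col x)}"
      then obtain i where i: "x \<le> i" "i < x + card (cell p col x)" "u = el i" by auto
      then have u: "u < p" "pos u = i" using arrangedD[OF A, of i] le by auto
      have "in_part p col {} u i" using arrangedD(5)[OF A u(1)] u(2) by simp
      then have "col u \<le> i" "i < col u + card (cell p col (col u))" by (auto simp: in_part_def)
      then have "col u = x"
        using color_gap[OF vc u(1) v(1)] color_gap[OF vc v(1) u(1)] i v(2)
        by (cases "col u" x rule: linorder_cases) auto
      then show "u \<in> cell p col x" using u by (simp add: in_cell_iff)
    next
      fix u assume "u \<in> cell p col x"
      then have u: "u < p" "col u = x" by (auto simp: in_cell_iff)
      have "in_part p col {} u (pos u)" using arrangedD(5)[OF A u(1)] .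
      then have "pos u \<in> {x..<x + card (cell p col x)}" using u by (simp add: in_part_def)
      then show "u \<in> el ` {x..<x + card (cell p col x)}" using arrangedD(4)[OF A u(1)] by (metis imageI)
    qed
  qed
qed

definition bucket_entry :: expr where
  "bucket_entry = ld BUCK (Reg rK \<^bold>* Reg 1 \<^bold>+ Reg rI)"

text \<open>
  The three passes over a layer cannot be merged: marking looks up the old colors of all
  members, recoloring needs the final numbers of marked vertices, and the sizes of the cells
  may be changed only after all members have been recolored.
\<close>

definition mark_body :: prog where
  "mark_body =
     Assign rV bucket_entry ;;
     Assign rC (ld COL (Reg rV)) ;;
     st CNT (Reg rV) (Const 0) ;;
     Assign rT (ld COL (Reg rV) \<^bold>+ ld SZ (Reg rC) \<^bold>- (Const 1 \<^bold>+ ld MARK (Reg rC))) ;;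
     Assign rW (ld EL (Reg rT)) ;;
     Assign rQ (ld POS (Reg rV)) ;;
     st EL (Reg rQ) (Reg rW) ;;
     st POS (Reg rW) (Reg rQ) ;;
     st EL (Reg rT) (Reg rV) ;;
     st POS (Reg rV) (Reg rT) ;;
     st MARK (Reg rC) (ld MARK (Reg rC) \<^bold>+ Const 1) ;;
     Assign rI (Reg rI \<^bold>+ Const 1)"

definition each_entry :: "prog \<Rightarrow> prog" where
  "each_entry c = Assign rI (Const 0) ;; While (Less (Reg rI) (Reg rN)) c"

definition recolor_body :: prog where
  "recolor_body =
     Assign rV bucket_entry ;;
     Assign rC (ld COL (Reg rV)) ;;
     st OLD (Reg rV) (Reg rC) ;;
     st COL (Reg rV) (Reg rC \<^bold>+ (ld SZ (Reg rC) \<^bold>- ld MARK (Reg rC))) ;;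
     Assign rI (Reg rI \<^bold>+ Const 1)"

text \<open>
  The first member of a cell updates the cell and resets its mark counter; for the other
  members \<open>rW\<close> is then 0 and nothing happens. \<open>rC\<close> and \<open>rQ\<close> are the old and the new color,
  \<open>rT\<close> and \<open>rW\<close> the sizes of the unmarked and the marked part. The tree entry of the old color
  tells whether it is waiting.
\<close>

definition requeue_body :: prog where
  "requeue_body =
     (Assign rV bucket_entry ;;
      Assign rC (ld OLD (Reg rV)) ;;
      Assign rW (ld MARK (Reg rC)) ;;
      st MARK (Reg rC) (Const 0) ;;
      Assign rT (ld SZ (Reg rC) \<^bold>- Reg rW)) ;;
     If (And (Less (Const 0) (Reg rW)) (Less (Const 0) (Reg rT)))
       ((Assign rQ (ld COL (Reg rV)) ;;
         st SZ (Reg rQ) (Reg rW) ;;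
         st SZ (Reg rC) (Reg rT) ;;
         If (And (Not (Less (Const 0) (ld TREE (Reg 1 \<^bold>+ Reg rC)))) (Less (Reg rT) (Reg rW)))
           (Assign rJ (Reg 1 \<^bold>+ Reg rC)) (Assign rJ (Reg 1 \<^bold>+ Reg rQ))) ;;
        climb Add)
       Skip ;;
     Assign rI (Reg rI \<^bold>+ Const 1)"

context refinement_machine
begin

lemma less_p_less_W: "x < p \<Longrightarrow> x < W" "x \<le> p \<Longrightarrow> x < W"
  using p_less_W(1) by auto

lemma bucket_index: "k < p \<Longrightarrow> i < p \<Longrightarrow> k * p + i < p * p" for k i :: nat
proof -
  assume "k < p" "i < p"
  then have "k * p + p \<le> p * p" by (metis Suc_leI add.commute mult_Suc mult_le_mono1)
  then show ?thesis using \<open>i < p\<close> by linarith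
qed

text \<open>
  Registers that the passes over a layer may overwrite.
\<close>

definition scratch :: "nat set" where "scratch = {rI, rJ, rU, rV, rC, rT, rW, rQ}"

text \<open>
  The members of layer \<open>k\<close> as a list, in the order in which the passes treat them.
\<close>

definition entries :: "state \<Rightarrow> nat \<Rightarrow> nat list \<Rightarrow> bool" where
  "entries s k Ms \<longleftrightarrow> reg s rK = k \<and> reg s rN = length Ms \<and> k < p \<and>
     distinct Ms \<and> set Ms \<subseteq> {..<p} \<and> (\<forall>i<length Ms. arr s BUCK (k * p + i) = Ms ! i)"

lemma entries_length: "entries s k Ms \<Longrightarrow> length Ms \<le> p"
  using card_mono[of "{..<p}" "set Ms"] by (simp add: entries_def distinct_card)

lemma each_entry_runs:
  assumes I0: "I 0 (set_reg s rI 0)"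
    and I: "\<And>i s. I i s \<Longrightarrow> input s \<and> entries s k Ms \<and> reg s rI = i"
    and body: "\<And>i s. I i s \<Longrightarrow> i < length Ms \<Longrightarrow> runs W c s (T i) (I (Suc i))"
    and s: "entries s k Ms"
  shows "runs W (each_entry c) s ((\<Sum>i<length Ms. T i) + 4 * length Ms + 6) (I (length Ms))"
proof -
  have n: "length Ms < W" using entries_length[OF s] less_p_less_W by blast
  have "runs W (While (Less (Reg rI) (Reg rN)) c) s'
      ((\<Sum>i<length Ms. T i) + (length Ms + 1) * (cond_cost (Less (Reg rI) (Reg rN)) + 1)) (I (length Ms))"
    if "I 0 s'" for s'
  proof (rule runs_While_count)
    show "I 0 s'" by fact
  next
    fix s i assume si: "I i s" "i < length Ms"
    have "cond_fits W s (Less (Reg rI) (Reg rN)) \<and> cond_val s (Less (Reg rI) (Reg rN))"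
      using I[OF si(1)] si(2) n by (simp add: entries_def)
    with body[OF si] show "cond_fits W s (Less (Reg rI) (Reg rN)) \<and> cond_val s (Less (Reg rI) (Reg rN)) \<and>
      runs W c s (T i) (I (Suc i))" by blast
  next
    fix s assume "I (length Ms) s"
    from I[OF this] show "cond_fits W s (Less (Reg rI) (Reg rN)) \<and> \<not> cond_val s (Less (Reg rI) (Reg rN))"
      using n by (simp add: entries_def)
  qed
  moreover have "runs W (Assign rI (Const 0)) s 2 (I 0)"
    using I0 p_less_W by (intro runs_straight) auto
  ultimately have "runs W (each_entry c) s (2 + ((\<Sum>i<length Ms. T i) +
      (length Ms + 1) * (cond_cost (Less (Reg rI) (Reg rN)) + 1))) (I (length Ms))"
    unfolding each_entry_def by (intro runs_Seq)
  then show ?thesis by (rule runs_weaken) auto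
qed

lemma set_take_Suc: "i < length Ms \<Longrightarrow> set (take (Suc i) Ms) = insert (Ms ! i) (set (take i Ms))"
  by (simp add: take_Suc_conv_app_nth)

lemma nth_notin_take: "distinct Ms \<Longrightarrow> i < length Ms \<Longrightarrow> Ms ! i \<notin> set (take i Ms)"
  by (auto simp: in_set_conv_nth nth_eq_iff_index_eq)

lemma mark_correct:
  assumes s: "input s" "entries s k Ms"
    and vc: "valid_coloring p col"
    and COL: "\<And>v. v < p \<Longrightarrow> arr s COL v = col v" and SZ: "\<And>b. arr s SZ b = card (cell p col b)"
    and MARK: "\<And>b. arr s MARK b = 0" and A: "arranged p col {} (arr s POS) (arr s EL)"
  shows "runs W (each_entry mark_body) s (300 * length Ms + 6) (\<lambda>s'. input s' \<and>
    arranged p col (set Ms) (arr s' POS) (arr s' EL) \<and>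
    (\<forall>b. arr s' MARK b = card (cell p col b \<inter> set Ms)) \<and>
    (\<forall>v. arr s' CNT v = (if v \<in> set Ms then 0 else arr s CNT v)) \<and>
    keeps_arrays_but {POS, EL, MARK, CNT} s s' \<and> keeps_regs_but scratch s s')"
proof -
  define I where "I = (\<lambda>i s'. input s' \<and> reg s' rI = i \<and>
    arranged p col (set (take i Ms)) (arr s' POS) (arr s' EL) \<and>
    (\<forall>b. arr s' MARK b = card (cell p col b \<inter> set (take i Ms))) \<and>
    (\<forall>v. arr s' CNT v = (if v \<in> set (take i Ms) then 0 else arr s CNT v)) \<and>
    keeps_arrays_but {POS, EL, MARK, CNT} s s' \<and> keeps_regs_but scratch s s')"
  have "runs W (each_entry mark_body) s ((\<Sum>i<length Ms. 200) + 4 * length Ms + 6) (I (length Ms))"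
  proof (rule each_entry_runs[where k = k])
    show "I 0 (set_reg s rI 0)"
      using s(1) A MARK by (simp add: I_def scratch_def)
    show "entries s k Ms" by fact
  next
    fix i s' assume "I i s'"
    then show "input s' \<and> entries s' k Ms \<and> reg s' rI = i"
      using s(2) by (simp add: I_def entries_def scratch_def)
  next
    fix i s' assume I: "I i s'" and i: "i < length Ms"
    define v where "v = Ms ! i"
    define M where "M = set (take i Ms)"
    define c where "c = col v"
    define t where "t = c + card (cell p col c) - (1 + card (cell p col c \<inter> M))"
    define w where "w = arr s' EL t"
    define q where "q = arr s' POS v"
    have e: "entries s' k Ms" and s': "input s'" using I s(2) by (auto simp: I_def entries_def scratch_def)
    have v: "v < p" "v \<notin> M" using i s(2) nth_notin_take[of Ms i] by (auto simp: v_def M_def entries_def subset_iff)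
    have A': "arranged p col M (arr s' POS) (arr s' EL)" using I by (simp add: I_def M_def)
    note mk = arranged_mark[OF vc A' v, folded c_def, folded t_def]
    have tp: "t < p" by (rule mk(1))
    have wp: "w < p" "q < p" using arrangedD[OF A'] tp v by (auto simp: w_def q_def)
    have cp: "c < p" unfolding c_def using color_less[OF vc v(1)] .
    have k: "k < p" "reg s' rK = k" "reg s' rI = i" using e I by (auto simp: entries_def I_def)
    have ip: "i < p" using i entries_length[OF e] by simp
    have kp: "k * p < W" using bucket_index[OF k(1) ip] p_less_W by linarith
    have ki: "k * p + i < W" using bucket_index[OF k(1) ip] p_less_W by linarith
    have be: "arr s' BUCK (k * p + i) = v" using e i by (simp add: entries_def v_def)
    have rd: "arr s' COL v = c" "arr s' SZ c = card (cell p col c)" "arr s' MARK c = card (cell p col c \<inter> M)"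
      using I COL SZ v by (auto simp: I_def c_def M_def)
    have cb: "c + card (cell p col c) \<le> p" unfolding c_def using color_bound[OF vc v(1)] .
    have cm: "card (cell p col c \<inter> M) < p"
    proof -
      have "v \<in> cell p col c - M" using v by (simp add: in_cell_iff c_def)
      then have "card (cell p col c - M) > 0" by (auto simp: card_gt_0_iff)
      then have "card (cell p col c \<inter> M) < card (cell p col c)"
        using card_cell_split[of p col c M] by linarith
      then show ?thesis using cb by linarith
    qed
    have "wpl W mark_body (\<lambda>s''. input s'' \<and> reg s'' rI = Suc i \<and>
        arr s'' EL = (arr s' EL)(q := w, t := v) \<and> arr s'' POS = (arr s' POS)(w := q, v := t) \<and>
        arr s'' MARK = (arr s' MARK)(c := card (cell p col c \<inter> M) + 1) \<and> arr s'' CNT = (arr s' CNT)(v := 0) \<and>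
        keeps_arrays_but {POS, EL, MARK, CNT} s' s'' \<and>
        keeps_regs_but scratch s' s'') s'"
      (is "wpl W _ ?Q _")
      unfolding mark_body_def bucket_entry_def
      using s' k be rd tp wp cp v(1) ki kp cb cm p_less_W ip bucket_index[OF k(1) ip]
        t_def[symmetric] w_def[symmetric] q_def[symmetric]
      by (simp add: inputD addressable_pp addressable_p less_p_less_W scratch_def)
    then have "runs W mark_body s' 200 ?Q"
      by (rule runs_straight) (simp add: mark_body_def bucket_entry_def)
    then show "runs W mark_body s' 200 (I (Suc i))"
    proof (rule runs_weaken[OF _ order_refl], elim conjE)
      fix s'' assume h: "input s''" "reg s'' rI = Suc i" "arr s'' EL = (arr s' EL)(q := w, t := v)"
        "arr s'' POS = (arr s' POS)(w := q, v := t)"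
        "arr s'' MARK = (arr s' MARK)(c := card (cell p col c \<inter> M) + 1)" "arr s'' CNT = (arr s' CNT)(v := 0)"
        "keeps_arrays_but {POS, EL, MARK, CNT} s' s''"
        "keeps_regs_but scratch s' s''"
      have "arranged p col (insert v M) (arr s'' POS) (arr s'' EL)"
        unfolding h(3,4) w_def q_def by (rule mk(2))
      moreover have "card (cell p col b \<inter> insert v M) = (if b = c then card (cell p col c \<inter> M) + 1 else card (cell p col b \<inter> M))" for b
      proof (cases "b = c")
        case True
        then have "cell p col b \<inter> insert v M = insert v (cell p col c \<inter> M)"
          using v by (auto simp: in_cell_iff c_def)
        then show ?thesis using True v by simp
      next
        case False
        then have "cell p col b \<inter> insert v M = cell p col b \<inter> M" by (auto simp: in_cell_iff c_def)
        then show ?thesis using False by simp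
      qed
      ultimately show "I (Suc i) s''"
        using I h unfolding I_def set_take_Suc[OF i] v_def[symmetric] M_def[symmetric]
        by auto
    qed
  qed
  then show ?thesis by (rule runs_weaken) (auto simp: I_def)
qed

lemma recolor_correct:
  assumes s: "input s" "entries s k Ms"
    and vc: "valid_coloring p col"
    and COL: "\<And>v. v < p \<Longrightarrow> arr s COL v = col v" and SZ: "\<And>b. arr s SZ b = card (cell p col b)"
    and MARK: "\<And>b. arr s MARK b = card (cell p col b \<inter> set Ms)"
  shows "runs W (each_entry recolor_body) s (104 * length Ms + 6) (\<lambda>s'. input s' \<and>
    (\<forall>v<p. arr s' COL v = split_col p (set Ms) col v) \<and> (\<forall>v\<in>set Ms. arr s' OLD v = col v) \<and>
    keeps_arrays_but {COL, OLD} s s' \<and> keeps_regs_but scratch s s')"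
proof -
  define I where "I = (\<lambda>i s'. input s' \<and> reg s' rI = i \<and>
    (\<forall>v<p. arr s' COL v = (if v \<in> set (take i Ms) then split_col p (set Ms) col v else col v)) \<and>
    (\<forall>v\<in>set (take i Ms). arr s' OLD v = col v) \<and>
    keeps_arrays_but {COL, OLD} s s' \<and> keeps_regs_but scratch s s')"
  have "runs W (each_entry recolor_body) s ((\<Sum>i<length Ms. 100) + 4 * length Ms + 6) (I (length Ms))"
  proof (rule each_entry_runs[where k = k])
    show "I 0 (set_reg s rI 0)"
      using s(1) COL by (simp add: I_def scratch_def)
    show "entries s k Ms" by fact
  next
    fix i s' assume "I i s'"
    then show "input s' \<and> entries s' k Ms \<and> reg s' rI = i"
      using s(2) by (simp add: I_def entries_def scratch_def)
  next
    fix i s' assume I: "I i s'" and i: "i < length Ms"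
    define v where "v = Ms ! i"
    define c where "c = col v"
    have e: "entries s' k Ms" and s': "input s'" using I s(2) by (auto simp: I_def entries_def scratch_def)
    have v: "v < p" "v \<notin> set (take i Ms)" "v \<in> set Ms"
      using i s(2) nth_notin_take[of Ms i] by (auto simp: v_def entries_def subset_iff)
    have cp: "c < p" unfolding c_def using color_less[OF vc v(1)] .
    have k: "k < p" "reg s' rK = k" "reg s' rI = i" using e I by (auto simp: entries_def I_def)
    have ip: "i < p" using i entries_length[OF e] by simp
    have kp: "k * p < W" "k * p + i < W" using bucket_index[OF k(1) ip] p_less_W by linarith+
    have be: "arr s' BUCK (k * p + i) = v" using e i by (simp add: entries_def v_def)
    have rd: "arr s' COL v = c" "arr s' SZ c = card (cell p col c)" "arr s' MARK c = card (cell p col c \<inter> set Ms)"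
      using I SZ MARK v by (auto simp: I_def c_def)
    have sp: "split_col p (set Ms) col v = c + card (cell p col c - set Ms)"
      using v by (simp add: split_col_def new_color_def c_def)
    have cb: "c + card (cell p col c) \<le> p" unfolding c_def using color_bound[OF vc v(1)] .
    have cs: "card (cell p col c) = card (cell p col c - set Ms) + card (cell p col c \<inter> set Ms)"
      by (rule card_cell_split)
    have "wpl W recolor_body (\<lambda>s''. input s'' \<and> reg s'' rI = Suc i \<and>
        arr s'' COL = (arr s' COL)(v := split_col p (set Ms) col v) \<and> arr s'' OLD = (arr s' OLD)(v := c) \<and>
        keeps_arrays_but {COL, OLD} s' s'' \<and>
        keeps_regs_but scratch s' s'') s'"
      (is "wpl W _ ?Q _")
      unfolding recolor_body_def bucket_entry_def
      using s' k be rd cp v(1) kp cb cs sp p_less_W ip bucket_index[OF k(1) ip]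
      by (simp add: inputD addressable_pp addressable_p less_p_less_W scratch_def)
    then have "runs W recolor_body s' 100 ?Q"
      by (rule runs_straight) (simp add: recolor_body_def bucket_entry_def)
    then show "runs W recolor_body s' 100 (I (Suc i))"
    proof (rule runs_weaken[OF _ order_refl], elim conjE)
      fix s'' assume h: "input s''" "reg s'' rI = Suc i"
        "arr s'' COL = (arr s' COL)(v := split_col p (set Ms) col v)" "arr s'' OLD = (arr s' OLD)(v := c)"
        "keeps_arrays_but {COL, OLD} s' s''"
        "keeps_regs_but scratch s' s''"
      show "I (Suc i) s''"
        using I h unfolding I_def set_take_Suc[OF i] v_def[symmetric] by (auto simp: c_def)
    qed
  qed
  then show ?thesis
    by (rule runs_weaken) (auto simp: I_def split_col_def)
qed

lemma sum_telescope_le: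
  fixes g :: "nat \<Rightarrow> nat"
  assumes "\<And>i. g i \<le> g (Suc i)"
  shows "(\<Sum>i<n. g (Suc i) - g i) = g n - g 0"
proof (induction n)
  case (Suc n)
  have "g 0 \<le> g n" using assms by (rule lift_Suc_mono_le) simp
  then show ?case using Suc assms[of n] by simp
qed simp

text \<open>
  Each member costs constant time, and each split cell one update of the tree, charged to its
  first member.
\<close>

lemma requeue_correct:
  assumes s: "input s" "entries s k Ms"
    and v: "valid p (col, V)"
    and COL: "\<And>v. v < p \<Longrightarrow> arr s COL v = split_col p (set Ms) col v"
    and OLD: "\<And>v. v \<in> set Ms \<Longrightarrow> arr s OLD v = col v"
    and SZ: "\<And>b. arr s SZ b = card (cell p col b)"
    and MARK: "\<And>b. arr s MARK b = card (cell p col b \<inter> set Ms)"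
    and tree: "tree_of s V"
  shows "runs W (each_entry requeue_body) s
    (204 * length Ms + 6 + (30 * D + 30) * card (split_cells p (set Ms) col)) (\<lambda>s'. input s' \<and>
    tree_of s' (split_queue p (set Ms) col V) \<and> (\<forall>b. arr s' SZ b = card (cell p (split_col p (set Ms) col) b)) \<and>
    (\<forall>b. arr s' MARK b = 0) \<and>
    keeps_arrays_but {SZ, MARK, TREE} s s' \<and> keeps_regs_but scratch s s')"
proof -
  define M where "M = set Ms"
  define Sp where "Sp = split_cells p M col"
  \<comment> \<open>The old colors whose cells have been treated by the first \<open>i\<close> entries.\<close>
  define Dn where "Dn = (\<lambda>i. col ` set (take i Ms))"
  have vc: "valid_coloring p col" and V: "V \<subseteq> colors p col" using v by (auto simp: valid_def)
  have Mp: "M \<subseteq> {..<p}" using s(2) by (simp add: entries_def M_def)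
  have finSp: "finite Sp" unfolding Sp_def by (rule finite_split_cells[OF vc])
  have colsp: "colors p col \<subseteq> {..<p}" using color_less[OF vc] by (auto simp: colors_def)
  have newp: "new_color p M col b < p" if "b \<in> Sp" for b
  proof -
    have "b \<in> colors p col" using that split_cells_subset[OF vc, where M = M] by (auto simp: Sp_def)
    then have "b + card (cell p col b) \<le> p" using color_bound[OF vc] by (auto simp: colors_def)
    then show ?thesis using new_color_bounds(2)[OF vc that[unfolded Sp_def]] by linarith
  qed
  define Vi where "Vi = (\<lambda>i. V \<union> smaller_part p M col V ` (Sp \<inter> Dn i))"
  have Vip: "Vi i \<subseteq> {..<p}" for i
    using V colsp newp split_cells_subset[OF vc, where M = M]
    unfolding Vi_def smaller_part_def Sp_def by (auto split: if_splits)
  \<comment> \<open>The contents of the size array after \<open>i\<close> entries: sizes of treated split cells and of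
    their new cells are up to date, the other ones are old.\<close>
  define szf where "szf = (\<lambda>i b. if b \<in> Sp \<inter> Dn i then card (cell p col b - M)
    else if b \<in> new_color p M col ` (Sp \<inter> Dn i) then card (cell p col (inv_into Sp (new_color p M col) b) \<inter> M)
    else card (cell p col b))"
  define I where "I = (\<lambda>i s'. input s' \<and> reg s' rI = i \<and>
    tree_of s' (Vi i) \<and> (\<forall>b. arr s' SZ b = szf i b) \<and>
    (\<forall>b. arr s' MARK b = (if b \<in> Dn i then 0 else card (cell p col b \<inter> M))) \<and>
    keeps_arrays_but {SZ, MARK, TREE} s s' \<and> keeps_regs_but scratch s s')"
  \<comment> \<open>The number of split cells treated so far; its increments are 0 or 1 and sum up to the
    number of split cells.\<close>
  define g where "g = (\<lambda>i. card (Sp \<inter> Dn i))"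
  have g_mono: "g i \<le> g (Suc i)" for i
  proof -
    have "set (take i Ms) \<subseteq> set (take (Suc i) Ms)" by (rule set_take_subset_set_take) simp
    then have "Dn i \<subseteq> Dn (Suc i)" unfolding Dn_def by (rule image_mono)
    then show ?thesis unfolding g_def using finSp by (intro card_mono) auto
  qed
  have "runs W (each_entry requeue_body) s
      ((\<Sum>i<length Ms. 200 + (30 * D + 30) * (g (Suc i) - g i)) + 4 * length Ms + 6) (I (length Ms))"
  proof (rule each_entry_runs[where k = k])
    show "I 0 (set_reg s rI 0)"
      using s(1) SZ MARK tree by (simp add: I_def scratch_def Dn_def szf_def Vi_def M_def tree_of_def)
    show "entries s k Ms" by fact
  next
    fix i s' assume "I i s'"
    then show "input s' \<and> entries s' k Ms \<and> reg s' rI = i"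
      using s(2) by (simp add: I_def entries_def scratch_def)
  next
    fix i s' assume I: "I i s'" and i: "i < length Ms"
    define v where "v = Ms ! i"
    define c where "c = col v"
    define b where "b = split_col p M col v"
    define m where "m = (if c \<in> Dn i then 0 else card (cell p col c \<inter> M))"
    have e: "entries s' k Ms" and s': "input s'" using I s(2) by (auto simp: I_def entries_def scratch_def)
    have v: "v < p" "v \<in> M"
      using i s(2) by (auto simp: v_def M_def entries_def subset_iff)
    have cp: "c < p" unfolding c_def using color_less[OF vc v(1)] .
    have k: "k < p" "reg s' rK = k" "reg s' rI = i" using e I by (auto simp: entries_def I_def)
    have ip: "i < p" using i entries_length[OF e] by simp
    have kp: "k * p < W" "k * p + i < W" using bucket_index[OF k(1) ip] p_less_W by linarith+
    have be: "arr s' BUCK (k * p + i) = v" using e i by (simp add: entries_def v_def)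
    have cs: "card (cell p col c) = card (cell p col c - M) + card (cell p col c \<inter> M)"
      by (rule card_cell_split)
    have cb: "c + card (cell p col c) \<le> p" unfolding c_def using color_bound[OF vc v(1)] .
    have bc: "b = new_color p M col c" using v by (simp add: b_def c_def split_col_def)
    have bp: "b < p" unfolding b_def using color_less[OF valid_split_col[OF vc] v(1)] .
    have Mpos: "0 < card (cell p col c \<inter> M)" using v by (auto simp: card_gt_0_iff in_cell_iff c_def)
    have SpD: "c \<in> Sp \<longleftrightarrow> 0 < card (cell p col c - M)"
      using Mpos by (auto simp: Sp_def split_cells_def card_gt_0_iff)
    have DnS: "Dn (Suc i) = insert c (Dn i)" unfolding Dn_def set_take_Suc[OF i] by (simp add: v_def c_def)
    have szc: "c \<notin> Dn i \<Longrightarrow> szf i c = card (cell p col c)"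
    proof -
      assume "c \<notin> Dn i"
      moreover have "c \<in> colors p col" using v by (auto simp: c_def colors_def)
      then have "c \<notin> new_color p M col ` (Sp \<inter> Dn i)" using new_color_fresh[OF vc] by (auto simp: Sp_def)
      ultimately show ?thesis by (simp add: szf_def)
    qed
    have rd: "arr s' OLD v = c" "arr s' SZ c = szf i c" "arr s' MARK c = m" "arr s' COL v = b"
      using I OLD[of v] COL[OF v(1)] v by (auto simp: I_def c_def m_def b_def M_def)
    have szf_le: "szf i c \<le> p"
    proof -
      have "card (cell p col x \<inter> M) \<le> p" "card (cell p col x - M) \<le> p" "card (cell p col x) \<le> p" for x
        using card_mono[of "{..<p}" "cell p col x \<inter> M"] card_mono[of "{..<p}" "cell p col x - M"]
          card_mono[of "{..<p}" "cell p col x"] by (auto simp: cell_def subset_iff)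
      then show ?thesis by (simp add: szf_def)
    qed
    have m_le: "m \<le> p" using cs cb by (simp add: m_def)
    let ?pre = "Assign rV bucket_entry ;; Assign rC (ld OLD (Reg rV)) ;; Assign rW (ld MARK (Reg rC)) ;;
      st MARK (Reg rC) (Const 0) ;; Assign rT (ld SZ (Reg rC) \<^bold>- Reg rW)"
    let ?cond = "And (Less (Const 0) (Reg rW)) (Less (Const 0) (Reg rT))"
    let ?upd = "Assign rQ (ld COL (Reg rV)) ;; st SZ (Reg rQ) (Reg rW) ;; st SZ (Reg rC) (Reg rT) ;;
         If (And (Not (Less (Const 0) (ld TREE (Reg 1 \<^bold>+ Reg rC)))) (Less (Reg rT) (Reg rW)))
           (Assign rJ (Reg 1 \<^bold>+ Reg rC)) (Assign rJ (Reg 1 \<^bold>+ Reg rQ))"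
    define P1 where "P1 = (\<lambda>s1. input s1 \<and> reg s1 rI = i \<and> reg s1 rV = v \<and> reg s1 rC = c \<and> reg s1 rW = m \<and>
      reg s1 rT = szf i c - m \<and> arr s1 MARK = (arr s' MARK)(c := 0) \<and>
      (\<forall>r<16. r \<noteq> MARK \<longrightarrow> arr s1 r = arr s' r) \<and> keeps_regs_but scratch s' s1)"
    have "wpl W ?pre P1 s'"
      unfolding bucket_entry_def P1_def
      using s' k be rd cp v(1) kp szf_le m_le p_less_W ip bucket_index[OF k(1) ip]
      by (simp add: inputD addressable_pp addressable_p less_p_less_W scratch_def)
    then have r1: "runs W ?pre s' 90 P1"
      by (rule runs_straight) (simp add: bucket_entry_def)
    have MARK': "(\<forall>b. ((arr s' MARK)(c := 0)) b = (if b \<in> Dn (Suc i) then 0 else card (cell p col b \<inter> M)))"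
      using I by (simp add: I_def DnS)
    define P2 where "P2 = (\<lambda>s1. input s1 \<and> reg s1 rI = i \<and>
        tree_of s1 (Vi (Suc i)) \<and> (\<forall>b. arr s1 SZ b = szf (Suc i) b) \<and>
        (\<forall>b. arr s1 MARK b = (if b \<in> Dn (Suc i) then 0 else card (cell p col b \<inter> M))) \<and>
        keeps_arrays_but {SZ, MARK, TREE} s s1 \<and> keeps_regs_but scratch s s1)"
    have r2: "runs W (If ?cond (?upd ;; climb Add) Skip) s1 (8 + (90 + (30 * D + 30) * (g (Suc i) - g i))) P2"
      if s1: "P1 s1" for s1
    proof -
      have ccost: "cond_cost ?cond + 1 = 8" by simp
      have "runs W (If ?cond (?upd ;; climb Add) Skip) s1 (cond_cost ?cond + 1 + (90 + (30 * D + 30) * (g (Suc i) - g i))) P2"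
      proof (rule runs_If)
        have "m < W" "szf i c - m < W" using m_le szf_le less_p_less_W(2) by auto
        then show "cond_fits W s1 ?cond" using s1 p_less_W by (simp add: P1_def)
      next
        assume "cond_val s1 ?cond"
        then have m0: "0 < m" "0 < szf i c - m" using s1 by (auto simp: P1_def)
        then have cD: "c \<notin> Dn i" by (auto simp: m_def split: if_splits)
        have szm: "szf i c - m = card (cell p col c - M)" "m = card (cell p col c \<inter> M)"
          using szc[OF cD] cD cs by (auto simp: m_def)
        have cSp: "c \<in> Sp" using m0(2) SpD szm by simp
        have SpDn: "Sp \<inter> Dn (Suc i) = insert c (Sp \<inter> Dn i)" unfolding DnS using cSp by blast
        have gS: "g (Suc i) - g i = 1"
          unfolding g_def SpDn using cD finSp by simp
        have fresh: "b \<notin> colors p col" unfolding bc using new_color_fresh[OF vc] cSp by (simp add: Sp_def)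
        have binj: "b \<notin> new_color p M col ` (Sp \<inter> Dn i)"
          using inj_on_new_color[OF vc, where M = M] cSp cD unfolding bc Sp_def inj_on_def by blast
        have cnotnew: "c \<notin> new_color p M col ` Sp" using new_color_fresh[OF vc] split_cells_subset[OF vc, where M = M] cSp
          by (auto simp: Sp_def)
        have cVi: "c \<in> Vi i \<longleftrightarrow> c \<in> V"
          using cD cnotnew by (auto simp: Vi_def smaller_part_def split: if_splits)
        have bVi: "b \<notin> Vi i"
        proof
          assume "b \<in> Vi i"
          then obtain c' where c': "c' \<in> Sp \<inter> Dn i" "b = smaller_part p M col V c'"
            using V fresh by (auto simp: Vi_def)
          have "c' \<in> colors p col" using c' split_cells_subset[OF vc, where M = M] by (auto simp: Sp_def)
          then show False using c' fresh binj by (auto simp: smaller_part_def split: if_splits)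
        qed
        define a where "a = (if c \<notin> V \<and> card (cell p col c - M) < card (cell p col c \<inter> M) then c else b)"
        have asm: "a = smaller_part p M col V c"
          unfolding a_def smaller_part_def bc by auto
        have aV: "a \<notin> Vi i" using cVi bVi by (simp add: a_def)
        have ap: "a < p" using cp bp by (simp add: a_def)
        have ViS: "Vi (Suc i) = insert a (Vi i)" unfolding Vi_def SpDn asm by auto
        have "arr s' TREE (p + c) = tree_count p (Vi i) (p + c)" using I p by (simp add: I_def tree_of_def)
        also have "\<dots> = (if c \<in> V then 1 else 0)" using p cVi by (simp add: tree_count_leaf)
        finally have tr: "arr s' TREE (p + c) = (if c \<in> V then 1 else 0)" .
        define P3 where "P3 = (\<lambda>s2. input s2 \<and> reg s2 rI = i \<and> reg s2 rJ = p + a \<and>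
          arr s2 SZ = (arr s' SZ)(b := m, c := card (cell p col c - M)) \<and> arr s2 MARK = (arr s' MARK)(c := 0) \<and>
          keeps_arrays_but {SZ, MARK} s' s2 \<and> keeps_regs_but scratch s' s2)"
        have s1r: "input s1" "reg s1 rI = i" "reg s1 rV = v" "reg s1 rC = c" "reg s1 rW = m"
          "reg s1 rT = card (cell p col c - M)" "arr s1 MARK = (arr s' MARK)(c := 0)"
          "\<forall>r<16. r \<noteq> MARK \<longrightarrow> arr s1 r = arr s' r" "keeps_regs_but scratch s' s1"
          using s1 szm by (auto simp: P1_def)
        have ma: "arr s1 0 v = b" "arr s1 6 (p + c) = (if c \<in> V then 1 else 0)" "arr s1 3 = arr s' 3"
          using s1r(8) rd(4) tr by auto
        have "m < W" "card (cell p col c - M) < W" "p + c < W" "p + b < W" "p + c < 2 * p"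
          using m_le cs cb cp bp p_less_W by auto
        then have "wpl W ?upd P3 s1"
          unfolding P3_def
          using s1r ma cp bp v(1) p_less_W szm(2)
          by (simp add: inputD addressable_p less_p_less_W scratch_def a_def)
        then have r3: "runs W ?upd s1 90 P3"
          by (rule runs_straight) simp
        have r4: "runs W (climb Add) s2 (30 * D + 30) P2" if s2: "P3 s2" for s2
        proof -
          have "tree_of s2 (Vi i)" using s2 I by (simp add: P3_def I_def tree_of_def)
          then have "runs W (climb Add) s2 (30 * D + 30) (\<lambda>s'. input s' \<and> tree_of s' (insert a (Vi i)) \<and>
            (\<forall>r<16. r \<noteq> TREE \<longrightarrow> arr s' r = arr s2 r) \<and> (\<forall>x. x \<noteq> rJ \<longrightarrow> reg s' x = reg s2 x))"
            using s2 ap aV Vip by (intro climb_tree[where b = a and V = "Vi i"]) (auto simp: P3_def)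
          then show ?thesis
          proof (rule runs_weaken[OF _ order_refl], elim conjE)
            fix s3 assume h: "input s3" "tree_of s3 (insert a (Vi i))"
              "\<forall>r<16. r \<noteq> TREE \<longrightarrow> arr s3 r = arr s2 r" "\<forall>x. x \<noteq> rJ \<longrightarrow> reg s3 x = reg s2 x"
            have sz: "arr s3 SZ = (arr s' SZ)(b := m, c := card (cell p col c - M))"
              and mk: "arr s3 MARK = (arr s' MARK)(c := 0)" using h s2 by (auto simp: P3_def)
            have ar: "arr s3 r = arr s r" if "r < 16" "r \<notin> {SZ, MARK, TREE}" for r
              using h(3) s2 I that by (auto simp: P3_def I_def)
            have rg: "reg s3 x = reg s x" if "x \<notin> scratch" for x
              using h(4) s2 I that by (auto simp: P3_def I_def scratch_def)
            have invb: "inv_into Sp (new_color p M col) b = c"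
              unfolding bc using inj_on_new_color[OF vc, where M = M] cSp by (simp add: Sp_def)
            have bSp: "b \<notin> Sp" using fresh split_cells_subset[OF vc, where M = M] by (auto simp: Sp_def)
            have bne: "b \<noteq> c" using new_color_bounds(1)[OF vc, of c M] cSp bc by (simp add: Sp_def)
            have "arr s3 SZ x = szf (Suc i) x" for x
            proof -
              have old: "arr s' SZ x = szf i x" using I by (simp add: I_def)
              have img: "new_color p M col ` (insert c (Sp \<inter> Dn i)) = insert b (new_color p M col ` (Sp \<inter> Dn i))"
                by (simp add: bc)
              consider "x = c" | "x = b" | "x \<noteq> c" "x \<noteq> b" by blast
              then show ?thesis
              proof cases
                case 1
                then show ?thesis unfolding sz szf_def SpDn by simp
              next
                case 2
                then show ?thesis unfolding sz szf_def SpDn img using bne bSp invb szm(2) by simp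
              next
                case 3
                then show ?thesis unfolding sz szf_def SpDn img using old by (simp add: szf_def)
              qed
            qed
            then show "P2 s3"
              unfolding P2_def ViS mk using h(1,2) ar rg MARK' h(4) s2 by (simp add: P3_def)
          qed
        qed
        have "runs W (?upd ;; climb Add) s1 (90 + (30 * D + 30)) P2"
          using r3 r4 by (rule runs_Seq)
        then show "runs W (?upd ;; climb Add) s1 (90 + (30 * D + 30) * (g (Suc i) - g i)) P2"
          unfolding gS by simp
      next
        assume "\<not> cond_val s1 ?cond"
        then have m0: "m = 0 \<or> szf i c - m = 0" using s1 by (auto simp: P1_def)
        have "c \<in> Dn i \<or> c \<notin> Sp"
          using m0 Mpos szc cs SpD by (auto simp: m_def split: if_splits)
        then have "Sp \<inter> Dn (Suc i) = Sp \<inter> Dn i" unfolding DnS by auto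
        then have "Vi (Suc i) = Vi i" "szf (Suc i) = szf i" unfolding Vi_def szf_def by (simp_all only:)
        then have "P2 s1"
          using s1 I MARK' by (auto simp: P1_def P2_def I_def scratch_def tree_of_def)
        then show "runs W Skip s1 (90 + (30 * D + 30) * (g (Suc i) - g i)) P2"
          by (intro runs_straight) auto
      qed
      then show ?thesis unfolding ccost .
    qed
    have r5: "runs W (Assign rI (Reg rI \<^bold>+ Const 1)) s1 4 (I (Suc i))" if s1: "P2 s1" for s1
    proof -
      have "i + 1 < W" "i < W" using ip p_less_W by auto
      then have "wpl W (Assign rI (Reg rI \<^bold>+ Const 1)) (I (Suc i)) s1"
        using s1 p_less_W by (auto simp: P2_def I_def scratch_def tree_of_def)
      then show ?thesis by (rule runs_straight) simp
    qed
    have "runs W requeue_body s' (90 + ((8 + (90 + (30 * D + 30) * (g (Suc i) - g i))) + 4)) (I (Suc i))"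
      unfolding requeue_body_def
      by (rule runs_Seq[OF r1 runs_Seq[OF r2 r5]])
    then show "runs W requeue_body s' (200 + (30 * D + 30) * (g (Suc i) - g i)) (I (Suc i))"
      by (rule runs_weaken) auto
  qed
  moreover have "(\<Sum>i<length Ms. 200 + (30 * D + 30) * (g (Suc i) - g i)) =
    200 * length Ms + (30 * D + 30) * (g (length Ms) - g 0)"
    by (simp add: sum.distrib sum_distrib_left[symmetric] sum_telescope_le[of g, OF g_mono])
  moreover have DnL: "Sp \<inter> Dn (length Ms) = Sp"
  proof -
    have "Sp \<subseteq> col ` M"
    proof
      fix b assume "b \<in> Sp"
      then obtain u where "u \<in> cell p col b \<inter> M" by (auto simp: Sp_def split_cells_def)
      then show "b \<in> col ` M" by (intro image_eqI[of _ _ u]) (auto simp: in_cell_iff)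
    qed
    then show ?thesis by (auto simp: Dn_def M_def)
  qed
  moreover have "g 0 = 0" by (simp add: g_def Dn_def)
  ultimately have "runs W (each_entry requeue_body) s
      (200 * length Ms + (30 * D + 30) * card Sp + 4 * length Ms + 6) (I (length Ms))"
    by (simp add: g_def)
  then show ?thesis
  proof (rule runs_weaken)
    fix s' assume I: "I (length Ms) s'"
    have "Vi (length Ms) = split_queue p M col V" unfolding Vi_def DnL split_queue_def Sp_def[symmetric] ..
    moreover have "szf (length Ms) b = card (cell p (split_col p M col) b)" for b
    proof -
      consider "b \<in> Sp" | c where "c \<in> Sp" "b = new_color p M col c"
        | "b \<notin> Sp" "b \<notin> new_color p M col ` Sp" by blast
      then show ?thesis
      proof cases
        case 1
        then show ?thesis using cell_split_old(1)[OF vc, of b M] unfolding szf_def DnL by (simp add: Sp_def)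
      next
        case 2
        have "b \<notin> Sp" using 2 new_color_fresh[OF vc, of c M] split_cells_subset[OF vc, where M = M] by (auto simp: Sp_def)
        moreover have "inv_into Sp (new_color p M col) b = c"
          unfolding 2 using inj_on_new_color[OF vc, where M = M] 2 by (simp add: Sp_def)
        ultimately show ?thesis
          using cell_split_old(2)[OF vc, of c M] 2 unfolding szf_def DnL by (simp add: Sp_def)
      next
        case 3
        have "cell p (split_col p M col) b = cell p col b"
        proof (cases "b \<in> colors p col")
          case True
          then show ?thesis using cell_unsplit[OF vc] 3 by (simp add: Sp_def)
        next
          case False
          then have "b \<notin> colors p (split_col p M col)" using 3 by (simp add: colors_split_col[OF vc] Sp_def)
          then show ?thesis using False by (auto simp: colors_def in_cell_iff)
        qed
        then show ?thesis using 3 unfolding szf_def DnL by simp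
      qed
    qed
    moreover have "(if b \<in> Dn (length Ms) then 0 else card (cell p col b \<inter> M)) = 0" for b
    proof -
      have "b \<notin> Dn (length Ms) \<Longrightarrow> cell p col b \<inter> M = {}"
      proof (rule ccontr)
        assume "b \<notin> Dn (length Ms)" "cell p col b \<inter> M \<noteq> {}"
        then obtain u where "u \<in> cell p col b \<inter> M" by blast
        then have "u \<in> M" "col u = b" by (auto simp: in_cell_iff)
        then show False using \<open>b \<notin> Dn (length Ms)\<close> by (auto simp: Dn_def M_def)
      qed
      then show ?thesis by simp
    qed
    ultimately show "input s' \<and>
      tree_of s' (split_queue p (set Ms) col V) \<and> (\<forall>b. arr s' SZ b = card (cell p (split_col p (set Ms) col) b)) \<and>
      (\<forall>b. arr s' MARK b = 0) \<and>
      keeps_arrays_but {SZ, MARK, TREE} s s' \<and> keeps_regs_but scratch s s'"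
      using I unfolding I_def M_def by simp
  qed (simp add: Sp_def M_def)
qed

end

section \<open>Splitting by all layers and the refinement loop\<close>

text \<open>
  Layers form a decreasing chain, so the loop may stop at the first empty one. It leaves the
  buckets and hit counters cleared.
\<close>

definition layers :: prog where
  "layers = Assign rK (Const 0) ;;
     While (Less (Const 0) (ld BLEN (Reg rK)))
       (Assign rN (ld BLEN (Reg rK)) ;;
        each_entry mark_body ;;
        each_entry recolor_body ;;
        each_entry requeue_body ;;
        (st BLEN (Reg rK) (Const 0) ;; Assign rK (Reg rK \<^bold>+ Const 1)))"

text \<open>
  The \<open>k + 1\<close>-st arc into a vertex puts it into layer \<open>k\<close>. Thus the layers are built without
  sorting the hit counts.
\<close>

definition scan_arc :: prog where
  "scan_arc =
     Assign rV (Mem (Const 2 \<^bold>+ Reg rU \<^bold>* (Reg 2 \<^bold>+ Const 1) \<^bold>+ Reg rJ)) ;;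
     Assign rK (ld CNT (Reg rV)) ;;
     st BUCK (Reg rK \<^bold>* Reg 1 \<^bold>+ ld BLEN (Reg rK)) (Reg rV) ;;
     st BLEN (Reg rK) (ld BLEN (Reg rK) \<^bold>+ Const 1) ;;
     st CNT (Reg rV) (Reg rK \<^bold>+ Const 1) ;;
     Assign rJ (Reg rJ \<^bold>+ Const 1)"

definition scan :: prog where
  "scan = (Assign rI (Reg rX) ;; Assign rN (Reg rX \<^bold>+ ld SZ (Reg rX))) ;;
     While (Less (Reg rI) (Reg rN))
       ((Assign rU (ld EL (Reg rI)) ;; Assign rJ (Const 0)) ;;
        While (Less (Reg rJ) (Reg 2)) scan_arc ;;
        Assign rI (Reg rI \<^bold>+ Const 1))"

definition refine_loop :: prog where
  "refine_loop = While (Less (Const 0) (ld TREE (Const 1))) (pop ;; scan ;; layers)"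

definition individualize_prog :: prog where
  "individualize_prog = (st BUCK (Const 0) (Reg rX) ;; st BLEN (Const 0) (Const 1)) ;; layers ;; refine_loop"

text \<open>
  Individualizing a vertex is splitting by a single layer, which lets it share the program for
  layers.
\<close>

lemma split_layers_singleton:
  assumes "0 < p"
  shows "split_layers p (\<lambda>j. if j = 0 then M else {}) p r = split p M r"
    and "count_splits p (\<lambda>j. if j = 0 then M else {}) p r = card (split_cells p M (fst r))"
  using split_layers_empty_tail[of 1 "\<lambda>j. if j = 0 then M else {}" p p r] assms by auto

text \<open>
  The layers together have as many members as there are arcs out of the processed cell.
\<close>

lemma sum_card_levels:
  fixes h :: "nat \<Rightarrow> nat"
  assumes "\<And>v. v < p \<Longrightarrow> h v \<le> p"
  shows "(\<Sum>j<p. card {v. v < p \<and> j < h v}) = (\<Sum>v<p. h v)"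
proof -
  have "(\<Sum>j<p. card {v. v < p \<and> j < h v}) = (\<Sum>j<p. \<Sum>v<p. if j < h v then 1 else 0)"
    by (intro sum.cong refl) (simp add: sum.If_cases Int_def)
  also have "\<dots> = (\<Sum>v<p. \<Sum>j<p. if j < h v then 1 else 0)" by (rule sum.swap)
  also have "\<dots> = (\<Sum>v<p. h v)"
  proof (rule sum.cong)
    fix v assume "v \<in> {..<p}"
    then have "h v \<le> p" using assms by simp
    then have "{..<p} \<inter> {j. j < h v} = {..<h v}" by auto
    then show "(\<Sum>j<p. if j < h v then 1 else 0) = h v" by (simp add: sum.If_cases)
  qed simp
  finally show ?thesis .
qed

locale refinement_run = refinement_machine +
  assumes adj_length: "\<And>u. u < p \<Longrightarrow> length (adj ! u) = d"
    and adj_distinct: "\<And>u. u < p \<Longrightarrow> distinct (adj ! u)"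
    and adj_subset: "\<And>u. u < p \<Longrightarrow> set (adj ! u) \<subseteq> {..<p}"
begin

definition E :: "(nat \<times> nat) set" where "E = {(u, v). u < p \<and> v \<in> set (adj ! u)}"

text \<open>
  The arrays describe the state of the refinement. The order of the vertices inside their
  cells is left open; it depends on the order of the adjacency lists, but neither the colors
  nor the waiting set do.
\<close>

definition represents :: "state \<Rightarrow> refinement \<Rightarrow> bool" where
  "represents s r \<longleftrightarrow> input s \<and> (\<forall>v<p. arr s COL v = fst r v) \<and>
     (\<forall>b. arr s SZ b = card (cell p (fst r) b)) \<and> (\<forall>b. arr s MARK b = 0) \<and>
     arranged p (fst r) {} (arr s POS) (arr s EL) \<and> tree_of s (snd r)"

definition bucket :: "state \<Rightarrow> nat \<Rightarrow> nat set \<Rightarrow> bool" where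
  "bucket s j M \<longleftrightarrow> bij_betw (\<lambda>i. arr s BUCK (j * p + i)) {..<arr s BLEN j} M"

lemma bucket_card: "bucket s j M \<Longrightarrow> card M = arr s BLEN j"
  unfolding bucket_def using bij_betw_same_card by fastforce

lemma bucket_entries:
  assumes "bucket s k M" "M \<subseteq> {..<p}" "k < p" "reg s rK = k" "reg s rN = arr s BLEN k"
  shows "\<exists>Ms. entries s k Ms \<and> set Ms = M \<and> length Ms = card M"
proof (intro exI conjI)
  let ?Ms = "map (\<lambda>i. arr s BUCK (k * p + i)) [0..<arr s BLEN k]"
  show M: "set ?Ms = M" using assms(1) by (auto simp: bucket_def bij_betw_def)
  show "length ?Ms = card M" using bucket_card[OF assms(1)] by simp
  have "distinct ?Ms" using assms(1) by (auto simp: bucket_def bij_betw_def distinct_map lessThan_atLeast0)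
  then show "entries s k ?Ms" using assms M by (simp add: entries_def)
qed

lemma layers_correct:
  assumes s: "represents s r" and v: "valid p r"
    and L: "\<And>j. bucket s j (L j)" "\<And>j. L j \<subseteq> {..<p}" "\<And>j. L (Suc j) \<subseteq> L j" "\<And>j. p \<le> j \<Longrightarrow> L j = {}"
  shows "runs W layers s (800 * (\<Sum>j<p. card (L j)) + (30 * D + 30) * count_splits p L p r + 20)
    (\<lambda>s'. represents s' (split_layers p L p r) \<and> (\<forall>j. arr s' BLEN j = 0) \<and>
      (\<forall>v. arr s' CNT v = (if v \<in> L 0 then 0 else arr s CNT v)))"
proof -
  define n where "n = (LEAST j. L j = {})"
  have Ln: "L n = {}" unfolding n_def by (rule LeastI[of _ p]) (simp add: L(4))
  have np: "n \<le> p" unfolding n_def by (rule Least_le) (simp add: L(4))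
  have Lne: "L j \<noteq> {}" if "j < n" for j using not_less_Least that unfolding n_def by blast
  have anti: "i \<le> j \<Longrightarrow> L j \<subseteq> L i" for i j using L(3) by (rule lift_Suc_antimono_le)
  have Lge: "L j = {}" if "n \<le> j" for j using anti[OF that] Ln by blast
  have tail: "split_layers p L p r = split_layers p L n r" "count_splits p L p r = count_splits p L n r"
    using split_layers_empty_tail[of n L p p r] Lge np by auto
  define sp where "sp = (\<lambda>i. card (split_cells p (L i) (fst (split_layers p L i r))))"
  define I where "I = (\<lambda>i s'. represents s' (split_layers p L i r) \<and> reg s' rK = i \<and>
    arr s' BUCK = arr s BUCK \<and> (\<forall>j. arr s' BLEN j = (if j < i then 0 else arr s BLEN j)) \<and>
    (\<forall>v. arr s' CNT v = (if \<exists>j<i. v \<in> L j then 0 else arr s CNT v)))"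
  let ?b = "Less (Const 0) (ld BLEN (Reg rK))"
  let ?body = "Assign rN (ld BLEN (Reg rK)) ;; each_entry mark_body ;; each_entry recolor_body ;;
        each_entry requeue_body ;; (st BLEN (Reg rK) (Const 0) ;; Assign rK (Reg rK \<^bold>+ Const 1))"
  have BL: "arr s BLEN j = card (L j)" for j using bucket_card[OF L(1)] by simp
  have cardL: "card (L j) \<le> p" for j using card_mono[OF _ L(2), of j] by simp
  have first: "runs W (Assign rK (Const 0)) s 2 (I 0)"
    using s p_less_W by (intro runs_straight) (auto simp: I_def represents_def tree_of_def)
  have "runs W (While ?b ?body) s' ((\<Sum>i<n. 700 * card (L i) + (30 * D + 30) * sp i) + (n + 1) * (cond_cost ?b + 1)) (I n)"
    if "I 0 s'" for s'
  proof (rule runs_While_count)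
    show "I 0 s'" by fact
  next
    fix s' assume I: "I n s'"
    then show "cond_fits W s' ?b \<and> \<not> cond_val s' ?b"
      using np p p_less_W BL[of n] Ln by (simp add: I_def represents_def addressable_p less_p_less_W)
  next
    fix s0 i assume I: "I i s0" and i: "i < n"
    have ip: "i < p" using i np by simp
    obtain col V where ri: "split_layers p L i r = (col, V)" by (cases "split_layers p L i r")
    have vi: "valid p (col, V)" using valid_split_layers[OF v, of L i] ri by simp
    have vc: "valid_coloring p col" using vi by (simp add: valid_def)
    have s0: "input s0" "\<And>v. v < p \<Longrightarrow> arr s0 COL v = col v" "\<And>b. arr s0 SZ b = card (cell p col b)"
      "\<And>b. arr s0 MARK b = 0" "arranged p col {} (arr s0 POS) (arr s0 EL)" "tree_of s0 V"
      using I ri by (auto simp: I_def represents_def)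
    have bl: "arr s0 BLEN i = card (L i)" using I BL by (simp add: I_def)
    have Lpos: "0 < card (L i)" using Lne[OF i] L(2)[of i] by (auto simp: card_gt_0_iff dest: finite_subset)
    have cond: "cond_fits W s0 ?b \<and> cond_val s0 ?b"
      using I ip p_less_W bl Lpos cardL[of i] s0(1) by (simp add: I_def addressable_p less_p_less_W)
    define P0 where "P0 = (\<lambda>s1. s1 = set_reg s0 rN (card (L i)))"
    have r0: "runs W (Assign rN (ld BLEN (Reg rK))) s0 9 P0"
      using I ip s0(1) bl cardL[of i]
      by (intro runs_straight) (auto simp: I_def P0_def addressable_p less_p_less_W)
    let ?s1 = "set_reg s0 rN (card (L i))"
    have "bucket ?s1 i (L i)" using L(1)[of i] I by (simp add: bucket_def I_def)
    then obtain Ms where Ms: "entries ?s1 i Ms" "set Ms = L i" "length Ms = card (L i)"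
      using bucket_entries[of ?s1 i "L i"] L(2) ip I bl by (auto simp: I_def)
    define P1 where "P1 = (\<lambda>s'. input s' \<and>
      arranged p col (set Ms) (arr s' POS) (arr s' EL) \<and>
      (\<forall>b. arr s' MARK b = card (cell p col b \<inter> set Ms)) \<and>
      (\<forall>v. arr s' CNT v = (if v \<in> set Ms then 0 else arr ?s1 CNT v)) \<and>
      keeps_arrays_but {POS, EL, MARK, CNT} ?s1 s' \<and> keeps_regs_but scratch ?s1 s')"
    have r1: "runs W (each_entry mark_body) s1 (300 * length Ms + 6) P1" if "P0 s1" for s1
      using that unfolding P0_def P1_def
      by (simp only:) (rule mark_correct[OF _ Ms(1) vc], use s0 in auto)
    have entries_cong: "entries s' i Ms" if "keeps_regs_but scratch ?s1 s'" "arr s' BUCK = arr ?s1 BUCK" for s'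
      using Ms(1) that by (simp add: entries_def scratch_def)
    define P2 where "P2 = (\<lambda>s'. input s' \<and>
      arranged p col (set Ms) (arr s' POS) (arr s' EL) \<and>
      (\<forall>v. arr s' CNT v = (if v \<in> set Ms then 0 else arr ?s1 CNT v)) \<and>
      (\<forall>v<p. arr s' COL v = split_col p (set Ms) col v) \<and> (\<forall>v\<in>set Ms. arr s' OLD v = col v) \<and>
      (\<forall>b. arr s' MARK b = card (cell p col b \<inter> set Ms)) \<and>
      keeps_arrays_but {POS, EL, MARK, CNT, COL, OLD} ?s1 s' \<and> keeps_regs_but scratch ?s1 s')"
    have r2: "runs W (each_entry recolor_body) s2 (104 * length Ms + 6) P2" if s2: "P1 s2" for s2
    proof (rule runs_weaken[OF recolor_correct[OF _ entries_cong vc]])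
      show "input s2" "keeps_regs_but scratch ?s1 s2" "arr s2 BUCK = arr ?s1 BUCK"
        "\<And>v. v < p \<Longrightarrow> arr s2 COL v = col v" "\<And>b. arr s2 SZ b = card (cell p col b)"
        "\<And>b. arr s2 MARK b = card (cell p col b \<inter> set Ms)"
        using s2 s0 by (auto simp: P1_def)
    next
      fix s3 assume "input s3 \<and>
        (\<forall>v<p. arr s3 COL v = split_col p (set Ms) col v) \<and> (\<forall>v\<in>set Ms. arr s3 OLD v = col v) \<and>
        keeps_arrays_but {COL, OLD} s2 s3 \<and> keeps_regs_but scratch s2 s3"
      then show "P2 s3" using s2 by (auto simp: P1_def P2_def)
    qed simp
    define P3 where "P3 = (\<lambda>s'. input s' \<and>
      arranged p col (set Ms) (arr s' POS) (arr s' EL) \<and>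
      (\<forall>v. arr s' CNT v = (if v \<in> set Ms then 0 else arr ?s1 CNT v)) \<and>
      (\<forall>v<p. arr s' COL v = split_col p (set Ms) col v) \<and>
      tree_of s' (split_queue p (set Ms) col V) \<and> (\<forall>b. arr s' SZ b = card (cell p (split_col p (set Ms) col) b)) \<and>
      (\<forall>b. arr s' MARK b = 0) \<and> arr s' BUCK = arr s0 BUCK \<and> arr s' BLEN = arr s0 BLEN \<and> reg s' rK = i)"
    have r3: "runs W (each_entry requeue_body) s3
        (204 * length Ms + 6 + (30 * D + 30) * card (split_cells p (set Ms) col)) P3" if s3: "P2 s3" for s3
    proof (rule runs_weaken[OF requeue_correct[OF _ entries_cong vi]])
      show "input s3" "keeps_regs_but scratch ?s1 s3" "arr s3 BUCK = arr ?s1 BUCK"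
        "\<And>v. v < p \<Longrightarrow> arr s3 COL v = split_col p (set Ms) col v" "\<And>b. arr s3 SZ b = card (cell p col b)"
        "\<And>v. v \<in> set Ms \<Longrightarrow> arr s3 OLD v = col v"
        "\<And>b. arr s3 MARK b = card (cell p col b \<inter> set Ms)" "tree_of s3 V"
        using s3 s0 by (auto simp: P2_def tree_of_def)
    next
      fix s4 assume "input s4 \<and>
        tree_of s4 (split_queue p (set Ms) col V) \<and> (\<forall>b. arr s4 SZ b = card (cell p (split_col p (set Ms) col) b)) \<and>
        (\<forall>b. arr s4 MARK b = 0) \<and>
        keeps_arrays_but {SZ, MARK, TREE} s3 s4 \<and> keeps_regs_but scratch s3 s4"
      then show "P3 s4" using s3 Ms(1) by (auto simp: P2_def P3_def scratch_def entries_def)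
    qed simp
    have r4: "runs W (st BLEN (Reg rK) (Const 0) ;; Assign rK (Reg rK \<^bold>+ Const 1)) s4 13 (I (Suc i))" if s4: "P3 s4" for s4
    proof -
      have rep: "represents (set_reg (set_arr s4 BLEN i 0) rK (Suc i)) (split_layers p L (Suc i) r)"
        using s4 arranged_split[OF vc, of "set Ms" "arr s4 POS" "arr s4 EL"] ri
        by (simp add: represents_def P3_def split_def Ms(2) tree_of_def)
      have "i + 1 < W" "i < W" using ip p_less_W by auto
      have "wpl W (st BLEN (Reg rK) (Const 0) ;; Assign rK (Reg rK \<^bold>+ Const 1)) (I (Suc i)) s4"
        using s4 ip rep p_less_W I Ms(2) \<open>i + 1 < W\<close> \<open>i < W\<close> unfolding I_def P3_def
        by (auto simp: addressable_p less_Suc_eq)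
      then show ?thesis by (rule runs_straight) simp
    qed
    have "runs W ?body s0 (9 + ((300 * length Ms + 6) + ((104 * length Ms + 6) +
        ((204 * length Ms + 6 + (30 * D + 30) * card (split_cells p (set Ms) col)) + 13)))) (I (Suc i))"
      by (rule runs_Seq[OF r0 runs_Seq[OF r1 runs_Seq[OF r2 runs_Seq[OF r3 r4]]]])
    then have "runs W ?body s0 (700 * card (L i) + (30 * D + 30) * sp i) (I (Suc i))"
      by (rule runs_weaken) (use Lpos in \<open>auto simp: Ms sp_def ri\<close>)
    with cond show "cond_fits W s0 ?b \<and> cond_val s0 ?b \<and> runs W ?body s0 (700 * card (L i) + (30 * D + 30) * sp i) (I (Suc i))"
      by blast
  qed
  then have "runs W layers s (2 + ((\<Sum>i<n. 700 * card (L i) + (30 * D + 30) * sp i) + (n + 1) * (cond_cost ?b + 1))) (I n)"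
    unfolding layers_def by (rule runs_Seq[OF first])
  then show ?thesis
  proof (rule runs_weaken)
    have sp_sum: "(\<Sum>i<n. sp i) = count_splits p L n r" for n by (induction n) (simp_all add: sp_def)
    have "(\<Sum>i<n. 1) \<le> (\<Sum>i<n. card (L i))"
    proof (rule sum_mono)
      fix i assume "i \<in> {..<n}"
      then show "1 \<le> card (L i)" using Lne[of i] L(2)[of i] by (auto simp: Suc_le_eq card_gt_0_iff dest: finite_subset)
    qed
    then have n_le: "n \<le> (\<Sum>i<n. card (L i))" by simp
    have "(\<Sum>i<n. card (L i)) \<le> (\<Sum>i<p. card (L i))" using np by (intro sum_mono2) auto
    then show "2 + ((\<Sum>i<n. 700 * card (L i) + (30 * D + 30) * sp i) + (n + 1) * (cond_cost ?b + 1))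
      \<le> 800 * (\<Sum>j<p. card (L j)) + (30 * D + 30) * count_splits p L p r + 20"
      using n_le by (simp add: sum.distrib sum_distrib_left[symmetric] sp_sum tail)
  next
    fix s' assume I: "I n s'"
    have "(\<exists>j<n. v \<in> L j) \<longleftrightarrow> v \<in> L 0" for v
      using anti[of 0] Ln by (metis empty_iff gr0I subsetD zero_le)
    then show "represents s' (split_layers p L p r) \<and> (\<forall>j. arr s' BLEN j = 0) \<and>
      (\<forall>v. arr s' CNT v = (if v \<in> L 0 then 0 else arr s CNT v))"
      using I BL Lge by (simp add: I_def tail)
  qed
qed

section \<open>Counting the arcs out of a cell\<close>

definition counted :: "state \<Rightarrow> (nat \<Rightarrow> nat) \<Rightarrow> bool" where
  "counted s h \<longleftrightarrow> (\<forall>v<p. arr s CNT v = h v) \<and> (\<forall>j. bucket s j {v. v < p \<and> j < h v})"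

lemma index_eq_iff:
  assumes "i < p" "i' < p"
  shows "j * p + i = j' * p + i' \<longleftrightarrow> j = j' \<and> i = (i' :: nat)"
proof
  assume eq: "j * p + i = j' * p + i'"
  have "j = (j * p + i) div p" using assms by simp
  also have "\<dots> = j'" unfolding eq using assms by simp
  finally show "j = j' \<and> i = i'" using eq by simp
qed simp

lemma scan_arc_correct:
  assumes s: "input s" and c: "counted s h" and u: "reg s rU = u" "u < p" "reg s rJ = j" "j < d"
    and h: "h (adj ! u ! j) < p"
  shows "runs W scan_arc s 100 (\<lambda>s'. input s' \<and>
    counted s' (h(adj ! u ! j := Suc (h (adj ! u ! j)))) \<and> reg s' rJ = Suc j \<and>
    keeps_arrays_but {CNT, BLEN, BUCK} s s' \<and> keeps_regs_but {rV, rK, rJ} s s')"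
proof -
  define v where "v = adj ! u ! j"
  define k where "k = h v"
  define n where "n = arr s BLEN k"
  have vp: "v < p" using adj_subset[OF u(2)] adj_length[OF u(2)] u(4) unfolding v_def by (metis lessThan_iff nth_mem subsetD)
  have kp: "k < p" using h by (simp add: k_def v_def)
  have bij: "bij_betw (\<lambda>i. arr s BUCK (j * p + i)) {..<arr s BLEN j} {v. v < p \<and> j < h v}" for j
    using c by (simp add: counted_def bucket_def)
  have len: "arr s BLEN j = card {v. v < p \<and> j < h v}" for j
    using bij_betw_same_card[OF bij[of j]] by simp
  have len_p: "arr s BLEN j \<le> p" for j
    unfolding len using card_mono[of "{..<p}" "{v. v < p \<and> j < h v}"] by auto
  have np: "n < p"
  proof -
    have "{w. w < p \<and> k < h w} \<subset> {..<p}" using vp by (auto simp: k_def)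
    then have "card {w. w < p \<and> k < h w} < card {..<p}" by (intro psubset_card_mono) auto
    then show ?thesis by (simp add: n_def len)
  qed
  have a: "2 + u * (d + 1) + j < base" using input_address_less u by simp
  have m: "mem s (2 + u * (d + 1) + j) = v" using s u by (simp add: input_def v_def)
  have cv: "arr s CNT v = k" using c vp by (simp add: counted_def k_def)
  have idx: "k * p + n < p * p" using kp np by (rule bucket_index)
  have small: "u * (d + 1) < W" "2 + u * (d + 1) < W" "2 + u * (d + 1) + j < W" "k * p < W" "k * p + n < W" "d + 1 < W" "d < W"
    "n + 1 < W" "k + 1 < W" "j + 1 < W" "j < W" "u < W" "n < W"
    using a idx p_less_W kp np u d by linarith+
  have "wpl W scan_arc (\<lambda>s'. input s' \<and> arr s' CNT = (arr s CNT)(v := Suc k) \<and>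
      arr s' BLEN = (arr s BLEN)(k := Suc n) \<and> arr s' BUCK = (arr s BUCK)(k * p + n := v) \<and> reg s' rJ = Suc j \<and>
      keeps_arrays_but {CNT, BLEN, BUCK} s s' \<and> keeps_regs_but {rV, rK, rJ} s s') s"
      (is "wpl W _ ?Q _")
    unfolding scan_arc_def
    using s u m vp kp np cv n_def[symmetric] idx small p_less_W
    by (simp add: inputD addressable_pp addressable_p less_p_less_W)
  then have "runs W scan_arc s 100 ?Q"
    by (rule runs_straight) (simp add: scan_arc_def)
  then show ?thesis
  proof (rule runs_weaken[OF _ order_refl], elim conjE)
    fix s' assume h': "input s'" "arr s' CNT = (arr s CNT)(v := Suc k)"
      "arr s' BLEN = (arr s BLEN)(k := Suc n)" "arr s' BUCK = (arr s BUCK)(k * p + n := v)" "reg s' rJ = Suc j"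
      "keeps_arrays_but {CNT, BLEN, BUCK} s s'" "keeps_regs_but {rV, rK, rJ} s s'"
    have "bucket s' j {w. w < p \<and> j < (h(v := Suc k)) w}" for j
    proof (cases "j = k")
      case False
      have "{w. w < p \<and> j < (h(v := Suc k)) w} = {w. w < p \<and> j < h w}" using False by (auto simp: k_def)
      moreover have "bij_betw (\<lambda>i. arr s' BUCK (j * p + i)) {..<arr s BLEN j} {w. w < p \<and> j < h w}"
      proof (rule iffD1[OF bij_betw_cong bij])
        fix i assume "i \<in> {..<arr s BLEN j}"
        then have "i < p" using len_p[of j] by simp
        then have "j * p + i \<noteq> k * p + n" using index_eq_iff[OF _ np] False by blast
        then show "arr s BUCK (j * p + i) = arr s' BUCK (j * p + i)" by (simp add: h'(4))
      qed
      ultimately show ?thesis using False by (simp add: bucket_def h'(3))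
    next
      case True
      have "{w. w < p \<and> k < (h(v := Suc k)) w} = insert v {w. w < p \<and> k < h w}" using vp by (auto simp: k_def)
      moreover have "bij_betw (\<lambda>i. arr s' BUCK (k * p + i)) (insert n {..<n}) (insert v {w. w < p \<and> k < h w})"
      proof -
        have "bij_betw (\<lambda>i. arr s' BUCK (k * p + i)) {..<n} {w. w < p \<and> k < h w}"
        proof (rule iffD1[OF bij_betw_cong bij[of k, folded n_def]])
          fix i assume "i \<in> {..<n}"
          then show "arr s BUCK (k * p + i) = arr s' BUCK (k * p + i)" by (simp add: h'(4))
        qed
        moreover have "arr s' BUCK (k * p + n) = v" by (simp add: h'(4))
        ultimately show ?thesis
          using notIn_Un_bij_betw[of n "{..<n}" "\<lambda>i. arr s' BUCK (k * p + i)" "{w. w < p \<and> k < h w}"]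
          by (simp add: k_def)
      qed
      ultimately show ?thesis using True by (simp add: bucket_def h'(3) lessThan_Suc)
    qed
    moreover have "\<forall>w<p. arr s' CNT w = (h(v := Suc k)) w" using c by (simp add: h'(2) counted_def)
    ultimately have "counted s' (h(v := Suc k))" by (simp add: counted_def)
    then show "input s' \<and> counted s' (h(adj ! u ! j := Suc (h (adj ! u ! j)))) \<and> reg s' rJ = Suc j \<and>
      keeps_arrays_but {CNT, BLEN, BUCK} s s' \<and> keeps_regs_but {rV, rK, rJ} s s'"
      using h' unfolding v_def k_def by blast
  qed
qed

text \<open>
  Distinct entries of an adjacency list let every hit counter grow by at most one per scanned
  vertex.
\<close>

lemma scan_vertex:
  assumes s: "input s" and c: "counted s (hits E A)" and u: "reg s rU = u" "u < p" "u \<notin> A" "A \<subseteq> {..<p}"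
    and J: "reg s rJ = 0"
  shows "runs W (While (Less (Reg rJ) (Reg 2)) scan_arc) s (104 * d + 4) (\<lambda>s'. input s' \<and>
    counted s' (hits E (insert u A)) \<and>
    keeps_arrays_but {CNT, BLEN, BUCK} s s' \<and> keeps_regs_but {rV, rK, rJ} s s')"
proof -
  let ?h = "\<lambda>j v. hits E A v + (if v \<in> set (take j (adj ! u)) then 1 else 0)"
  define I where "I = (\<lambda>j s'. input s' \<and> counted s' (?h j) \<and> reg s' rJ = j \<and>
    keeps_arrays_but {CNT, BLEN, BUCK} s s' \<and> keeps_regs_but {rV, rK, rJ} s s')"
  have "runs W (While (Less (Reg rJ) (Reg 2)) scan_arc) s
    ((\<Sum>j<d. 100) + (d + 1) * (cond_cost (Less (Reg rJ) (Reg 2)) + 1)) (I d)"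
  proof (rule runs_While_count)
    show "I 0 s" using s c J by (simp add: I_def)
  next
    fix s' assume "I d s'"
    then show "cond_fits W s' (Less (Reg rJ) (Reg 2)) \<and> \<not> cond_val s' (Less (Reg rJ) (Reg 2))"
      using d p_less_W by (simp add: I_def inputD)
  next
    fix s' j assume I: "I j s'" and j: "j < d"
    let ?v = "adj ! u ! j"
    have v: "?v \<notin> set (take j (adj ! u))"
      using nth_notin_take[OF adj_distinct[OF u(2)]] j adj_length[OF u(2)] by simp
    have "card A < p"
      using psubset_card_mono[of "{..<p}" A] u by auto
    moreover have "hits E A ?v \<le> card A"
      unfolding hits_def using u(4) by (intro card_mono) (auto dest: finite_subset)
    ultimately have "?h j ?v < p" using v by simp
    moreover have "reg s' rU = u" using I u by (simp add: I_def)
    ultimately have "runs W scan_arc s' 100 (\<lambda>s''. input s'' \<and>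
      counted s'' ((?h j)(?v := Suc (?h j ?v))) \<and> reg s'' rJ = Suc j \<and>
      keeps_arrays_but {CNT, BLEN, BUCK} s' s'' \<and> keeps_regs_but {rV, rK, rJ} s' s'')"
      using I u(2) j by (intro scan_arc_correct) (auto simp: I_def)
    then have "runs W scan_arc s' 100 (I (Suc j))"
    proof (rule runs_weaken[OF _ order_refl])
      fix s'' assume h: "input s'' \<and>
        counted s'' ((?h j)(?v := Suc (?h j ?v))) \<and> reg s'' rJ = Suc j \<and>
        keeps_arrays_but {CNT, BLEN, BUCK} s' s'' \<and> keeps_regs_but {rV, rK, rJ} s' s''"
      have "(?h j)(?v := Suc (?h j ?v)) = ?h (Suc j)"
        using v j adj_length[OF u(2)] by (auto simp: set_take_Suc)
      then show "I (Suc j) s''" using h I by (simp add: I_def)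
    qed
    then show "cond_fits W s' (Less (Reg rJ) (Reg 2)) \<and> cond_val s' (Less (Reg rJ) (Reg 2)) \<and>
      runs W scan_arc s' 100 (I (Suc j))"
      using I j d p_less_W by (simp add: I_def inputD)
  qed
  then show ?thesis
  proof (rule runs_weaken)
    fix s' assume I: "I d s'"
    have "?h d = hits E (insert u A)"
    proof
      fix v
      have "hits E (insert u A) v = hits E A v + hits E {u} v"
        using hits_Un[of A "{u}" E v] u finite_subset[of A "{..<p}"] by simp
      also have "hits E {u} v = (if v \<in> set (adj ! u) then 1 else 0)"
      proof -
        have "{w \<in> {u}. (w, v) \<in> E} = (if v \<in> set (adj ! u) then {u} else {})" using u(2) by (auto simp: E_def)
        then show ?thesis by (simp add: hits_def)
      qed
      finally show "?h d v = hits E (insert u A) v" using adj_length[OF u(2)] by simp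
    qed
    then show "input s' \<and> counted s' (hits E (insert u A)) \<and>
      keeps_arrays_but {CNT, BLEN, BUCK} s s' \<and> keeps_regs_but {rV, rK, rJ} s s'"
      using I by (simp add: I_def)
  qed simp
qed

lemma counted_zero: "(\<forall>v<p. arr s CNT v = 0) \<Longrightarrow> (\<forall>j. arr s BLEN j = 0) \<Longrightarrow> counted s (hits E {})"
  by (simp add: counted_def bucket_def bij_betw_def)

lemma scan_correct:
  assumes s: "input s" and c: "counted s (hits E {})"
    and vc: "valid_coloring p col" and A: "arranged p col {} (arr s POS) (arr s EL)"
    and SZ: "\<And>b. arr s SZ b = card (cell p col b)" and x: "reg s rX = x" "x \<in> colors p col"
  defines "X \<equiv> cell p col x"
  shows "runs W scan s (150 * d * card X + 30) (\<lambda>s'. input s' \<and> counted s' (hits E X) \<and>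
    keeps_arrays_but {CNT, BLEN, BUCK} s s')"
proof -
  define el where "el = arr s EL"
  define n where "n = card X"
  have bij: "bij_betw el {x..<x + n} X" and xn: "x + n \<le> p"
    using arranged_members[OF vc A x(2)] by (auto simp: el_def n_def X_def)
  have Xp: "X \<subseteq> {..<p}" by (auto simp: X_def in_cell_iff)
  define seen where "seen = (\<lambda>i. el ` {x..<x + i})"
  define I where "I = (\<lambda>i s'. input s' \<and> counted s' (hits E (seen i)) \<and> reg s' rI = x + i \<and> reg s' rN = x + n \<and>
    keeps_arrays_but {CNT, BLEN, BUCK} s s')"
  let ?b = "Less (Reg rI) (Reg rN)"
  let ?body = "(Assign rU (ld EL (Reg rI)) ;; Assign rJ (Const 0)) ;;
        While (Less (Reg rJ) (Reg 2)) scan_arc ;; Assign rI (Reg rI \<^bold>+ Const 1)"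
  have xp: "x < p" using x(2) color_less[OF vc] by (auto simp: colors_def)
  have "x + n < W" "x < W" using xn p_less_W by auto
  then have 1: "runs W (Assign rI (Reg rX) ;; Assign rN (Reg rX \<^bold>+ ld SZ (Reg rX))) s 14 (I 0)"
    using s c x xp xn SZ
    by (intro runs_straight) (auto simp: I_def seen_def addressable_p less_p_less_W n_def X_def counted_def bucket_def)
  have 2: "runs W (While ?b ?body) s' ((\<Sum>i<n. 104 * d + 40) + (n + 1) * (cond_cost ?b + 1)) (I n)" if "I 0 s'" for s'
  proof (rule runs_While_count)
    show "I 0 s'" by fact
  next
    fix s' assume "I n s'"
    then show "cond_fits W s' ?b \<and> \<not> cond_val s' ?b" using \<open>x + n < W\<close> by (simp add: I_def)
  next
    fix s' i assume I: "I i s'" and i: "i < n"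
    define u where "u = el (x + i)"
    have uX: "u \<in> X" using bij i by (auto simp: u_def bij_betw_def)
    then have up: "u < p" using Xp by auto
    have u_new: "u \<notin> seen i"
    proof
      assume "u \<in> seen i"
      then obtain l where l: "l \<in> {x..<x + i}" "el l = el (x + i)" by (auto simp: u_def seen_def)
      have "inj_on el {x..<x + n}" using bij by (simp add: bij_betw_def)
      from inj_onD[OF this l(2)] have "l = x + i" using l(1) i by auto
      then show False using l(1) by simp
    qed
    have seen_p: "seen i \<subseteq> {..<p}"
    proof -
      have "seen i \<subseteq> el ` {x..<x + n}" unfolding seen_def using i by (intro image_mono) auto
      also have "\<dots> = X" using bij by (simp add: bij_betw_def)
      finally show ?thesis using Xp by blast
    qed
    have seen_Suc: "seen (Suc i) = insert u (seen i)"
      by (auto simp: seen_def u_def less_Suc_eq)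
    have el': "arr s' EL (x + i) = u" using I by (simp add: I_def u_def el_def)
    have ip: "x + i < p" using i xn by linarith
    define P1 where "P1 = (\<lambda>s1. I i s1 \<and> reg s1 rU = u \<and> reg s1 rJ = 0)"
    have r1: "runs W (Assign rU (ld EL (Reg rI)) ;; Assign rJ (Const 0)) s' 12 P1"
      using I el' ip up p_less_W
      by (intro runs_straight) (auto simp: P1_def I_def addressable_p less_p_less_W counted_def bucket_def)
    define P2 where "P2 = (\<lambda>s1. input s1 \<and> counted s1 (hits E (seen (Suc i))) \<and> reg s1 rI = x + i \<and> reg s1 rN = x + n \<and>
      keeps_arrays_but {CNT, BLEN, BUCK} s s1)"
    have r2: "runs W (While (Less (Reg rJ) (Reg 2)) scan_arc) s1 (104 * d + 4) P2" if s1: "P1 s1" for s1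
    proof -
      have "runs W (While (Less (Reg rJ) (Reg 2)) scan_arc) s1 (104 * d + 4) (\<lambda>s'. input s' \<and>
        counted s' (hits E (insert u (seen i))) \<and>
        keeps_arrays_but {CNT, BLEN, BUCK} s1 s' \<and> keeps_regs_but {rV, rK, rJ} s1 s')"
        by (rule scan_vertex) (use s1 up u_new seen_p in \<open>auto simp: P1_def I_def\<close>)
      then show ?thesis by (rule runs_weaken) (use s1 in \<open>auto simp: P1_def P2_def I_def seen_Suc\<close>)
    qed
    have r3: "runs W (Assign rI (Reg rI \<^bold>+ Const 1)) s2 4 (I (Suc i))" if s2: "P2 s2" for s2
    proof -
      have "x + i + 1 < W" "x + i < W" using ip p_less_W by auto
      then show ?thesis using s2 p_less_W
        by (intro runs_straight) (auto simp: P2_def I_def counted_def bucket_def)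
    qed
    have "runs W ?body s' (12 + (104 * d + 4 + 4)) (I (Suc i))"
      by (rule runs_Seq[OF r1 runs_Seq[OF r2 r3]])
    then have "runs W ?body s' (104 * d + 40) (I (Suc i))" by (rule runs_weaken) auto
    then show "cond_fits W s' ?b \<and> cond_val s' ?b \<and> runs W ?body s' (104 * d + 40) (I (Suc i))"
      using I i ip \<open>x + n < W\<close> less_p_less_W(1)[OF ip] by (simp add: I_def)
  qed
  have "runs W scan s (14 + ((\<Sum>i<n. 104 * d + 40) + (n + 1) * (cond_cost ?b + 1))) (I n)"
    unfolding scan_def by (rule runs_Seq[OF 1 2])
  then show ?thesis
  proof (rule runs_weaken)
    have "1 * (n * 46) \<le> d * (n * 46)" using d by (intro mult_le_mono) auto
    then have "n * 44 \<le> 12 + d * (n * 46)" by linarith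
    then show "14 + ((\<Sum>i<n. 104 * d + 40) + (n + 1) * (cond_cost ?b + 1)) \<le> 150 * d * card X + 30"
      by (simp add: n_def[symmetric] algebra_simps)
  next
    fix s' assume "I n s'"
    moreover have "seen n = X" using bij by (simp add: seen_def bij_betw_def)
    ultimately show "input s' \<and> counted s' (hits E X) \<and>
      keeps_arrays_but {CNT, BLEN, BUCK} s s'" by (simp add: I_def)
  qed
qed

section \<open>Time of a refinement\<close>

text \<open>
  Between two steps the counters and buckets are clean, so that no time is spent on
  initializing them.
\<close>

definition ready :: "state \<Rightarrow> refinement \<Rightarrow> bool" where
  "ready s r \<longleftrightarrow> represents s r \<and> (\<forall>v<p. arr s CNT v = 0) \<and> (\<forall>j. arr s BLEN j = 0)"

lemma sum_hits: "X \<subseteq> {..<p} \<Longrightarrow> (\<Sum>v<p. hits E X v) = d * card X"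
proof -
  assume X: "X \<subseteq> {..<p}"
  then have fin: "finite X" using finite_subset by blast
  have "(\<Sum>v<p. hits E X v) = (\<Sum>v<p. \<Sum>u\<in>X. if (u, v) \<in> E then 1 else 0)"
    unfolding hits_def using fin by (intro sum.cong refl) (simp add: sum.If_cases Int_def)
  also have "\<dots> = (\<Sum>u\<in>X. \<Sum>v<p. if (u, v) \<in> E then 1 else 0)" by (rule sum.swap)
  also have "\<dots> = (\<Sum>u\<in>X. d)"
  proof (rule sum.cong)
    fix u assume "u \<in> X"
    then have u: "u < p" using X by auto
    have "{v. v < p \<and> (u, v) \<in> E} = set (adj ! u)" using u adj_subset[OF u] by (auto simp: E_def)
    then have "card {v. v < p \<and> (u, v) \<in> E} = d" using distinct_card[OF adj_distinct[OF u]] adj_length[OF u] by simp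
    then show "(\<Sum>v<p. if (u, v) \<in> E then 1 else 0) = d" by (simp add: sum.If_cases Int_def)
  qed simp
  finally show ?thesis by (simp add: mult.commute)
qed

text \<open>
  The scan and the passes over the layers take time proportional to the arcs out of the cell;
  in addition there is one tree update for the removed color and one for every split.
\<close>

lemma refine_step_correct:
  assumes s: "ready s r" and v: "valid p r" and ne: "snd r \<noteq> {}"
  defines "x \<equiv> select p (snd r)"
  defines "X \<equiv> cell p (fst r) x"
  shows "runs W (pop ;; scan ;; layers) s (950 * d * card X + (130 * D + 150) *
      Suc (count_splits p (layer p E X) p (fst r, snd r - {x}))) (\<lambda>s'. ready s' (refine_step p E r))"
proof -
  obtain col V where r: "r = (col, V)" by (cases r)
  have vc: "valid_coloring p col" and Vc: "V \<subseteq> colors p col" using v by (auto simp: valid_def r)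
  have Vp: "V \<subseteq> {..<p}" using valid_queue[OF v] by (simp add: r)
  have xV: "x \<in> V" unfolding x_def r using ne Vp by (simp add: r select_in)
  have xc: "x \<in> colors p col" using xV Vc by auto
  have v': "valid p (col, V - {x})" using v unfolding r by (rule valid_remove)
  have X: "X = cell p col x" by (simp add: X_def r)
  have Xp: "X \<subseteq> {..<p}" by (auto simp: X in_cell_iff)
  have s0: "input s" "\<And>v. v < p \<Longrightarrow> arr s COL v = col v" "\<And>b. arr s SZ b = card (cell p col b)"
    "\<And>b. arr s MARK b = 0" "arranged p col {} (arr s POS) (arr s EL)" "tree_of s V"
    "\<forall>v<p. arr s CNT v = 0" "\<forall>j. arr s BLEN j = 0"
    using s by (auto simp: ready_def represents_def r)
  define P1 where "P1 = (\<lambda>s'. input s' \<and> reg s' rX = x \<and> tree_of s' (V - {x}) \<and>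
    (\<forall>r<16. r \<noteq> TREE \<longrightarrow> arr s' r = arr s r))"
  have r1: "runs W pop s (100 * D + 100) P1"
    by (rule runs_weaken[OF pop_correct[OF s0(1,6) Vp]]) (use ne in \<open>auto simp: P1_def x_def r\<close>)
  define P2 where "P2 = (\<lambda>s'. represents s' (col, V - {x}) \<and> counted s' (hits E X))"
  have r2: "runs W scan s1 (150 * d * card X + 30) P2" if s1: "P1 s1" for s1
  proof -
    have "counted s1 (hits E {})" using s1 s0 by (intro counted_zero) (auto simp: P1_def)
    then have "runs W scan s1 (150 * d * card X + 30) (\<lambda>s'. input s' \<and> counted s' (hits E X) \<and>
      keeps_arrays_but {CNT, BLEN, BUCK} s1 s')"
      unfolding X using s1 s0 xc by (intro scan_correct[OF _ _ vc]) (auto simp: P1_def)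
    then show ?thesis
      by (rule runs_weaken) (use s1 s0 in \<open>auto simp: P1_def P2_def represents_def tree_of_def\<close>)
  qed
  let ?L = "layer p E X"
  have sumL: "(\<Sum>j<p. card (?L j)) = d * card X"
    unfolding layer_def using sum_card_levels[of p "hits E X"] hits_le[OF Xp] sum_hits[OF Xp] by simp
  have r3: "runs W layers s2 (800 * (d * card X) + (30 * D + 30) * count_splits p ?L p (col, V - {x}) + 20)
      (\<lambda>s'. ready s' (refine_step p E r))" if s2: "P2 s2" for s2
  proof -
    have "runs W layers s2 (800 * (\<Sum>j<p. card (?L j)) + (30 * D + 30) * count_splits p ?L p (col, V - {x}) + 20)
      (\<lambda>s'. represents s' (split_layers p ?L p (col, V - {x})) \<and> (\<forall>j. arr s' BLEN j = 0) \<and>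
        (\<forall>v. arr s' CNT v = (if v \<in> ?L 0 then 0 else arr s2 CNT v)))"
    proof (rule layers_correct[OF _ v'])
      show "represents s2 (col, V - {x})" using s2 by (simp add: P2_def)
      show "bucket s2 j (?L j)" for j using s2 by (simp add: P2_def counted_def layer_def)
      show "?L j \<subseteq> {..<p}" "?L (Suc j) \<subseteq> ?L j" for j by (auto simp: layer_def)
      show "?L j = {}" if "p \<le> j" for j using hits_le[OF Xp, of E] that by (auto simp: layer_def) (meson leD le_trans)
    qed
    then show ?thesis
      unfolding sumL
    proof (rule runs_weaken[OF _ order_refl])
      fix s' assume h: "represents s' (split_layers p ?L p (col, V - {x})) \<and> (\<forall>j. arr s' BLEN j = 0) \<and>
        (\<forall>v. arr s' CNT v = (if v \<in> ?L 0 then 0 else arr s2 CNT v))"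
      have "refine_step p E r = split_layers p ?L p (col, V - {x})"
        using ne by (simp add: refine_step_def r x_def X_def Let_def)
      moreover have "\<forall>v<p. arr s' CNT v = 0"
        using h s2 by (auto simp: P2_def counted_def layer_def)
      ultimately show "ready s' (refine_step p E r)" using h by (simp add: ready_def)
    qed
  qed
  have "runs W (pop ;; scan ;; layers) s (100 * D + 100 + (150 * d * card X + 30 +
      (800 * (d * card X) + (30 * D + 30) * count_splits p ?L p (col, V - {x}) + 20))) (\<lambda>s'. ready s' (refine_step p E r))"
    by (rule runs_Seq[OF r1 runs_Seq[OF r2 r3]])
  then show ?thesis by (rule runs_weaken) (auto simp: r algebra_simps)
qed

lemma potential_nonneg: "0 \<le> potential p r"
  unfolding potential_def
proof (intro sum_nonneg add_nonneg_nonneg)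
  fix v assume "v \<in> {..<p}"
  then have "1 \<le> card (cell p (fst r) (fst r v))"
    by (auto simp: Suc_le_eq card_gt_0_iff in_cell_iff)
  then show "0 \<le> log 2 (real (card (cell p (fst r) (fst r v))))" by simp
qed simp

text \<open>
  The telescoping sums of the two budgets bound the total time.
\<close>

lemma refine_loop_correct:
  assumes s: "ready s r" and v: "valid p r" "stable_up_to p E {} r" "split_budget p r \<le> 2 * p"
  shows "\<exists>T. real T \<le> 950 * real d * potential p r + real (130 * D + 180) * real (split_budget p r) + 20 \<and>
    runs W refine_loop s T (\<lambda>s'. ready s' (refine p E r))"
proof -
  let ?r = "\<lambda>i. (refine_step p E ^^ i) r"
  have inv: "valid p (?r i)" "stable_up_to p E {} (?r i)" for i
    using refine_steps_invariants[OF v(1,2), of i] by auto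
  have done2p: "snd (?r (2 * p)) = {}" using refine_correct(3)[OF v] by (simp add: refine_def)
  define n where "n = (LEAST i. snd (?r i) = {})"
  have rn: "snd (?r n) = {}" unfolding n_def using done2p by (rule LeastI)
  have n2p: "n \<le> 2 * p" unfolding n_def using done2p by (rule Least_le)
  have ne: "snd (?r i) \<noteq> {}" if "i < n" for i using not_less_Least that unfolding n_def by blast
  have refn: "refine p E r = ?r n"
  proof -
    have "?r (n + k) = ?r n" for k by (induction k) (simp_all add: refine_step_done rn)
    from this[of "2 * p - n"] n2p show ?thesis by (simp add: refine_def)
  qed
  define X where "X = (\<lambda>i. cell p (fst (?r i)) (select p (snd (?r i))))"
  define sp where "sp = (\<lambda>i. Suc (count_splits p (layer p E (X i)) p (fst (?r i), snd (?r i) - {select p (snd (?r i))})))"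
  define T where "T = (\<lambda>i. 950 * d * card (X i) + (130 * D + 150) * sp i)"
  let ?b = "Less (Const 0) (ld TREE (Const 1))"
  have "runs W refine_loop s ((\<Sum>i<n. T i) + (n + 1) * (cond_cost ?b + 1)) (\<lambda>s'. ready s' (?r n))"
    unfolding refine_loop_def
  proof (rule runs_While_count)
    show "ready s (?r 0)" using s by simp
  next
    fix s' i assume s': "ready s' (?r i)" and i: "i < n"
    have Vp: "snd (?r i) \<subseteq> {..<p}" using valid_queue[OF inv(1)] .
    have t: "arr s' TREE 1 = tree_count p (snd (?r i)) 1"
      using s' by (simp add: ready_def represents_def tree_of_def)
    have "0 < tree_count p (snd (?r i)) 1" "tree_count p (snd (?r i)) 1 < W"
      using tree_count_root_pos[OF Vp ne[OF i]] less_p_less_W(2)[OF tree_count_le_p[OF Vp]] by auto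
    then have "cond_fits W s' ?b \<and> cond_val s' ?b"
      using s' t p p_less_W by (simp add: ready_def represents_def addressable_p)
    moreover have "runs W (pop ;; scan ;; layers) s' (T i) (\<lambda>s'. ready s' (?r (Suc i)))"
      using refine_step_correct[OF s' inv(1) ne[OF i]] by (simp add: T_def X_def sp_def)
    ultimately show "cond_fits W s' ?b \<and> cond_val s' ?b \<and>
      runs W (pop ;; scan ;; layers) s' (T i) (\<lambda>s'. ready s' (?r (Suc i)))" by blast
  next
    fix s' assume s': "ready s' (?r n)"
    then have "arr s' TREE 1 = 0" by (simp add: ready_def represents_def tree_of_def rn)
    then show "cond_fits W s' ?b \<and> \<not> cond_val s' ?b"
      using s' p p_less_W by (simp add: ready_def represents_def addressable_p)
  qed
  moreover have "real ((\<Sum>i<n. T i) + (n + 1) * (cond_cost ?b + 1))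
    \<le> 950 * real d * potential p r + real (130 * D + 180) * real (split_budget p r) + 20"
  proof -
    have 1: "real (\<Sum>i<m. card (X i)) + potential p (?r m) \<le> potential p r" if "m \<le> n" for m
      using that
    proof (induction m)
      case (Suc m)
      then show ?case using refine_step_budgets(1)[OF inv(1) ne, of m E] by (simp add: X_def)
    qed simp
    have 2: "(\<Sum>i<m. sp i) + split_budget p (?r m) \<le> split_budget p r" if "m \<le> n" for m
      using that
    proof (induction m)
      case (Suc m)
      then show ?case using refine_step_budgets(2)[OF inv(1) ne, of m E] by (simp add: sp_def X_def)
    qed simp
    have a: "real (\<Sum>i<n. card (X i)) \<le> potential p r" using 1[of n] potential_nonneg[of "?r n"] by simp
    have b: "(\<Sum>i<n. sp i) \<le> split_budget p r" using 2[of n] by simp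
    have "(\<Sum>i<n. 1) \<le> (\<Sum>i<n. sp i)" by (rule sum_mono) (simp add: sp_def)
    then have c: "n \<le> split_budget p r" using b by simp
    have "(\<Sum>i<n. T i) = 950 * d * (\<Sum>i<n. card (X i)) + (130 * D + 150) * (\<Sum>i<n. sp i)"
      by (simp add: T_def sum.distrib sum_distrib_left)
    then have "real ((\<Sum>i<n. T i) + (n + 1) * (cond_cost ?b + 1)) =
      950 * real d * real (\<Sum>i<n. card (X i)) + real (130 * D + 150) * real (\<Sum>i<n. sp i) + 11 * (real n + 1)"
      by simp
    also have "\<dots> \<le> 950 * real d * potential p r + real (130 * D + 150) * real (split_budget p r) + 11 * (real (split_budget p r) + 1)"
      using a b c by (intro add_mono mult_left_mono) (simp_all add: of_nat_sum[symmetric] del: of_nat_sum)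
    also have "\<dots> \<le> 950 * real d * potential p r + real (130 * D + 180) * real (split_budget p r) + 20"
      by (simp add: algebra_simps)
    finally show ?thesis .
  qed
  ultimately show ?thesis unfolding refn by blast
qed

text \<open>
  The potential is at most \<open>p * (log 2 p + 1)\<close> and the budget at most \<open>2 * p\<close>, while a tree
  update takes time \<open>O(log p)\<close>.
\<close>

lemma individualize_prog_correct:
  assumes s: "ready s r" and v: "valid p r" "stable_up_to p E {} r" "snd r = {}" and a: "reg s rX = a" "a < p"
  shows "\<exists>T. real T \<le> 5000 * real d * real p * log 2 (real p) \<and>
    runs W individualize_prog s T (\<lambda>s'. ready s' (individualize p E a r))"
proof -
  let ?L = "\<lambda>j. if j = (0::nat) then {a} else {}"
  let ?r = "split p {a} r"
  have s0: "input s" using s by (simp add: ready_def represents_def)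
  define P1 where "P1 = (\<lambda>s'. represents s' r \<and> (\<forall>v<p. arr s' CNT v = 0) \<and> (\<forall>j. bucket s' j (?L j)))"
  have "wpl W (st BUCK (Const 0) (Reg rX) ;; st BLEN (Const 0) (Const 1)) P1 s"
    using s a p p_less_W
    by (auto simp: P1_def ready_def represents_def tree_of_def bucket_def bij_betw_def addressable_p less_p_less_W lessThan_Suc)
  then have r1: "runs W (st BUCK (Const 0) (Reg rX) ;; st BLEN (Const 0) (Const 1)) s 20 P1"
    by (rule runs_straight) simp
  have v1: "valid p ?r" "stable_up_to p E {} ?r" using valid_split[OF v(1)] stable_up_to_split[OF v(1,2)] by auto
  have bud: "split_budget p ?r + card (split_cells p {a} (fst r)) \<le> 2 * p"
    using split_budget_split[OF v(1), of "{a}"] split_budget_le[OF v(1,3)] by simp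
  then have bud1: "split_budget p ?r \<le> 2 * p" and spl: "card (split_cells p {a} (fst r)) \<le> 2 * p" by auto
  have sumL: "(\<Sum>j<p. card (?L j)) = 1"
  proof -
    have "(\<Sum>j<p. card (?L j)) = (\<Sum>j<p. if j = 0 then 1 else 0)" by (rule sum.cong) auto
    also have "\<dots> = 1" using p by simp
    finally show ?thesis .
  qed
  have p0: "0 < p" using p by simp
  have r2: "runs W layers s1 (800 + (30 * D + 30) * (2 * p) + 20) (\<lambda>s'. ready s' ?r)" if s1: "P1 s1" for s1
  proof -
    have "runs W layers s1 (800 * (\<Sum>j<p. card (?L j)) + (30 * D + 30) * count_splits p ?L p r + 20)
      (\<lambda>s'. represents s' (split_layers p ?L p r) \<and> (\<forall>j. arr s' BLEN j = 0) \<and>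
        (\<forall>v. arr s' CNT v = (if v \<in> ?L 0 then 0 else arr s1 CNT v)))"
      using s1 a p by (intro layers_correct[OF _ v(1)]) (auto simp: P1_def)
    then show ?thesis
    proof (rule runs_weaken)
      show "800 * (\<Sum>j<p. card (?L j)) + (30 * D + 30) * count_splits p ?L p r + 20 \<le> 800 + (30 * D + 30) * (2 * p) + 20"
        unfolding sumL split_layers_singleton[OF p0] using spl by (intro add_mono mult_le_mono) auto
    next
      fix s' assume "represents s' (split_layers p ?L p r) \<and> (\<forall>j. arr s' BLEN j = 0) \<and>
        (\<forall>v. arr s' CNT v = (if v \<in> ?L 0 then 0 else arr s1 CNT v))"
      then show "ready s' ?r" using s1 unfolding split_layers_singleton[OF p0] by (simp add: ready_def P1_def)
    qed
  qed
  define B where "B = 950 * real d * potential p ?r + real (130 * D + 180) * real (split_budget p ?r) + 20"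
  define N where "N = nat \<lfloor>B\<rfloor>"
  have B0: "0 \<le> B" unfolding B_def using potential_nonneg[of ?r] by simp
  have r3: "runs W refine_loop s2 N (\<lambda>s'. ready s' (individualize p E a r))" if s2: "ready s2 ?r" for s2
  proof -
    from refine_loop_correct[OF s2 v1 bud1] obtain T where
      T: "real T \<le> B" "runs W refine_loop s2 T (\<lambda>s'. ready s' (refine p E ?r))" unfolding B_def by blast
    have "T \<le> N" unfolding N_def using T(1) B0 by (simp add: le_nat_floor)
    with T(2) show ?thesis unfolding individualize_def by (rule runs_weaken)
  qed
  have run: "runs W individualize_prog s (20 + (800 + (30 * D + 30) * (2 * p) + 20 + N)) (\<lambda>s'. ready s' (individualize p E a r))"
    unfolding individualize_prog_def by (rule runs_Seq[OF r1 runs_Seq[OF r2 r3]])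
  let ?l = "log 2 (real p)"
  have l1: "1 \<le> ?l" using p by (simp add: le_log_iff)
  have pot: "potential p ?r \<le> real p * (?l + 1)"
  proof -
    have "potential p ?r \<le> (\<Sum>v<p. ?l + 1)"
      unfolding potential_def
    proof (intro sum_mono add_mono)
      fix v assume "v \<in> {..<p}"
      then have "0 < card (cell p (fst ?r) (fst ?r v))"
        using card_cell_pos[of p "fst ?r" v] v1(1) by (simp add: valid_def)
      moreover have "card (cell p (fst ?r) (fst ?r v)) \<le> p"
        using card_mono[of "{..<p}" "cell p (fst ?r) (fst ?r v)"] by (auto simp: cell_def)
      ultimately show "log 2 (real (card (cell p (fst ?r) (fst ?r v)))) \<le> ?l" by simp
    qed simp
    then show ?thesis by simp
  qed
  have "real (20 + (800 + (30 * D + 30) * (2 * p) + 20 + N)) \<le> 840 + (30 * real D + 30) * (2 * real p) + B"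
    unfolding N_def using B0 by simp
  also have "\<dots> \<le> 840 + (30 * real D + 30) * (2 * real p) +
      (950 * real d * (real p * (?l + 1)) + (130 * real D + 180) * (2 * real p) + 20)"
  proof -
    have "950 * real d * potential p ?r \<le> 950 * real d * (real p * (?l + 1))"
      using pot by (intro mult_left_mono) auto
    moreover have "real (130 * D + 180) * real (split_budget p ?r) \<le> (130 * real D + 180) * (2 * real p)"
      using bud1 by (intro mult_mono) auto
    ultimately show ?thesis unfolding B_def by linarith
  qed
  also have "\<dots> = 860 + (320 * real D + 420) * real p + 950 * real d * real p * (?l + 1)"
    by (simp add: algebra_simps)
  also have "\<dots> \<le> 860 * (real d * real p * ?l) + (320 * 4 * ?l + 420 * ?l) * (real d * real p) + 950 * real d * real p * (2 * ?l)"
  proof -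
    have d1: "1 \<le> real d" "1 \<le> real p" using d p by auto
    have dp: "real p \<le> real d * real p" using d1 by simp
    have "1 \<le> real d * real p" using dp d1 by linarith
    then have "1 \<le> real d * real p * ?l" using l1 mult_mono[of 1 "real d * real p" 1 ?l] by simp
    moreover have "(320 * real D + 420) * real p \<le> (320 * 4 * ?l + 420 * ?l) * (real d * real p)"
      using D_bound l1 dp by (intro mult_mono) auto
    moreover have "950 * real d * real p * (?l + 1) \<le> 950 * real d * real p * (2 * ?l)"
      using l1 by (intro mult_left_mono) auto
    ultimately show ?thesis by linarith
  qed
  also have "\<dots> = 4460 * (real d * real p * ?l)" by (simp add: algebra_simps)
  also have "\<dots> \<le> 5000 * real d * real p * ?l" using l1 by simp
  finally show ?thesis using run by blast
qed

end

section \<open>Two individualizations in a row\<close>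

definition init_arrays :: prog where
  "init_arrays = (Assign 0 (Reg 1 \<^bold>* Reg 1 \<^bold>+ Reg 1) ;; Assign rI (Const 0)) ;;
     While (Less (Reg rI) (Reg 1))
       (st EL (Reg rI) (Reg rI) ;; st POS (Reg rI) (Reg rI) ;; Assign rI (Reg rI \<^bold>+ Const 1)) ;;
     (st SZ (Const 0) (Reg 1) ;; Assign rX (Const 0))"

text \<open>
  The least vertex of color 0 is as good as any other one of its class.
\<close>

definition find_color_0 :: prog where
  "find_color_0 = Assign rX (Const 0) ;;
     While (Less (Const 0) (ld COL (Reg rX))) (Assign rX (Reg rX \<^bold>+ Const 1))"

text \<open>
  The output overwrites the input from address 0 on. Labels are colors plus one, since colors
  start at 0.
\<close>

definition output_with :: "expr \<Rightarrow> prog" where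
  "output_with e = Assign rI (Const 0) ;;
     While (Less (Reg rI) (Reg 1)) (Store (Reg rI) (e \<^bold>+ Const 1) ;; Assign rI (Reg rI \<^bold>+ Const 1))"

definition canonize :: prog where
  "canonize = init_arrays ;; individualize_prog ;; find_color_0 ;; individualize_prog ;; output_with (ld COL (Reg rI))"

definition first_refinement :: "nat \<Rightarrow> (nat \<times> nat) set \<Rightarrow> refinement" where
  "first_refinement p E = individualize p E 0 unit_refinement"

definition second_vertex :: "nat \<Rightarrow> (nat \<times> nat) set \<Rightarrow> nat" where
  "second_vertex p E = (LEAST v. fst (first_refinement p E) v = 0)"

definition second_refinement :: "nat \<Rightarrow> (nat \<times> nat) set \<Rightarrow> refinement" where
  "second_refinement p E = individualize p E (second_vertex p E) (first_refinement p E)"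

context refinement_run
begin

lemma init_arrays_correct:
  assumes s: "reg s 1 = p" "reg s 2 = d"
    and inp: "\<And>u j. u < p \<Longrightarrow> j < d \<Longrightarrow> mem s (2 + u * (d + 1) + j) = adj ! u ! j"
    and zero: "\<And>a. base \<le> a \<Longrightarrow> mem s a = 0"
  shows "runs W init_arrays s (50 * p + 50) (\<lambda>s'. ready s' unit_refinement \<and> reg s' rX = 0)"
proof -
  define I where "I = (\<lambda>i s'. input s' \<and> reg s' rI = i \<and>
    (\<forall>r<16. \<forall>j. arr s' r j = (if (r = EL \<or> r = POS) \<and> j < i then j else 0)))"
  have "p * p + p < W" using p_less_W(7) by (simp add: base_def)
  then have "wpl W (Assign 0 (Reg 1 \<^bold>* Reg 1 \<^bold>+ Reg 1) ;; Assign rI (Const 0)) (I 0) s"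
    using s inp zero p_less_W by (auto simp: I_def input_def base_def arr_def)
  then have r1: "runs W (Assign 0 (Reg 1 \<^bold>* Reg 1 \<^bold>+ Reg 1) ;; Assign rI (Const 0)) s 10 (I 0)"
    by (rule runs_straight) simp
  let ?b = "Less (Reg rI) (Reg 1)"
  let ?body = "st EL (Reg rI) (Reg rI) ;; st POS (Reg rI) (Reg rI) ;; Assign rI (Reg rI \<^bold>+ Const 1)"
  have r2: "runs W (While ?b ?body) s' ((\<Sum>i<p. 30) + (p + 1) * (cond_cost ?b + 1)) (I p)" if "I 0 s'" for s'
  proof (rule runs_While_count)
    show "I 0 s'" by fact
  next
    fix s' assume "I p s'"
    then show "cond_fits W s' ?b \<and> \<not> cond_val s' ?b" using p_less_W by (simp add: I_def inputD)
  next
    fix s' i assume I: "I i s'" and i: "i < p"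
    have "i + 1 < W" "i < W" using i p_less_W by auto
    then have "wpl W ?body (I (Suc i)) s'"
      using I i p_less_W by (auto simp: I_def addressable_p less_Suc_eq)
    then have "runs W ?body s' 30 (I (Suc i))" by (rule runs_straight) simp
    then show "cond_fits W s' ?b \<and> cond_val s' ?b \<and> runs W ?body s' 30 (I (Suc i))"
      using I i p_less_W \<open>i < W\<close> by (simp add: I_def inputD)
  qed
  have r3: "runs W (st SZ (Const 0) (Reg 1) ;; Assign rX (Const 0)) s' 20 (\<lambda>s'. ready s' unit_refinement \<and> reg s' rX = 0)"
    if s': "I p s'" for s'
  proof -
    have c: "cell p (\<lambda>_. 0) b = (if b = 0 then {..<p} else {})" for b
      by (auto simp: cell_def)
    have "wpl W (st SZ (Const 0) (Reg 1) ;; Assign rX (Const 0)) (\<lambda>s'. ready s' unit_refinement \<and> reg s' rX = 0) s'"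
      using s' p_less_W p
      by (auto simp: I_def inputD addressable_p ready_def represents_def unit_refinement_def c tree_of_def
          arranged_def in_part_def)
    then show ?thesis by (rule runs_straight) simp
  qed
  have "runs W init_arrays s (10 + ((\<Sum>i<p. 30) + (p + 1) * (cond_cost ?b + 1) + 20)) (\<lambda>s'. ready s' unit_refinement \<and> reg s' rX = 0)"
    unfolding init_arrays_def by (rule runs_Seq[OF r1 runs_Seq[OF r2 r3]])
  then show ?thesis by (rule runs_weaken) auto
qed

lemma find_color_0_correct:
  assumes s: "ready s r" and v: "valid p r"
  defines "a \<equiv> LEAST v. fst r v = 0"
  shows "runs W find_color_0 s (20 * p + 20) (\<lambda>s'. ready s' r \<and> reg s' rX = a)" "a < p"
proof -
  obtain w where w: "w < p" "fst r w = 0" using valid_ex_color_0[OF v] by blast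
  show ap: "a < p" unfolding a_def using w Least_le[of "\<lambda>v. fst r v = 0" w] by simp
  have a0: "fst r a = 0" unfolding a_def using w(2) by (rule LeastI)
  have ne: "fst r i \<noteq> 0" if "i < a" for i using not_less_Least that unfolding a_def by blast
  have vc: "valid_coloring p (fst r)" using v by (simp add: valid_def)
  define I where "I = (\<lambda>i s'. ready s' r \<and> reg s' rX = i)"
  have r1: "runs W (Assign rX (Const 0)) s 2 (I 0)"
    using s p_less_W by (intro runs_straight) (auto simp: I_def ready_def represents_def tree_of_def)
  let ?b = "Less (Const 0) (ld COL (Reg rX))"
  have r2: "runs W (While ?b (Assign rX (Reg rX \<^bold>+ Const 1))) s' ((\<Sum>i<a. 4) + (a + 1) * (cond_cost ?b + 1)) (I a)" if "I 0 s'" for s'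
  proof (rule runs_While_count)
    show "I 0 s'" by fact
  next
    fix s' assume "I a s'"
    then show "cond_fits W s' ?b \<and> \<not> cond_val s' ?b"
      using ap a0 p_less_W by (simp add: I_def ready_def represents_def addressable_p less_p_less_W)
  next
    fix s' i assume I: "I i s'" and i: "i < a"
    have ip: "i < p" using i ap by simp
    have "i + 1 < W" "i < W" using ip p_less_W by auto
    then have "wpl W (Assign rX (Reg rX \<^bold>+ Const 1)) (I (Suc i)) s'"
      using I p_less_W by (auto simp: I_def ready_def represents_def tree_of_def)
    then have "runs W (Assign rX (Reg rX \<^bold>+ Const 1)) s' 4 (I (Suc i))" by (rule runs_straight) simp
    then show "cond_fits W s' ?b \<and> cond_val s' ?b \<and> runs W (Assign rX (Reg rX \<^bold>+ Const 1)) s' 4 (I (Suc i))"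
      using I ip ne[OF i] p_less_W color_less[OF vc ip] less_p_less_W
      by (simp add: I_def ready_def represents_def addressable_p)
  qed
  have "runs W find_color_0 s (2 + ((\<Sum>i<a. 4) + (a + 1) * (cond_cost ?b + 1))) (I a)"
    unfolding find_color_0_def by (rule runs_Seq[OF r1 r2])
  then show "runs W find_color_0 s (20 * p + 20) (\<lambda>s'. ready s' r \<and> reg s' rX = a)"
    by (rule runs_weaken) (use ap in \<open>auto simp: I_def\<close>)
qed

lemma output_correct:
  assumes s: "ready s r" and v: "valid p r"
  shows "runs W (output_with (ld COL (Reg rI))) s (40 * p + 40) (\<lambda>s'. \<forall>v<p. mem s' v = Suc (fst r v))"
proof -
  have vc: "valid_coloring p (fst r)" using v by (simp add: valid_def)
  define I where "I = (\<lambda>i s'. reg s' 0 = base \<and> reg s' 1 = p \<and> reg s' rI = i \<and> (\<forall>v<p. arr s' COL v = fst r v) \<and>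
    (\<forall>v<i. mem s' v = Suc (fst r v)))"
  have r1: "runs W (Assign rI (Const 0)) s 2 (I 0)"
    using s p_less_W by (intro runs_straight) (auto simp: I_def ready_def represents_def inputD)
  let ?b = "Less (Reg rI) (Reg 1)"
  let ?body = "Store (Reg rI) (ld COL (Reg rI) \<^bold>+ Const 1) ;; Assign rI (Reg rI \<^bold>+ Const 1)"
  have r2: "runs W (While ?b ?body) s' ((\<Sum>i<p. 20) + (p + 1) * (cond_cost ?b + 1)) (I p)" if "I 0 s'" for s'
  proof (rule runs_While_count)
    show "I 0 s'" by fact
  next
    fix s' assume "I p s'"
    then show "cond_fits W s' ?b \<and> \<not> cond_val s' ?b" using p_less_W by (simp add: I_def)
  next
    fix s' i assume I: "I i s'" and i: "i < p"
    have ad: "addressable W s' COL i"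
    proof -
      have "16 * i + base < W" using i W pp p unfolding base_def by linarith
      then show ?thesis using I p_less_W by (simp add: addressable_def I_def)
    qed
    have iW: "i + 1 < W" "i < W" using i p_less_W by auto
    have cW: "fst r i + 1 < W" "fst r i < W" using color_less[OF vc i] p_less_W by auto
    define s1 where "s1 = s'\<lparr>mem := (mem s')(i := Suc (fst r i))\<rparr>"
    have ib: "i < base" using i by (simp add: base_def)
    have a1: "arr s1 COL = arr s' COL"
      using I ib by (auto simp: s1_def arr_def fun_eq_iff I_def)
    have "I (Suc i) (set_reg s1 rI (Suc i))"
      using I a1 by (auto simp: I_def s1_def less_Suc_eq)
    then have "wpl W ?body (I (Suc i)) s'"
      using I i ad iW cW p_less_W by (simp add: I_def s1_def)
    then have "runs W ?body s' 20 (I (Suc i))" by (rule runs_straight) simp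
    then show "cond_fits W s' ?b \<and> cond_val s' ?b \<and> runs W ?body s' 20 (I (Suc i))"
      using I i p_less_W iW by (simp add: I_def)
  qed
  have "runs W (output_with (ld COL (Reg rI))) s (2 + ((\<Sum>i<p. 20) + (p + 1) * (cond_cost ?b + 1))) (I p)"
    unfolding output_with_def by (rule runs_Seq[OF r1 r2])
  then show ?thesis by (rule runs_weaken) (auto simp: I_def)
qed

lemma canonize_correct:
  assumes s: "reg s 1 = p" "reg s 2 = d"
    and inp: "\<And>u j. u < p \<Longrightarrow> j < d \<Longrightarrow> mem s (2 + u * (d + 1) + j) = adj ! u ! j"
    and zero: "\<And>a. base \<le> a \<Longrightarrow> mem s a = 0"
    and regular: "\<And>v. v < p \<Longrightarrow> hits E {..<p} v = d"
  shows "\<exists>T. real T \<le> 11000 * real d * real p * log 2 (real p) \<and>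
    runs W canonize s T (\<lambda>s'. \<forall>v<p. mem s' v = Suc (fst (second_refinement p E) v))"
proof -
  have p0: "0 < p" using p by simp
  note u = unit_refinement[OF p0 regular]
  note i1 = individualize_correct[OF u, of 0, folded first_refinement_def]
  note i2 = individualize_correct[OF i1(1-3), of "second_vertex p E", folded second_refinement_def]
  define B where "B = nat \<lfloor>5000 * real d * real p * log 2 (real p)\<rfloor>"
  have l1: "1 \<le> log 2 (real p)" using p by (simp add: le_log_iff)
  have Ble: "real B \<le> 5000 * real d * real p * log 2 (real p)" unfolding B_def using l1 by simp
  have ind: "runs W individualize_prog s' B (\<lambda>s'. ready s' (individualize p E a r))"
    if "ready s' r" "valid p r" "stable_up_to p E {} r" "snd r = {}" "reg s' rX = a" "a < p" for s' r a
  proof -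
    from individualize_prog_correct[OF that] obtain T where
      T: "real T \<le> 5000 * real d * real p * log 2 (real p)"
        "runs W individualize_prog s' T (\<lambda>s'. ready s' (individualize p E a r))" by blast
    have "T \<le> B" unfolding B_def using T(1) by (simp add: le_nat_floor)
    with T(2) show ?thesis by (rule runs_weaken)
  qed
  have r1: "runs W init_arrays s (50 * p + 50) (\<lambda>s'. ready s' unit_refinement \<and> reg s' rX = 0)"
    by (rule init_arrays_correct) (use assms in auto)
  have r2: "runs W individualize_prog s1 B (\<lambda>s'. ready s' (first_refinement p E))"
    if "ready s1 unit_refinement \<and> reg s1 rX = 0" for s1
    unfolding first_refinement_def using that u p0 by (intro ind) auto
  have r3: "runs W find_color_0 s2 (20 * p + 20) (\<lambda>s'. ready s' (first_refinement p E) \<and> reg s' rX = second_vertex p E)"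
    if "ready s2 (first_refinement p E)" for s2
    unfolding second_vertex_def using that i1(1) by (rule find_color_0_correct)
  have ap: "second_vertex p E < p"
  proof -
    obtain w where "w < p" "fst (first_refinement p E) w = 0" using valid_ex_color_0[OF i1(1)] by blast
    then show ?thesis unfolding second_vertex_def using Least_le[of "\<lambda>v. fst (first_refinement p E) v = 0" w] by simp
  qed
  have r4: "runs W individualize_prog s3 B (\<lambda>s'. ready s' (second_refinement p E))"
    if "ready s3 (first_refinement p E) \<and> reg s3 rX = second_vertex p E" for s3
    unfolding second_refinement_def using that i1 ap by (intro ind) auto
  have r5: "runs W (output_with (ld COL (Reg rI))) s4 (40 * p + 40) (\<lambda>s'. \<forall>v<p. mem s' v = Suc (fst (second_refinement p E) v))"
    if "ready s4 (second_refinement p E)" for s4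
    using that i2(1) by (rule output_correct)
  have "runs W canonize s (50 * p + 50 + (B + (20 * p + 20 + (B + (40 * p + 40)))))
    (\<lambda>s'. \<forall>v<p. mem s' v = Suc (fst (second_refinement p E) v))"
    unfolding canonize_def by (rule runs_Seq[OF r1 runs_Seq[OF r2 runs_Seq[OF r3 runs_Seq[OF r4 r5]]]])
  moreover have "real (50 * p + 50 + (B + (20 * p + 20 + (B + (40 * p + 40))))) \<le> 11000 * real d * real p * log 2 (real p)"
  proof -
    have "1 \<le> real d" using d by simp
    then have "real p * 1 \<le> real p * (real d * log 2 (real p))" using l1 mult_mono[of 1 "real d" 1 "log 2 (real p)"]
      by (intro mult_left_mono) auto
    moreover define X where "X = real d * real p * log 2 (real p)"
    ultimately have "real p \<le> X" by (simp add: ac_simps)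
    moreover have "3 \<le> real p" using p by simp
    moreover have "real B \<le> 5000 * X" using Ble by (simp add: X_def mult.assoc)
    ultimately have "110 * real p + (110 + 2 * real B) \<le> 11000 * X" by linarith
    then show ?thesis by (simp add: X_def mult.assoc)
  qed
  ultimately show ?thesis by blast
qed

end

section \<open>Circulant graphs of prime order\<close>

text \<open>
  A labeling of the vertices of a circulant graph by integers, periodic with period \<open>p\<close>, which
  carries the differences in \<open>S\<close> to the arcs.
\<close>

definition presents :: "nat \<Rightarrow> int set \<Rightarrow> (int \<Rightarrow> nat) \<Rightarrow> (nat \<times> nat) set \<Rightarrow> bool" where
  "presents p S \<omega> E \<longleftrightarrow> S \<subseteq> {1..<int p} \<and> (\<forall>x y. \<omega> x = \<omega> y \<longleftrightarrow> [x = y] (mod int p)) \<and>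
     range \<omega> = {..<p} \<and> E = {(\<omega> x, \<omega> (x + s)) | x s. s \<in> S}"

lemma presentsD:
  assumes "presents p S \<omega> E"
  shows "S \<subseteq> {1..<int p}" "\<omega> x = \<omega> y \<longleftrightarrow> [x = y] (mod int p)" "\<omega> x < p"
    "v < p \<Longrightarrow> \<exists>x. v = \<omega> x"
proof -
  show "S \<subseteq> {1..<int p}" "\<omega> x = \<omega> y \<longleftrightarrow> [x = y] (mod int p)"
    using assms by (auto simp: presents_def)
  have r: "range \<omega> = {..<p}" using assms by (simp add: presents_def)
  show "\<omega> x < p" using r by blast
  show "v < p \<Longrightarrow> \<exists>x. v = \<omega> x" using r by (metis imageE lessThan_iff)
qed

lemma presents_arc_less:
  assumes P: "presents p S \<omega> E" and e: "(u, v) \<in> E"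
  shows "u < p" "v < p"
proof -
  have "E = {(\<omega> x, \<omega> (x + s)) | x s. s \<in> S}" using P by (simp add: presents_def)
  with e obtain x s where "u = \<omega> x" "v = \<omega> (x + s)" by auto
  then show "u < p" "v < p" using presentsD(3)[OF P] by auto
qed

lemma presents_arc:
  assumes P: "presents p S \<omega> E"
  shows "(\<omega> x, \<omega> y) \<in> E \<longleftrightarrow> (y - x) mod int p \<in> S"
proof
  assume "(\<omega> x, \<omega> y) \<in> E"
  then obtain x' s where s: "\<omega> x = \<omega> x'" "\<omega> y = \<omega> (x' + s)" "s \<in> S"
    using P by (auto simp: presents_def)
  then have "[y - x = x' + s - x'] (mod int p)"
    using presentsD(2)[OF P] by (intro cong_diff) auto
  moreover have "s mod int p = s" using s(3) presentsD(1)[OF P] by auto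
  ultimately show "(y - x) mod int p \<in> S" using s(3) by (simp add: cong_def)
next
  assume s: "(y - x) mod int p \<in> S"
  have "\<omega> y = \<omega> (x + (y - x) mod int p)"
    using presentsD(2)[OF P, of y "x + (y - x) mod int p"] by (simp add: cong_def mod_add_right_eq)
  then show "(\<omega> x, \<omega> y) \<in> E" using P s unfolding presents_def by auto
qed

lemma presents_translate:
  assumes P: "presents p S \<omega> E"
  shows "presents p S (\<lambda>x. \<omega> (x + t)) E"
  unfolding presents_def
proof (intro conjI allI)
  show "S \<subseteq> {1..<int p}" by (rule presentsD(1)[OF P])
  show "\<omega> (x + t) = \<omega> (y + t) \<longleftrightarrow> [x = y] (mod int p)" for x y
    using presentsD(2)[OF P] by (simp add: cong_add_rcancel)
  have surj: "surj (\<lambda>x. x + t)" by (rule surjI[of _ "\<lambda>x. x - t"]) simp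
  have "range (\<lambda>x. \<omega> (x + t)) = \<omega> ` range (\<lambda>x. x + t)" by (simp only: image_image)
  also have "\<dots> = {..<p}" unfolding surj using P by (simp add: presents_def)
  finally show "range (\<lambda>x. \<omega> (x + t)) = {..<p}" .
  have "{(\<omega> x, \<omega> (x + s)) | x s. s \<in> S} = {(\<omega> (x + t), \<omega> (x + s + t)) | x s. s \<in> S}" (is "?A = ?B")
  proof (intro equalityI subsetI)
    fix e assume "e \<in> ?A"
    then obtain x s where "e = (\<omega> x, \<omega> (x + s))" "s \<in> S" by blast
    then have "e = (\<omega> ((x - t) + t), \<omega> ((x - t) + s + t)) \<and> s \<in> S" by (simp add: algebra_simps)
    then show "e \<in> ?B" by blast
  next
    fix e assume "e \<in> ?B"
    then obtain x s where "e = (\<omega> (x + t), \<omega> (x + s + t))" "s \<in> S" by blast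
    then have "e = (\<omega> (x + t), \<omega> ((x + t) + s)) \<and> s \<in> S" by (simp add: algebra_simps)
    then show "e \<in> ?A" by blast
  qed
  then show "E = {(\<omega> (x + t), \<omega> (x + s + t)) | x s. s \<in> S}" using P by (simp add: presents_def)
qed

lemma presents_hits:
  assumes P: "presents p S \<omega> E" and X: "X \<subseteq> {..<p}"
  shows "hits E X (\<omega> x) = card {s \<in> S. \<omega> (x - s) \<in> X}"
proof -
  have "inj_on (\<lambda>s. \<omega> (x - s)) S"
  proof (rule inj_onI)
    fix s t assume "s \<in> S" "t \<in> S" "\<omega> (x - s) = \<omega> (x - t)"
    then have "[x - s = x - t] (mod int p)" using presentsD(2)[OF P] by simp
    then have "[t = s] (mod int p)" by (simp add: cong_iff_dvd_diff)
    moreover have "s mod int p = s" "t mod int p = t" using \<open>s \<in> S\<close> \<open>t \<in> S\<close> presentsD(1)[OF P] by auto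
    ultimately show "s = t" by (simp add: cong_def)
  qed
  then have inj: "inj_on (\<lambda>s. \<omega> (x - s)) {s \<in> S. \<omega> (x - s) \<in> X}" by (rule inj_on_subset) auto
  have "{u \<in> X. (u, \<omega> x) \<in> E} = (\<lambda>s. \<omega> (x - s)) ` {s \<in> S. \<omega> (x - s) \<in> X}"
  proof (intro equalityI subsetI)
    fix u assume u: "u \<in> {u \<in> X. (u, \<omega> x) \<in> E}"
    then obtain y where y: "u = \<omega> y" using presentsD(4)[OF P] X by blast
    then have s: "(x - y) mod int p \<in> S" using u presents_arc[OF P] by simp
    have "u = \<omega> (x - (x - y) mod int p)"
      unfolding y presentsD(2)[OF P] by (simp add: cong_def mod_diff_right_eq)
    then show "u \<in> (\<lambda>s. \<omega> (x - s)) ` {s \<in> S. \<omega> (x - s) \<in> X}" using s u by blast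
  next
    fix u assume "u \<in> (\<lambda>s. \<omega> (x - s)) ` {s \<in> S. \<omega> (x - s) \<in> X}"
    then obtain s where s: "u = \<omega> (x - s)" "s \<in> S" "u \<in> X" by auto
    have "(\<omega> (x - s), \<omega> x) \<in> E"
      unfolding presents_arc[OF P] using s(2) presentsD(1)[OF P] by auto
    then show "u \<in> {u \<in> X. (u, \<omega> x) \<in> E}" using s by simp
  qed
  then show ?thesis unfolding hits_def using card_image[OF inj] by simp
qed

lemma presents_regular: "presents p S \<omega> E \<Longrightarrow> v < p \<Longrightarrow> hits E {..<p} v = card S"
  using presents_hits[of p S \<omega> E "{..<p}"] presentsD(3,4)[of p S \<omega> E] by fastforce

lemma presents_out_degree:
  assumes P: "presents p S \<omega> E" and v: "v < p"
  shows "card {w. (v, w) \<in> E} = card S"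
proof -
  obtain x where x: "v = \<omega> x" using presentsD(4)[OF P v] by blast
  have "{w. (v, w) \<in> E} = (\<lambda>s. \<omega> (x + s)) ` S"
  proof (intro equalityI subsetI)
    fix w assume w: "w \<in> {w. (v, w) \<in> E}"
    then have "w < p" using presents_arc_less(2)[OF P, of v w] by simp
    then have "w \<in> range \<omega>" using P by (simp add: presents_def)
    then obtain y where y: "w = \<omega> y" by blast
    have s: "(y - x) mod int p \<in> S" using w presents_arc[OF P] x y by simp
    have "w = \<omega> (x + (y - x) mod int p)"
      unfolding y presentsD(2)[OF P] by (simp add: cong_def mod_add_right_eq)
    then show "w \<in> (\<lambda>s. \<omega> (x + s)) ` S" using s by blast
  next
    fix w assume "w \<in> (\<lambda>s. \<omega> (x + s)) ` S"
    then show "w \<in> {w. (v, w) \<in> E}" using P x unfolding presents_def by blast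
  qed
  moreover have "inj_on (\<lambda>s. \<omega> (x + s)) S"
  proof (rule inj_onI)
    fix s t assume "s \<in> S" "t \<in> S" "\<omega> (x + s) = \<omega> (x + t)"
    then have "[s = t] (mod int p)" using presentsD(2)[OF P] by (simp add: cong_add_lcancel)
    moreover have "s mod int p = s" "t mod int p = t" using \<open>s \<in> S\<close> \<open>t \<in> S\<close> presentsD(1)[OF P] by auto
    ultimately show "s = t" by (simp add: cong_def)
  qed
  ultimately show ?thesis by (simp add: card_image)
qed

text \<open>
  With nothing waiting, the coloring is equitable when read off along a presentation.
\<close>

lemma stable_imp_equitable:
  assumes pr: "prime p" and P: "presents p S \<omega> E" and st: "stable_up_to p E {} r" "snd r = {}"
  shows "equitable_coloring p S (\<lambda>x. fst r (\<omega> x))"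
proof
  show "prime p" by fact
  show "S \<subseteq> {1..<int p}" by (rule presentsD(1)[OF P])
  show "fst r (\<omega> x) = fst r (\<omega> y)" if "[x = y] (mod int p)" for x y
    using that presentsD(2)[OF P] by metis
  fix x y b assume eq: "fst r (\<omega> x) = fst r (\<omega> y)"
  have "stable_up_to p E {} (fst r, {})" using st by (cases r) auto
  then have "hits E (cell p (fst r) b) (\<omega> x) = hits E (cell p (fst r) b) (\<omega> y)"
    by (rule stable_up_toD) (use eq presentsD(3)[OF P] in auto)
  moreover have "cell p (fst r) b \<subseteq> {..<p}" by (auto simp: cell_def)
  moreover have "\<omega> (z - s) \<in> cell p (fst r) b \<longleftrightarrow> fst r (\<omega> (z - s)) = b" for z s
    using presentsD(3)[OF P] by (simp add: in_cell_iff)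
  ultimately show "card {s \<in> S. fst r (\<omega> (x - s)) = b} = card {s \<in> S. fst r (\<omega> (y - s)) = b}"
    by (simp add: presents_hits[OF P])
qed

lemma refinement_iso_comp:
  assumes "refinement_iso p E E' f" "refinement_iso p E' E'' g"
  shows "refinement_iso p E E'' (g \<circ> f)"
proof
  interpret f: refinement_iso p E E' f by fact
  interpret g: refinement_iso p E' E'' g by fact
  show "bij_betw (g \<circ> f) {..<p} {..<p}" using f.bij g.bij by (rule bij_betw_trans)
  show "((g \<circ> f) u, (g \<circ> f) v) \<in> E'' \<longleftrightarrow> (u, v) \<in> E" if "u < p" "v < p" for u v
    using that f.arcs g.arcs f.\<phi>_less by simp
qed

text \<open>
  The hypothesis says that multiplication by the multiplier maps \<open>S\<close> into itself; being
  injective on a finite set, it maps \<open>S\<close> onto itself, hence preserves arcs and non-arcs.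
\<close>

lemma affine_automorphism:
  assumes P: "presents p S \<omega> E" and pr: "prime p" and \<kappa>: "\<not> int p dvd \<kappa>"
    and S: "\<And>s. s \<in> S \<Longrightarrow> \<kappa> * s mod int p \<in> S"
  shows "\<exists>f. refinement_iso p E E f \<and> (\<forall>x. f (\<omega> x) = \<omega> (\<kappa> * x + t))"
proof -
  have p: "0 < p" using pr by (rule prime_gt_0_nat)
  have cop: "coprime \<kappa> (int p)" using \<kappa> pr prime_imp_coprime[of "int p" \<kappa>] by (simp add: coprime_commute)
  \<comment> \<open>By periodicity, the choice of the preimage does not matter.\<close>
  define f where "f = (\<lambda>v. \<omega> (\<kappa> * (SOME x. v = \<omega> x) + t))"
  have f: "f (\<omega> x) = \<omega> (\<kappa> * x + t)" for x
  proof -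
    have "\<omega> x = \<omega> (SOME y. \<omega> x = \<omega> y)" by (rule someI) (rule refl)
    then have "[x = (SOME y. \<omega> x = \<omega> y)] (mod int p)" using presentsD(2)[OF P] by blast
    then have "[\<kappa> * x + t = \<kappa> * (SOME y. \<omega> x = \<omega> y) + t] (mod int p)"
      by (intro cong_add cong_mult cong_refl)
    then have "\<omega> (\<kappa> * x + t) = \<omega> (\<kappa> * (SOME y. \<omega> x = \<omega> y) + t)" using presentsD(2)[OF P] by blast
    then show ?thesis by (simp only: f_def)
  qed
  have S_iff: "\<kappa> * s mod int p \<in> S \<longleftrightarrow> s mod int p \<in> S" for s
  proof -
    define m where "m = (\<lambda>s. \<kappa> * s mod int p)"
    have "inj_on m S"
    proof (rule inj_onI)
      fix s t assume st: "s \<in> S" "t \<in> S" "m s = m t"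
      then have "[\<kappa> * s = \<kappa> * t] (mod int p)" by (simp add: m_def cong_def)
      then have "[s = t] (mod int p)" using cop by (simp add: cong_mult_lcancel)
      moreover have "s mod int p = s" "t mod int p = t" using st presentsD(1)[OF P] by auto
      ultimately show "s = t" by (simp add: cong_def)
    qed
    moreover have "m ` S \<subseteq> S" using S by (auto simp: m_def)
    moreover have "finite S" using presentsD(1)[OF P] by (rule finite_subset) simp
    ultimately have surj: "m ` S = S" by (intro endo_inj_surj)
    show ?thesis
    proof
      assume "\<kappa> * s mod int p \<in> S"
      then obtain s' where s': "s' \<in> S" "\<kappa> * s mod int p = \<kappa> * s' mod int p" using surj unfolding m_def by blast
      then have "[s = s'] (mod int p)" using cop by (simp add: cong_def[symmetric] cong_mult_lcancel)
      moreover have "s' mod int p = s'" using s' presentsD(1)[OF P] by auto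
      ultimately show "s mod int p \<in> S" using s' by (simp add: cong_def)
    next
      assume "s mod int p \<in> S"
      from S[OF this] show "\<kappa> * s mod int p \<in> S" by (simp add: mod_mult_right_eq)
    qed
  qed
  have "refinement_iso p E E f"
  proof
    have inj: "inj_on f {..<p}"
    proof (rule inj_onI)
      fix u v assume uv: "u \<in> {..<p}" "v \<in> {..<p}" "f u = f v"
      then obtain x y where xy: "u = \<omega> x" "v = \<omega> y" using presentsD(4)[OF P] by (metis lessThan_iff)
      then have "[\<kappa> * x = \<kappa> * y] (mod int p)" using uv(3) f presentsD(2)[OF P] by (simp add: cong_add_rcancel)
      then have "[x = y] (mod int p)" using cop by (simp add: cong_mult_lcancel)
      then show "u = v" using xy presentsD(2)[OF P] by simp
    qed
    moreover have "f ` {..<p} \<subseteq> {..<p}" unfolding f_def using presentsD(3)[OF P] by auto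
    ultimately show "bij_betw f {..<p} {..<p}"
      unfolding bij_betw_def using endo_inj_surj[of "{..<p}" f] by simp
    fix u v assume "u < p" "v < p"
    then obtain x y where xy: "u = \<omega> x" "v = \<omega> y" using presentsD(4)[OF P] by metis
    have "(\<kappa> * y + t) - (\<kappa> * x + t) = \<kappa> * (y - x)" by (simp add: algebra_simps)
    then show "(f u, f v) \<in> E \<longleftrightarrow> (u, v) \<in> E"
      unfolding xy f presents_arc[OF P] using S_iff[of "y - x"] by simp
  qed
  then show ?thesis using f by blast
qed

lemma translation_automorphism:
  assumes P: "presents p S \<omega> E" and pr: "prime p" and v: "v < p"
  shows "\<exists>f. refinement_iso p E E f \<and> f v = 0"
proof -
  obtain x where x: "v = \<omega> x" using presentsD(4)[OF P v] by blast
  have "0 < p" using v by simp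
  then obtain y where y: "0 = \<omega> y" using presentsD(4)[OF P] by blast
  have "s \<in> S \<Longrightarrow> 1 * s mod int p \<in> S" for s using presentsD(1)[OF P] by auto
  moreover have "\<not> int p dvd 1" using prime_gt_1_nat[OF pr] by simp
  ultimately obtain f where "refinement_iso p E E f" "\<forall>z. f (\<omega> z) = \<omega> (1 * z + (y - x))"
    using affine_automorphism[OF P pr, of 1 "y - x"] by blast
  then show ?thesis using x y by auto
qed

locale nontrivial_circulant =
  fixes p :: nat and S :: "int set" and \<omega> :: "int \<Rightarrow> nat" and E :: "(nat \<times> nat) set"
  assumes prime: "prime p" and presents: "presents p S \<omega> E" and origin: "\<omega> 0 = 0"
    and S_nonempty: "S \<noteq> {}" and S_proper: "S \<noteq> {1..<int p}"
begin

lemma p_pos: "0 < p" using prime by (rule prime_gt_0_nat)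

lemma unit: "valid p unit_refinement" "stable_up_to p E {} unit_refinement" "snd unit_refinement = {}"
  using unit_refinement[OF p_pos, of E "card S"] presents_regular[OF presents] by auto

lemmas first = individualize_correct[OF unit, where a = 0, folded first_refinement_def]
lemmas second = individualize_correct[OF first(1-3), where a = "second_vertex p E", folded second_refinement_def]

lemma origin_isolated: "v < p \<Longrightarrow> fst (first_refinement p E) v = fst (first_refinement p E) 0 \<Longrightarrow> v = 0"
  using first(4)[of v 0] p_pos by simp

lemma p_gt_2: "2 < p"
proof -
  have "p \<noteq> 2"
  proof
    assume p2: "p = 2"
    have "{1..<int p} = {1}" using p2 by auto
    then show False using presentsD(1)[OF presents] S_nonempty S_proper by auto
  qed
  then show ?thesis using prime_ge_2_nat[OF prime] by simp
qed

text \<open>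
  After splitting off vertex 0 from the unit coloring its color is \<open>p - 1\<close>, and colors only
  grow. So a vertex of color 0 is different from vertex 0, and the second individualization is
  a proper one.
\<close>

lemma origin_color: "fst (first_refinement p E) 0 \<noteq> 0"
proof -
  have "cell p (\<lambda>_. 0) 0 - {0} = {1..<p}" by (auto simp: cell_def)
  then have "fst (split p {0} unit_refinement) 0 = p - 1"
    by (simp add: split_col_def new_color_def unit_refinement_def)
  then have "p - 1 \<le> fst (first_refinement p E) 0"
    unfolding first_refinement_def using individualize_ge[of p 0 unit_refinement 0 E] by simp
  then show ?thesis using p_gt_2 by simp
qed

lemma second_vertex: "second_vertex p E < p" "fst (first_refinement p E) (second_vertex p E) = 0"
proof -
  obtain w where w: "w < p" "fst (first_refinement p E) w = 0" using valid_ex_color_0[OF first(1)] by blast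
  then show "fst (first_refinement p E) (second_vertex p E) = 0"
    unfolding second_vertex_def by (metis (mono_tags) LeastI)
  show "second_vertex p E < p" unfolding second_vertex_def using w Least_le[of "\<lambda>v. fst (first_refinement p E) v = 0" w] by simp
qed

lemma dvd_iff_origin: "int p dvd x \<longleftrightarrow> \<omega> x = 0"
  using presentsD(2)[OF presents, of x 0] by (simp add: origin cong_0_iff)

lemma same_color_automorphism:
  assumes uv: "u < p" "v < p" "fst (first_refinement p E) u = fst (first_refinement p E) v" "u \<noteq> 0"
  shows "\<exists>f. refinement_iso p E E f \<and> f 0 = 0 \<and> f u = v"
proof -
  interpret c: equitable_coloring p S "\<lambda>x. fst (first_refinement p E) (\<omega> x)"
    by (rule stable_imp_equitable[OF prime presents first(2,3)])
  obtain x y where xy: "u = \<omega> x" "v = \<omega> y" using presentsD(4)[OF presents] uv by metis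
  have "int p dvd z" if "fst (first_refinement p E) (\<omega> z) = fst (first_refinement p E) (\<omega> 0)" for z
    using origin_isolated[OF presentsD(3)[OF presents], of z] that unfolding dvd_iff_origin by (simp add: origin)
  moreover have "\<not> int p dvd x" unfolding dvd_iff_origin using uv xy by simp
  ultimately obtain \<kappa> where \<kappa>: "\<not> int p dvd \<kappa>" "[y = \<kappa> * x] (mod int p)" "\<forall>s\<in>S. \<kappa> * s mod int p \<in> S"
    using c.same_color_imp_multiple[of x y] uv xy by auto
  then obtain f where f: "refinement_iso p E E f" "\<forall>x. f (\<omega> x) = \<omega> (\<kappa> * x + 0)"
    using affine_automorphism[OF presents prime \<kappa>(1), of 0] by blast
  have "f (\<omega> 0) = \<omega> 0" using f(2) by simp
  then have "f 0 = 0" by (simp add: origin)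
  moreover have "f u = v" using f(2) \<kappa>(2) presentsD(2)[OF presents] by (simp add: xy cong_sym)
  ultimately show ?thesis using f(1) by blast
qed

lemma second_refinement_discrete:
  assumes uv: "u < p" "v < p" "fst (second_refinement p E) u = fst (second_refinement p E) v"
  shows "u = v"
proof -
  interpret c: equitable_coloring p S "\<lambda>x. fst (second_refinement p E) (\<omega> x)"
    by (rule stable_imp_equitable[OF prime presents second(2,3)])
  obtain x y where xy: "u = \<omega> x" "v = \<omega> y" using presentsD(4)[OF presents] uv by metis
  obtain a where a: "second_vertex p E = \<omega> a" using presentsD(4)[OF presents second_vertex(1)] by blast
  have zero: "int p dvd z" if "fst (second_refinement p E) (\<omega> z) = fst (second_refinement p E) (\<omega> 0)" for z
    using second(4)[OF presentsD(3)[OF presents] _ that] origin_isolated[OF presentsD(3)[OF presents], of z] p_pos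
    unfolding dvd_iff_origin by (simp add: origin)
  have single: "[z = a] (mod int p)" if "fst (second_refinement p E) (\<omega> z) = fst (second_refinement p E) (\<omega> a)" for z
    using second(4)[OF presentsD(3)[OF presents] presentsD(3)[OF presents] that] a presentsD(2)[OF presents] by simp
  have "\<not> int p dvd a"
    unfolding dvd_iff_origin
  proof
    assume "\<omega> a = 0"
    then show False using a second_vertex(2) origin_color by simp
  qed
  then have "[x = y] (mod int p)"
    using c.two_singletons_imp_discrete[OF zero single _ S_nonempty S_proper, of x y] uv xy by simp
  then show ?thesis using xy presentsD(2)[OF presents] by simp
qed

lemma second_refinement_bij: "bij_betw (\<lambda>v. Suc (fst (second_refinement p E) v)) {..<p} {1..p}"
proof -
  have inj: "inj_on (\<lambda>v. Suc (fst (second_refinement p E) v)) {..<p}"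
    using second_refinement_discrete by (auto simp: inj_on_def)
  have "valid_coloring p (fst (second_refinement p E))" using second(1) by (simp add: valid_def)
  then have "(\<lambda>v. Suc (fst (second_refinement p E) v)) ` {..<p} \<subseteq> {1..p}"
    using color_less by (force simp: Suc_le_eq)
  then have "(\<lambda>v. Suc (fst (second_refinement p E) v)) ` {..<p} = {1..p}"
    using card_image[OF inj] by (intro card_subset_eq) auto
  then show ?thesis using inj by (simp add: bij_betw_def)
qed

end

text \<open>
  A given isomorphism is composed with a translation that moves the image of 0 to 0, and then
  with a multiplier that moves the image of the second vertex of \<open>G\<close> to the second vertex of
  \<open>H\<close>. Both have the same color there by the lockstep argument, so such a multiplier exists.
  The result respects both individualized vertices.
\<close>

lemma second_refinement_canonical:
  assumes G: "nontrivial_circulant p S \<omega> E" and H: "nontrivial_circulant p S' \<omega>' E'"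
    and iso: "refinement_iso p E E' \<phi>"
  shows "\<exists>\<theta>. refinement_iso p E E' \<theta> \<and> (\<forall>v<p. fst (second_refinement p E') (\<theta> v) = fst (second_refinement p E) v)"
proof -
  interpret G: nontrivial_circulant p S \<omega> E by fact
  interpret H: nontrivial_circulant p S' \<omega>' E' by fact
  interpret \<phi>: refinement_iso p E E' \<phi> by fact
  obtain f where f: "refinement_iso p E' E' f" "f (\<phi> 0) = 0"
    using translation_automorphism[OF H.presents H.prime \<phi>.\<phi>_less[OF G.p_pos]] by blast
  define \<psi> where "\<psi> = f \<circ> \<phi>"
  have \<psi>: "refinement_iso p E E' \<psi>" unfolding \<psi>_def using iso f(1) by (rule refinement_iso_comp)
  have first_rel: "refinement_iso.related p \<chi> (first_refinement p E) (first_refinement p E')"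
    if "refinement_iso p E E' \<chi>" "\<chi> 0 = 0" for \<chi>
  proof -
    interpret \<chi>: refinement_iso p E E' \<chi> by fact
    show ?thesis
      unfolding first_refinement_def using \<chi>.related_individualize[OF \<chi>.related_unit G.p_pos] that(2) by simp
  qed
  interpret \<psi>: refinement_iso p E E' \<psi> by fact
  let ?a = "second_vertex p E" and ?a' = "second_vertex p E'"
  have "\<psi>.related (first_refinement p E) (first_refinement p E')"
    by (rule first_rel[OF \<psi>]) (simp add: \<psi>_def f(2))
  then have c: "fst (first_refinement p E') (\<psi> ?a) = 0"
    using G.second_vertex by (simp add: \<psi>.related_def)
  have "\<psi> ?a \<noteq> 0"
  proof
    assume "\<psi> ?a = 0"
    then show False using c H.origin_color by simp
  qed
  then obtain g where g: "refinement_iso p E' E' g" "g 0 = 0" "g (\<psi> ?a) = ?a'"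
    using H.same_color_automorphism[OF \<psi>.\<phi>_less[OF G.second_vertex(1)] H.second_vertex(1)] c H.second_vertex(2)
    by auto
  define \<theta> where "\<theta> = g \<circ> \<psi>"
  have \<theta>: "refinement_iso p E E' \<theta>" unfolding \<theta>_def using \<psi> g(1) by (rule refinement_iso_comp)
  interpret \<theta>: refinement_iso p E E' \<theta> by fact
  have "\<theta> 0 = 0" by (simp add: \<theta>_def \<psi>_def f(2) g(2))
  then have "\<theta>.related (first_refinement p E) (first_refinement p E')" by (rule first_rel[OF \<theta>])
  from \<theta>.related_individualize[OF this G.second_vertex(1)]
  have "\<theta>.related (second_refinement p E) (second_refinement p E')"
    unfolding second_refinement_def by (simp add: \<theta>_def g(3))
  then show ?thesis using \<theta> by (auto simp: \<theta>.related_def)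
qed

section \<open>The canonical labeling\<close>

text \<open>
  In a pair digraph the arcs are determined by their ends, so an isomorphism is a bijection of
  the vertices.
\<close>

lemma digraph_iso_with_proj:
  assumes "digraph_iso (with_proj G) (with_proj H)"
  obtains f where "bij_betw f (pverts G) (pverts H)" "parcs H = (\<lambda>(u, v). (f u, f v)) ` parcs G"
    "parcs G \<subseteq> pverts G \<times> pverts G"
proof -
  from assms obtain h where h: "pre_digraph.digraph_isomorphism (with_proj G) h"
    and H: "with_proj H = app_iso h (with_proj G)"
    unfolding digraph_iso_def by blast
  define f where "f = iso_verts h"
  have v: "pverts H = f ` pverts G" using arg_cong[OF H, of verts] by (simp add: f_def)
  have a: "parcs H = iso_arcs h ` parcs G" using arg_cong[OF H, of arcs] by simp
  have t: "fst = iso_tail h" using arg_cong[OF H, of tail] by simp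
  have hd: "snd = iso_head h" using arg_cong[OF H, of head] by simp
  have "inj_on f (pverts G)"
    using h by (simp add: pre_digraph.digraph_isomorphism_def f_def)
  then have "bij_betw f (pverts G) (pverts H)" using v by (simp add: bij_betw_def)
  moreover have "iso_arcs h e = (f (fst e), f (snd e))" if "e \<in> parcs G" for e
    using h that t hd unfolding pre_digraph.digraph_isomorphism_def f_def
    by (metis prod.collapse with_proj_simps(2,4,5))
  then have "parcs H = (\<lambda>(u, v). (f u, f v)) ` parcs G"
    unfolding a by (intro image_cong refl) (simp add: case_prod_beta)
  moreover have "parcs G \<subseteq> pverts G \<times> pverts G"
  proof -
    have "wf_digraph (with_proj G)" using h by (simp add: pre_digraph.digraph_isomorphism_def)
    then show ?thesis unfolding wf_digraph_def by fastforce
  qed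
  ultimately show ?thesis by (rule that)
qed

text \<open>
  The isomorphism onto the Cayley graph provides the presentation; a translation moves its
  origin to vertex 0.
\<close>

lemma circulant_presents:
  assumes p: "0 < p" and G: "G \<in> circulant_graphs p"
  shows "pverts G = {..<p}" "\<exists>S \<omega>. presents p S \<omega> (parcs G) \<and> \<omega> 0 = 0"
proof -
  show V: "pverts G = {..<p}" using G unfolding circulant_graphs_def lessThan_atLeast0 by blast
  let ?Z = "integer_mod_group p"
  from G obtain S where S: "S \<subseteq> carrier ?Z - {\<one>\<^bsub>?Z\<^esub>}"
    and iso: "digraph_iso (with_proj G) (with_proj (cayley_digraph ?Z S))"
    unfolding circulant_graphs_def circulant_graph_def by blast
  from S have S': "S \<subseteq> {1..<int p}" using p by (auto simp: carrier_integer_mod_group)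
  from iso obtain f where f: "bij_betw f (pverts G) (pverts (cayley_digraph ?Z S))"
    and arcs: "parcs (cayley_digraph ?Z S) = (\<lambda>(u, v). (f u, f v)) ` parcs G"
    and sub: "parcs G \<subseteq> pverts G \<times> pverts G"
    by (rule digraph_iso_with_proj)
  have vc: "pverts (cayley_digraph ?Z S) = {0..<int p}"
    using p by (simp add: cayley_digraph_def carrier_integer_mod_group)
  have bij: "bij_betw f {..<p} {0..<int p}" using f V vc by simp
  define g where "g = the_inv_into {..<p} f"
  have gb: "bij_betw g {0..<int p} {..<p}" unfolding g_def using bij by (rule bij_betw_the_inv_into)
  have gf: "g (f v) = v" if "v < p" for v
    unfolding g_def using bij that by (intro the_inv_into_f_f) (auto simp: bij_betw_def)
  have fg: "f (g x) = x" if "x \<in> {0..<int p}" for x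
    unfolding g_def using bij that by (intro f_the_inv_into_f) (auto simp: bij_betw_def)
  have arc: "parcs (cayley_digraph ?Z S) = {(x, (s + x) mod int p) | x s. x \<in> {0..<int p} \<and> s \<in> S}"
    using p by (simp add: cayley_digraph_def carrier_integer_mod_group)
  have md: "x mod int p \<in> {0..<int p}" for x using p by simp
  define \<omega> where "\<omega> = (\<lambda>x. g (x mod int p))"
  have "presents p S \<omega> (parcs G)"
    unfolding presents_def
  proof (intro conjI allI)
    show "S \<subseteq> {1..<int p}" by fact
    show "\<omega> x = \<omega> y \<longleftrightarrow> [x = y] (mod int p)" for x y
      using gb md[of x] md[of y] unfolding \<omega>_def cong_def bij_betw_def by (auto dest: inj_onD)
    show "range \<omega> = {..<p}"
    proof (intro equalityI subsetI)
      fix v assume "v \<in> range \<omega>"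
      then show "v \<in> {..<p}" using gb md unfolding \<omega>_def bij_betw_def by blast
    next
      fix v assume v: "v \<in> {..<p}"
      then have "f v \<in> {0..<int p}" using bij by (auto simp: bij_betw_def)
      then have "\<omega> (f v) = v" using gf v by (simp add: \<omega>_def)
      then show "v \<in> range \<omega>" by (metis rangeI)
    qed
    show "parcs G = {(\<omega> x, \<omega> (x + s)) | x s. s \<in> S}"
    proof (intro equalityI subsetI)
      fix e assume e: "e \<in> parcs G"
      obtain u v where uv: "e = (u, v)" by (cases e)
      have up: "u < p" "v < p" using e sub V uv by auto
      have "(f u, f v) \<in> parcs (cayley_digraph ?Z S)" unfolding arcs using e uv by force
      then obtain s where s: "s \<in> S" "f v = (s + f u) mod int p" "f u \<in> {0..<int p}" unfolding arc by auto
      have "u = \<omega> (f u)" using gf[OF up(1)] s(3) by (simp add: \<omega>_def)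
      moreover have "v = \<omega> (f u + s)" using gf[OF up(2)] s(2) by (simp add: \<omega>_def add.commute)
      ultimately show "e \<in> {(\<omega> x, \<omega> (x + s)) | x s. s \<in> S}" using s(1) uv by blast
    next
      fix e assume "e \<in> {(\<omega> x, \<omega> (x + s)) | x s. s \<in> S}"
      then obtain x s where e: "e = (\<omega> x, \<omega> (x + s))" "s \<in> S" by blast
      have "(x mod int p, (s + x mod int p) mod int p) \<in> parcs (cayley_digraph ?Z S)"
        unfolding arc using e(2) md by blast
      then obtain u v where uv: "(u, v) \<in> parcs G" "f u = x mod int p" "f v = (s + x mod int p) mod int p"
        unfolding arcs by auto
      have "u < p" "v < p" using uv(1) sub V by auto
      then have "u = \<omega> x" "v = \<omega> (x + s)"
        using gf[of u] gf[of v] uv(2,3) by (simp_all add: \<omega>_def add.commute mod_add_left_eq mod_add_right_eq)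
      then show "e \<in> parcs G" using uv(1) e(1) by simp
    qed
  qed
  note P = this
  obtain t where t: "0 = \<omega> t" using presentsD(4)[OF P p] by blast
  show "\<exists>S \<omega>. presents p S \<omega> (parcs G) \<and> \<omega> 0 = 0"
    using presents_translate[OF P, of t] t by (intro exI[of _ S] exI[of _ "\<lambda>x. \<omega> (x + t)"]) simp
qed

definition graph_degree :: "nat pair_pre_digraph \<Rightarrow> nat" where
  "graph_degree G = card {w. (0, w) \<in> parcs G}"

text \<open>
  For degrees 0 and at least \<open>p - 1\<close> the graph is empty or complete, every relabeling yields
  the same graph, and refinement could not distinguish any vertices.
\<close>

definition canonical_label :: "nat pair_pre_digraph \<Rightarrow> nat \<Rightarrow> nat" where
  "canonical_label G v = (let p = card (pverts G); d = graph_degree G in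
     if 0 < d \<and> d + 1 < p then Suc (fst (second_refinement p (parcs G)) v) else Suc v)"

lemma nontrivialI:
  assumes "prime p" "presents p S \<omega> (parcs G)" "\<omega> 0 = 0" "0 < graph_degree G" "graph_degree G + 1 < p"
  shows "nontrivial_circulant p S \<omega> (parcs G)"
proof
  have "0 < p" using assms(1) by (rule prime_gt_0_nat)
  then have d: "graph_degree G = card S" unfolding graph_degree_def by (rule presents_out_degree[OF assms(2)])
  show "S \<noteq> {}" using assms(4) d by auto
  show "S \<noteq> {1..<int p}" using assms(5) d by auto
qed (use assms in auto)

text \<open>
  In the excluded cases the arcs are determined by the order and the degree.
\<close>

lemma trivial_arcs:
  assumes "prime p" "presents p S \<omega> E" "card S = 0 \<or> p \<le> card S + 1"
  shows "E = (if card S = 0 then {} else {(u, v). u < p \<and> v < p \<and> u \<noteq> v})"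
proof (cases "card S = 0")
  case True
  have "finite S" using presentsD(1)[OF assms(2)] by (rule finite_subset) simp
  then have "S = {}" using True by simp
  then show ?thesis using assms(2) by (simp add: presents_def)
next
  case False
  note P = assms(2)
  have p: "1 < p" using assms(1) by (rule prime_gt_1_nat)
  have "S = {1..<int p}"
    using presentsD(1)[OF P] assms(3) False by (intro card_seteq) auto
  have "(u, v) \<in> E \<longleftrightarrow> u < p \<and> v < p \<and> u \<noteq> v" for u v
  proof (cases "u < p \<and> v < p")
    case True
    then obtain x y where xy: "u = \<omega> x" "v = \<omega> y" using presentsD(4)[OF P] by metis
    have "0 < int p" using p by simp
    then have r: "0 \<le> (y - x) mod int p" "(y - x) mod int p < int p"
      by (rule pos_mod_sign, rule pos_mod_bound)
    have "(y - x) mod int p \<in> S \<longleftrightarrow> (y - x) mod int p \<noteq> 0"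
      unfolding \<open>S = {1..<int p}\<close> atLeastLessThan_iff using r by linarith
    also have "\<dots> \<longleftrightarrow> \<not> [y = x] (mod int p)"
      unfolding cong_iff_dvd_diff dvd_eq_mod_eq_0 ..
    also have "\<dots> \<longleftrightarrow> u \<noteq> v" unfolding xy presentsD(2)[OF P] by (simp only: cong_sym_eq)
    finally show ?thesis using True presents_arc[OF P, of x y] unfolding xy by blast
  next
    case False
    then show ?thesis using presents_arc_less[OF P, of u v] by auto
  qed
  then show ?thesis using False by auto
qed

lemma relabel_eqI:
  assumes "bij_betw f (pverts G) (pverts H)" "parcs H = (\<lambda>(u, v). (f u, f v)) ` parcs G"
    and "parcs G \<subseteq> pverts G \<times> pverts G" and "\<And>v. v \<in> pverts G \<Longrightarrow> l' (f v) = l v"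
  shows "relabel l G = relabel l' H"
proof -
  have "pverts H = f ` pverts G" using assms(1) by (simp add: bij_betw_def)
  then have "l ` pverts G = l' ` pverts H" using assms(4) by (simp add: image_image)
  moreover have "(\<lambda>(u, v). (l u, l v)) ` parcs G = (\<lambda>(u, v). (l' u, l' v)) ` parcs H"
    unfolding assms(2) image_image using assms(3,4) by (intro image_cong) auto
  ultimately show ?thesis by (simp add: relabel_def)
qed

lemma canonical_labeling_canonical_label:
  "canonical_labeling (\<Union>p \<in> {p. prime p}. circulant_graphs p) canonical_label"
  unfolding canonical_labeling_def
proof (intro conjI ballI impI)
  fix G assume "G \<in> (\<Union>p \<in> {p. prime p}. circulant_graphs p)"
  then obtain p where p: "prime p" "G \<in> circulant_graphs p" by blast
  have p0: "0 < p" using p(1) by (rule prime_gt_0_nat)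
  have V: "pverts G = {..<p}" by (rule circulant_presents(1)[OF p0 p(2)])
  obtain S \<omega> where P: "presents p S \<omega> (parcs G)" "\<omega> 0 = 0" using circulant_presents(2)[OF p0 p(2)] by blast
  show "bij_betw (canonical_label G) (pverts G) {1..card (pverts G)}"
  proof (cases "0 < graph_degree G \<and> graph_degree G + 1 < p")
    case True
    then have "canonical_label G = (\<lambda>v. Suc (fst (second_refinement p (parcs G)) v))"
      by (auto simp: canonical_label_def V Let_def)
    then show ?thesis
      using nontrivial_circulant.second_refinement_bij[OF nontrivialI[OF p(1) P]] True V by simp
  next
    case False
    then have "canonical_label G = Suc"
      by (auto simp: canonical_label_def V Let_def)
    then show ?thesis using V by (simp add: bij_betw_def lessThan_atLeast0 image_Suc_atLeastLessThan atLeastLessThanSuc_atLeastAtMost)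
  qed
next
  fix G H assume "G \<in> (\<Union>p \<in> {p. prime p}. circulant_graphs p)" "H \<in> (\<Union>p \<in> {p. prime p}. circulant_graphs p)"
    and iso: "digraph_iso (with_proj G) (with_proj H)"
  then obtain p q where p: "prime p" "G \<in> circulant_graphs p" and q: "prime q" "H \<in> circulant_graphs q" by blast
  obtain f where f: "bij_betw f (pverts G) (pverts H)" "parcs H = (\<lambda>(u, v). (f u, f v)) ` parcs G"
    "parcs G \<subseteq> pverts G \<times> pverts G" using iso by (rule digraph_iso_with_proj)
  have p0: "0 < p" using p(1) by (rule prime_gt_0_nat)
  have q0: "0 < q" using q(1) by (rule prime_gt_0_nat)
  have V: "pverts G = {..<p}" by (rule circulant_presents(1)[OF p0 p(2)])
  have "pverts H = {..<q}" by (rule circulant_presents(1)[OF q0 q(2)])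
  moreover from this have "p = q" using bij_betw_same_card[OF f(1)] V by simp
  ultimately have V': "pverts H = {..<p}" and qp: "q = p" by auto
  obtain S \<omega> where P: "presents p S \<omega> (parcs G)" "\<omega> 0 = 0" using circulant_presents(2)[OF p0 p(2)] by blast
  obtain S' \<omega>' where P': "presents p S' \<omega>' (parcs H)" "\<omega>' 0 = 0"
    using circulant_presents(2)[OF q0 q(2)] qp by blast
  have bij: "bij_betw f {..<p} {..<p}" using f(1) V V' by simp
  have inj: "f u = f v \<longleftrightarrow> u = v" if "u < p" "v < p" for u v
    using bij that by (auto simp: bij_betw_def inj_on_def)
  have ri: "refinement_iso p (parcs G) (parcs H) f"
  proof
    show "bij_betw f {..<p} {..<p}" by fact
    show "(f u, f v) \<in> parcs H \<longleftrightarrow> (u, v) \<in> parcs G" if "u < p" "v < p" for u v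
    proof
      assume "(f u, f v) \<in> parcs H"
      then obtain a b where ab: "(a, b) \<in> parcs G" "f u = f a" "f v = f b" unfolding f(2) by auto
      then have "a < p" "b < p" using f(3) V by auto
      then have "u = a" "v = b" using ab(2,3) inj that by blast+
      then show "(u, v) \<in> parcs G" using ab(1) by simp
    next
      assume "(u, v) \<in> parcs G"
      then have "(\<lambda>(u, v). (f u, f v)) (u, v) \<in> parcs H" unfolding f(2) by (rule imageI)
      then show "(f u, f v) \<in> parcs H" by simp
    qed
  qed
  have deg: "graph_degree G = card S" "graph_degree H = card S'"
    unfolding graph_degree_def using presents_out_degree[OF P(1) p0] presents_out_degree[OF P'(1) p0] by auto
  have same: "card S' = card S"
  proof -
    have "hits (parcs H) (f ` {..<p}) (f 0) = hits (parcs G) {..<p} 0"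
      using refinement_iso.hits_related[OF ri, of "{..<p}" 0] p0 by simp
    moreover have "f ` {..<p} = {..<p}" "f 0 < p" using bij p0 by (auto simp: bij_betw_def)
    ultimately show ?thesis using presents_regular[OF P(1) p0] presents_regular[OF P'(1)] by simp
  qed
  show "relabel (canonical_label G) G = relabel (canonical_label H) H"
  proof (cases "0 < card S \<and> card S + 1 < p")
    case True
    have cl: "canonical_label G = (\<lambda>v. Suc (fst (second_refinement p (parcs G)) v))"
      "canonical_label H = (\<lambda>v. Suc (fst (second_refinement p (parcs H)) v))"
      using True by (auto simp: canonical_label_def V V' Let_def deg same)
    have "nontrivial_circulant p S \<omega> (parcs G)" "nontrivial_circulant p S' \<omega>' (parcs H)"
      using True by (auto intro!: nontrivialI p(1) P P' simp: deg same)
    from second_refinement_canonical[OF this ri] obtain \<theta> where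
      \<theta>: "refinement_iso p (parcs G) (parcs H) \<theta>"
        "\<forall>v<p. fst (second_refinement p (parcs H)) (\<theta> v) = fst (second_refinement p (parcs G)) v" by blast
    interpret \<theta>: refinement_iso p "parcs G" "parcs H" \<theta> by (rule \<theta>(1))
    have subH: "parcs H \<subseteq> {..<p} \<times> {..<p}" using presents_arc_less[OF P'(1)] by auto
    have "parcs H = (\<lambda>(u, v). (\<theta> u, \<theta> v)) ` parcs G"
    proof (intro equalityI subsetI)
      fix e assume e: "e \<in> parcs H"
      obtain u' v' where uv': "e = (u', v')" by (cases e)
      then have "u' < p" "v' < p" using e subH by auto
      then obtain u v where uv: "u < p" "u' = \<theta> u" "v < p" "v' = \<theta> v" using \<theta>.\<phi>_surj by metis
      then have "(u, v) \<in> parcs G" using e uv' \<theta>.arcs by simp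
      then show "e \<in> (\<lambda>(u, v). (\<theta> u, \<theta> v)) ` parcs G" using uv uv' by force
    next
      fix e assume "e \<in> (\<lambda>(u, v). (\<theta> u, \<theta> v)) ` parcs G"
      then obtain u v where "(u, v) \<in> parcs G" "e = (\<theta> u, \<theta> v)" by auto
      moreover from this have "u < p" "v < p" using f(3) V by auto
      ultimately show "e \<in> parcs H" using \<theta>.arcs by simp
    qed
    then show ?thesis
      by (intro relabel_eqI[where f = \<theta>]) (use \<theta>.bij V V' f(3) \<theta>(2) in \<open>auto simp: cl\<close>)
  next
    case False
    then have cl: "canonical_label G = Suc" "canonical_label H = Suc"
      by (auto simp: canonical_label_def V V' Let_def deg same)
    have "parcs G = parcs H"
      using trivial_arcs[OF p(1) P(1)] trivial_arcs[OF p(1) P'(1)] False same by auto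
    then show ?thesis using V V' cl by (simp add: relabel_def)
  qed
qed

subsection \<open>A program for the word RAM\<close>

definition labeling_program :: prog where
  "labeling_program = (Assign 1 (Mem (Const 0)) ;; Assign 2 (Mem (Const 1))) ;;
     If (And (Less (Const 0) (Reg 2)) (Less (Reg 2 \<^bold>+ Const 1) (Reg 1)))
       canonize (output_with (Reg rI))"

lemma nth_concat_uniform:
  assumes "\<And>x. x \<in> set xss \<Longrightarrow> length x = m" "u < length xss" "i < m"
  shows "concat xss ! (u * m + i) = xss ! u ! i"
  using assms
proof (induction xss arbitrary: u)
  case (Cons x xss)
  then show ?case by (cases u) (simp_all add: nth_append algebra_simps)
qed simp

lemma output_identity:
  assumes s: "reg s 1 = p" and W: "p + 1 < W" "4 < W"
  shows "runs W (output_with (Reg rI)) s (40 * p + 40) (\<lambda>s'. \<forall>v<p. mem s' v = Suc v)"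
proof -
  define I where "I = (\<lambda>i (s' :: state). reg s' 1 = p \<and> reg s' rI = i \<and> (\<forall>v<i. mem s' v = Suc v))"
  have r1: "runs W (Assign rI (Const 0)) s 2 (I 0)"
    using s W by (intro runs_straight) (auto simp: I_def)
  let ?b = "Less (Reg rI) (Reg 1)"
  let ?body = "Store (Reg rI) (Reg rI \<^bold>+ Const 1) ;; Assign rI (Reg rI \<^bold>+ Const 1)"
  have r2: "runs W (While ?b ?body) s' ((\<Sum>i<p. 20) + (p + 1) * (cond_cost ?b + 1)) (I p)" if "I 0 s'" for s'
  proof (rule runs_While_count)
    show "I 0 s'" by fact
  next
    fix s' assume "I p s'"
    then show "cond_fits W s' ?b \<and> \<not> cond_val s' ?b" using W by (simp add: I_def)
  next
    fix s' i assume I: "I i s'" and i: "i < p"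
    have "wpl W ?body (I (Suc i)) s'"
      using I i W by (auto simp: I_def less_Suc_eq)
    then have "runs W ?body s' 20 (I (Suc i))" by (rule runs_straight) simp
    then show "cond_fits W s' ?b \<and> cond_val s' ?b \<and> runs W ?body s' 20 (I (Suc i))"
      using I i W by (simp add: I_def)
  qed
  have "runs W (output_with (Reg rI)) s (2 + ((\<Sum>i<p. 20) + (p + 1) * (cond_cost ?b + 1))) (I p)"
    unfolding output_with_def by (rule runs_Seq[OF r1 r2])
  then show ?thesis by (rule runs_weaken) (auto simp: I_def)
qed

text \<open>
  Words below \<open>p ^ 8\<close> are large enough for all addresses, as \<open>64 * p ^ 2 \<le> p ^ 8\<close> already for
  \<open>p = 2\<close>. The constant 20000 leaves room for reading the parameters and for the output.
\<close>

lemma labeling_program_correct: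
  assumes p: "prime p" and G: "G \<in> circulant_graphs p"
    and deg: "\<forall>v \<in> pverts G. out_degree (with_proj G) v = \<Delta>"
  shows "computes_labeling_within labeling_program 8 canonical_label G
    (20000 * real (max 1 \<Delta>) * real p * log 2 (real p))"
  unfolding computes_labeling_within_def
proof (intro allI impI)
  fix adj assume adj: "adjacency_lists G adj"
  have p1: "1 < p" using p by (rule prime_gt_1_nat)
  then have p0: "0 < p" by simp
  have V: "pverts G = {..<p}" by (rule circulant_presents(1)[OF p0 G])
  obtain S \<omega> where P: "presents p S \<omega> (parcs G)" "\<omega> 0 = 0" using circulant_presents(2)[OF p0 G] by blast
  have arcsub: "u < p \<and> v < p" if "(u, v) \<in> parcs G" for u v
    using presents_arc_less[OF P(1) that] by simp
  have Sfin: "finite S" using presentsD(1)[OF P(1)] by (rule finite_subset) simp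
  have out: "out_degree (with_proj G) v = card S" if "v < p" for v
  proof -
    have "out_arcs (with_proj G) v = Pair v ` {w. (v, w) \<in> parcs G}"
      by (auto simp: out_arcs_def)
    then have "out_degree (with_proj G) v = card {w. (v, w) \<in> parcs G}"
      unfolding out_degree_def by (simp add: card_image inj_on_def)
    then show ?thesis using presents_out_degree[OF P(1) that] by simp
  qed
  have \<Delta>: "\<Delta> = card S" using deg out[of 0] p0 V by auto
  have gd: "graph_degree G = \<Delta>" unfolding graph_degree_def \<Delta> by (rule presents_out_degree[OF P(1) p0])
  have \<Delta>p: "\<Delta> < p"
  proof -
    have "card S \<le> card {1..<int p}" using presentsD(1)[OF P(1)] by (intro card_mono) auto
    then show ?thesis using p1 by (simp add: \<Delta>)
  qed
  have "{0..<length adj} = {..<p}" using adj V by (simp add: adjacency_lists_def)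
  from arg_cong[OF this, of card] have la: "length adj = p" by simp
  have A: "distinct (adj ! v)" "set (adj ! v) = {w. (v, w) \<in> parcs G}" if "v < p" for v
    using adj that unfolding adjacency_lists_def la by blast+
  have ll: "length (adj ! v) = \<Delta>" if "v < p" for v
    using distinct_card[OF A(1)[OF that]] A(2)[OF that] presents_out_degree[OF P(1) that] by (simp add: \<Delta>)
  let ?enc = "encode_adjacency adj"
  let ?rows = "map (\<lambda>ns. length ns # ns) adj"
  have rows: "length x = \<Delta> + 1" if "x \<in> set ?rows" for x
    using that ll la by (auto simp: in_set_conv_nth)
  have len: "length ?enc = 1 + p * (\<Delta> + 1)"
  proof -
    have "length (concat ?rows) = sum_list (map length ?rows)" by (simp add: length_concat)
    also have "map length ?rows = map (\<lambda>_. \<Delta> + 1) ?rows" by (intro map_cong refl rows)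
    also have "\<dots> = replicate p (\<Delta> + 1)" by (simp add: map_replicate_const la)
    finally show ?thesis by (simp add: encode_adjacency_def sum_list_replicate)
  qed
  have entry: "?enc ! (1 + (u * (\<Delta> + 1) + i)) = (length (adj ! u) # adj ! u) ! i" if "u < p" "i < \<Delta> + 1" for u i
  proof -
    have "concat ?rows ! (u * (\<Delta> + 1) + i) = ?rows ! u ! i"
      using that la by (intro nth_concat_uniform rows) auto
    then show ?thesis using that la by (simp add: encode_adjacency_def)
  qed
  have in_len: "1 + (u * (\<Delta> + 1) + i) < length ?enc" if "u < p" "i < \<Delta> + 1" for u i
  proof -
    have "u * (\<Delta> + 1) + (\<Delta> + 1) = (u + 1) * (\<Delta> + 1)" by simp
    also have "\<dots> \<le> p * (\<Delta> + 1)" using that by (intro mult_le_mono) auto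
    finally show ?thesis using that unfolding len by linarith
  qed
  let ?s = "init_state ?enc"
  have m0: "mem ?s 0 = p" using len by (simp add: init_state_def encode_adjacency_def la)
  have m1: "mem ?s 1 = \<Delta>" using in_len[OF p0, of 0] entry[OF p0, of 0] ll[OF p0] by (simp add: init_state_def)
  have minp: "mem ?s (2 + u * (\<Delta> + 1) + j) = adj ! u ! j" if "u < p" "j < \<Delta>" for u j
    using in_len[of u "Suc j"] entry[of u "Suc j"] that by (simp add: init_state_def)
  have mz: "mem ?s a = 0" if "length ?enc \<le> a" for a using that by (simp add: init_state_def)
  have cp: "card (pverts G) = p" using V by simp
  define W where "W = p ^ 8"
  have W2: "p * p * 64 \<le> W"
  proof -
    have "(2::nat) ^ 6 \<le> p ^ 6" using p1 by (intro power_mono) auto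
    then have "p * p * 2 ^ 6 \<le> p * p * p ^ 6" by (rule mult_le_mono2)
    also have "\<dots> = W" by (simp add: W_def power_numeral_reduce)
    finally show ?thesis by simp
  qed
  have pp: "2 * p \<le> p * p" using p1 by simp
  have Wb: "p + 1 < W" "4 < W" "\<Delta> + 1 < W" "p < W" "\<Delta> < W" using W2 pp p1 \<Delta>p by linarith+
  define Q where "Q = (\<lambda>s' :: state. reg s' 1 = p \<and> reg s' 2 = \<Delta> \<and> mem s' = mem ?s)"
  have r1: "runs W (Assign 1 (Mem (Const 0)) ;; Assign 2 (Mem (Const 1))) ?s 10 Q"
    using m0 m1 Wb by (intro runs_straight) (auto simp: Q_def)
  let ?b = "And (Less (Const 0) (Reg 2)) (Less (Reg 2 \<^bold>+ Const 1) (Reg 1))"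
  have l1: "1 \<le> log 2 (real p)" using p1 by (simp add: le_log_iff)
  define B where "B = 11000 * real (max 1 \<Delta>) * real p * log 2 (real p)"
  have p_le: "real p \<le> real (max 1 \<Delta>) * real p * log 2 (real p)"
  proof -
    have "real p * 1 \<le> real p * (real (max 1 \<Delta>) * log 2 (real p))"
      using l1 mult_mono[of 1 "real (max 1 \<Delta>)" 1 "log 2 (real p)"] by (intro mult_left_mono) auto
    then show ?thesis by (simp add: ac_simps)
  qed
  \<comment> \<open>Time bounds of programs are natural numbers.\<close>
  define N where "N = nat \<lfloor>B\<rfloor>"
  have B80: "real (40 * p + 40) \<le> B"
  proof -
    have "real (40 * p + 40) \<le> 80 * real p" using p1 by simp
    also have "\<dots> \<le> 11000 * (real (max 1 \<Delta>) * real p * log 2 (real p))" using p_le p1 by linarith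
    finally show ?thesis by (simp only: B_def mult.assoc)
  qed
  have N_ge: "T \<le> N" if "real T \<le> B" for T unfolding N_def using that by (simp add: le_nat_floor)
  have r2: "runs W (If ?b canonize (output_with (Reg rI))) s1 (cond_cost ?b + 1 + N)
      (\<lambda>s'. \<forall>v<p. mem s' v = canonical_label G v)" if s1: "Q s1" for s1
  proof (rule runs_If)
    show "cond_fits W s1 ?b" using s1 Wb by (simp add: Q_def)
  next
    assume "cond_val s1 ?b"
    then have nt: "0 < \<Delta>" "\<Delta> + 1 < p" using s1 by (auto simp: Q_def)
    have "3 * 3 \<le> p * p" using nt by (intro mult_le_mono) auto
    then have "20 * (p * p) + 100 \<le> W" using W2 by linarith
    then interpret refinement_run W p \<Delta> adj
      using nt ll A arcsub by unfold_locales auto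
    have EG: "E = parcs G" using A arcsub by (auto simp: E_def)
    have "1 + p * (\<Delta> + 1) \<le> base"
    proof -
      have "p * (\<Delta> + 1) \<le> p * p" using \<Delta>p by (intro mult_le_mono) auto
      then show ?thesis using p0 by (simp add: base_def)
    qed
    then have zero: "base \<le> a \<Longrightarrow> mem s1 a = 0" for a using mz s1 by (simp add: Q_def len)
    have "hits E {..<p} v = \<Delta>" if "v < p" for v unfolding EG \<Delta> using presents_regular[OF P(1) that] .
    then obtain T where T: "real T \<le> 11000 * real \<Delta> * real p * log 2 (real p)"
      "runs W canonize s1 T (\<lambda>s'. \<forall>v<p. mem s' v = Suc (fst (second_refinement p E) v))"
      using canonize_correct[of s1] s1 minp zero by (auto simp: Q_def)
    have "T \<le> N" using T(1) nt by (intro N_ge) (simp add: B_def max_def)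
    with T(2) show "runs W canonize s1 N (\<lambda>s'. \<forall>v<p. mem s' v = canonical_label G v)"
      by (rule runs_weaken) (use nt in \<open>simp add: canonical_label_def cp gd EG\<close>)
  next
    assume "\<not> cond_val s1 ?b"
    then have nt: "\<not> (0 < \<Delta> \<and> \<Delta> + 1 < p)" using s1 by (auto simp: Q_def)
    have "runs W (output_with (Reg rI)) s1 (40 * p + 40) (\<lambda>s'. \<forall>v<p. mem s' v = Suc v)"
      using s1 Wb by (intro output_identity) (auto simp: Q_def)
    then show "runs W (output_with (Reg rI)) s1 N (\<lambda>s'. \<forall>v<p. mem s' v = canonical_label G v)"
      using N_ge[OF B80] by (rule runs_weaken) (use nt in \<open>auto simp: canonical_label_def cp gd\<close>)
  qed
  have "runs W labeling_program ?s (10 + (cond_cost ?b + 1 + N)) (\<lambda>s'. \<forall>v<p. mem s' v = canonical_label G v)"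
    unfolding labeling_program_def by (rule runs_Seq[OF r1 r2])
  then obtain t s where t: "exec W labeling_program ?s t s" "t \<le> 10 + (cond_cost ?b + 1 + N)"
    "\<forall>v<p. mem s v = canonical_label G v" by (rule runsE)
  have B0: "0 \<le> B" using B80 by linarith
  have "real t \<le> 10 + (real (cond_cost ?b) + 1 + B)"
  proof -
    have "real N \<le> B" unfolding N_def using B0 by simp
    moreover have "real t \<le> real (10 + (cond_cost ?b + 1 + N))" using t(2) by (simp only: of_nat_le_iff)
    ultimately show ?thesis by simp
  qed
  also have "\<dots> \<le> 20000 * real (max 1 \<Delta>) * real p * log 2 (real p)"
  proof -
    have "real (cond_cost ?b) \<le> 10" by simp
    moreover have "21 \<le> 9000 * real p" using p1 by simp
    ultimately show ?thesis
      using p_le unfolding B_def mult.assoc[of 11000] mult.assoc[of 20000] mult.assoc[of _ "real p"] by linarith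
  qed
  finally show "\<exists>t s. exec (card (pverts G) ^ 8) labeling_program ?s t s \<and>
      real t \<le> 20000 * real (max 1 \<Delta>) * real p * log 2 (real p) \<and> (\<forall>v \<in> pverts G. mem s v = canonical_label G v)"
    using t cp V unfolding W_def by auto
qed

theorem corollary5:
  shows "\<exists>(lab :: nat pair_pre_digraph \<Rightarrow> nat \<Rightarrow> nat) (c :: prog) (k :: nat) (C :: real).
    canonical_labeling (\<Union>p \<in> {p. prime p}. circulant_graphs p) lab \<and>
    (\<forall>(p :: nat) (\<Delta> :: nat) G. prime p \<longrightarrow> G \<in> circulant_graphs p \<longrightarrow>
      (\<forall>v \<in> pverts G. out_degree (with_proj G) v = \<Delta>) \<longrightarrow>
      computes_labeling_within c k lab G (C * real (max 1 \<Delta>) * real p * log 2 (real p)))"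
  using canonical_labeling_canonical_label labeling_program_correct by blast

end
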